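(* Let $\theta\in(0,1)$ and let $\eta,\xi\in\mathcal F_\theta(E^\infty,\mathbb R)$ with $\xi\ge0$. Suppose there exists a unique $\delta\in\mathbb R$ with $P(\eta-\delta\xi)=0$, let $t^*=\sup\{t\in\mathbb R:\eta+t\xi\text{ is summable}\}$, and suppose that $-\delta<t^*$. (i) If $\xi$ is non-lattice, then $z\mapsto(\mathrm{Id}-\mathcal L_{\eta+z\xi})^{-1}\in\mathcal B(\mathcal F_\theta^b(E^\infty))$ is holomorphic in a neighbourhood of every $z$ on the line $\mathrm{Re}(z)=-\delta$ except for $z=-\delta$. (ii) If $\xi$ is integer-valued but there does not exist any $\psi\in\mathcal C(E^\infty)$ such that the range of $\xi-\psi+\psi\circ\sigma$ is contained in a proper subgroup of $\mathbb Z$, then $z\mapsto(\mathrm{Id}-\mathcal L_{\eta+z\xi})^{-1}$ is $2\pi\mathbf{i}$-periodic, and holomorphic at every $z$ on the line $\mathrm{Re}(z)=-\delta$ such that $\mathrm{Im}(z)/(2\pi)$ is not an integer.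
   Context: Let $I\subset\mathbb N$ be an at most countable alphabet, $A\colon I\times I\to\{0,1\}$ an incidence matrix, $E^\infty=\{\omega\in I^{\mathbb N}: A_{\omega_j\omega_{j+1}}=1\ \forall j\ge 1\}$ with the subspace topology of the product of discrete topologies, $E^n$ the set of subwords of length $n$ of elements of $E^\infty$, $E^*=\bigcup_{n\ge0}E^n$ ($E^0$ contains only the empty word). Standing assumption: $A$ is finitely irreducible, i.e. there is a finite set $\Lambda\subset E^*$ such that for all $i,j\in I$ there is $\omega\in\Lambda$ with $i\omega j\in E^*$. $\sigma$ is the left shift on $E^\infty$; $[\omega]$ is the cylinder set of $\omega\in E^n$; $S_nf=\sum_{j=0}^{n-1}f\circ\sigma^j$. The pressure of $u\colon E^\infty\to\mathbb R$ is $P(u)=\lim_{n\to\infty}\frac1n\log\sum_{\omega\in E^n}\exp(\sup_{\tau\in[\omega]}S_nu(\tau))$. $\mathcal C(E^\infty)$, $\mathcal C(E^\infty,\mathbb R)$: continuous complex-/real-valued functions. For $f\in\mathcal C(E^\infty)$, $\mathrm{var}_n(f)=\sup\{|f(x)-f(y)|: x_i=y_i\text{ for }i\le n\}$ and $\|f\|_\theta=\sup_{n\ge1}\mathrm{var}_n(f)/\theta^n$. $\mathcal F_\theta(E^\infty,\mathbb R)$: real continuous functions with $\|f\|_\theta<\infty$ (possibly unbounded). $\mathcal F_\theta^b(E^\infty)$: bounded continuous complex functions with $\|f\|_\theta<\infty$, a Banach space under $\|\cdot\|_\theta+\|\cdot\|_\infty$; $\mathcal B(\mathcal F_\theta^b(E^\infty))$: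 bounded linear operators on it. A real-valued $u\in\mathcal F_\theta(E^\infty,\mathbb R)$ is summable if $\sum_{e\in I}\exp(\sup(u|_{[e]}))<\infty$. For $f=u+\mathbf{i}v$ with $u,v\in\mathcal F_\theta(E^\infty,\mathbb R)$ and $u$ summable, $\mathcal L_f(g)(\omega)=\sum_{y:\sigma y=\omega}e^{f(y)}g(y)$; thus $\mathcal L_{\eta+z\xi}\in\mathcal B(\mathcal F_\theta^b(E^\infty))$ for $\mathrm{Re}(z)<t^*$. $\xi\in\mathcal C(E^\infty,\mathbb R)$ is lattice if there is $\psi\in\mathcal C(E^\infty,\mathbb R)$ such that the range of $\xi-\psi+\psi\circ\sigma$ lies in a discrete subgroup of $\mathbb R$; otherwise $\xi$ is non-lattice. *)

theory Defs
  imports "HOL-Analysis.Analysis" "HOL-Algebra.Elementary_Groups"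
begin

section \<open>Countable Markov shifts\<close>

text \<open>Sequences are indexed from 0. The type \<^typ>\<open>nat \<Rightarrow> nat\<close> carries the product topology of the
  discrete spaces \<^typ>\<open>nat\<close>, so \<^term>\<open>continuous_on E\<close> refers to the subspace topology on the
  shift space. Most notions below take the shift space as a parameter \<open>E\<close>; functions on it are
  total functions of which only the values on \<open>E\<close> matter.\<close>

definition shift_space :: "nat set \<Rightarrow> (nat \<Rightarrow> nat \<Rightarrow> nat) \<Rightarrow> (nat \<Rightarrow> nat) set" where
  "shift_space I A = {\<omega>. (\<forall>j. \<omega> j \<in> I) \<and> (\<forall>j. A (\<omega> j) (\<omega> (Suc j)) = 1)}"

definition shift :: "(nat \<Rightarrow> nat) \<Rightarrow> nat \<Rightarrow> nat" where
  "shift \<omega> = (\<lambda>j. \<omega> (Suc j))"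

definition words :: "(nat \<Rightarrow> nat) set \<Rightarrow> nat \<Rightarrow> nat list set" where
  "words E n = {map \<omega> [k..<k + n] |\<omega> k. \<omega> \<in> E}"

definition all_words :: "(nat \<Rightarrow> nat) set \<Rightarrow> nat list set" where
  "all_words E = (\<Union>n. words E n)"

definition cylinder :: "(nat \<Rightarrow> nat) set \<Rightarrow> nat list \<Rightarrow> (nat \<Rightarrow> nat) set" where
  "cylinder E w = {\<tau> \<in> E. \<forall>i < length w. \<tau> i = w ! i}"

definition finitely_irreducible :: "nat set \<Rightarrow> (nat \<Rightarrow> nat \<Rightarrow> nat) \<Rightarrow> bool" where
  "finitely_irreducible I A \<longleftrightarrow>
     (\<exists>\<Lambda>. finite \<Lambda> \<and> \<Lambda> \<subseteq> all_words (shift_space I A) \<and>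
        (\<forall>i\<in>I. \<forall>j\<in>I. \<exists>w\<in>\<Lambda>. [i] @ w @ [j] \<in> all_words (shift_space I A)))"

definition birkhoff_sum :: "nat \<Rightarrow> ((nat \<Rightarrow> nat) \<Rightarrow> real) \<Rightarrow> (nat \<Rightarrow> nat) \<Rightarrow> real" where
  "birkhoff_sum n f \<omega> = (\<Sum>j<n. f ((shift ^^ j) \<omega>))"

section \<open>Pressure and summability\<close>

definition exp_ext :: "ereal \<Rightarrow> ennreal" where
  "exp_ext x = (if x = -\<infinity> then 0 else if x = \<infinity> then \<infinity> else ennreal (exp (real_of_ereal x)))"

definition ln_ext :: "ennreal \<Rightarrow> ereal" where
  "ln_ext x = (if x = 0 then -\<infinity> else if x = \<infinity> then \<infinity> else ereal (ln (enn2real x)))"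

definition partition_sum :: "(nat \<Rightarrow> nat) set \<Rightarrow> ((nat \<Rightarrow> nat) \<Rightarrow> real) \<Rightarrow> nat \<Rightarrow> ennreal" where
  "partition_sum E u n =
     (\<Sum>\<^sub>\<infinity>w\<in>words E n. exp_ext (SUP \<tau>\<in>cylinder E w. ereal (birkhoff_sum n u \<tau>)))"

text \<open>The limit exists whenever the shift is finitely irreducible and \<open>u\<close> has a finite
  \<open>\<theta>\<close>-seminorm, so the value of \<^const>\<open>lim\<close> on divergent sequences plays no role.\<close>

definition pressure :: "(nat \<Rightarrow> nat) set \<Rightarrow> ((nat \<Rightarrow> nat) \<Rightarrow> real) \<Rightarrow> ereal" where
  "pressure E u = lim (\<lambda>n. ereal (1 / real n) * ln_ext (partition_sum E u n))"

definition summable_potential :: "nat set \<Rightarrow> (nat \<Rightarrow> nat) set \<Rightarrow> ((nat \<Rightarrow> nat) \<Rightarrow> real) \<Rightarrow> bool" where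
  "summable_potential I E u \<longleftrightarrow>
     (\<Sum>\<^sub>\<infinity>e\<in>I. exp_ext (SUP \<tau>\<in>cylinder E [e]. ereal (u \<tau>))) < \<infinity>"

definition critical_exponent ::
  "nat set \<Rightarrow> (nat \<Rightarrow> nat) set \<Rightarrow> ((nat \<Rightarrow> nat) \<Rightarrow> real) \<Rightarrow> ((nat \<Rightarrow> nat) \<Rightarrow> real) \<Rightarrow> ereal" where
  "critical_exponent I E \<eta> \<xi> =
     Sup {ereal t |t. summable_potential I E (\<lambda>x. \<eta> x + t * \<xi> x)}"

section \<open>Function spaces\<close>

definition variation :: "(nat \<Rightarrow> nat) set \<Rightarrow> nat \<Rightarrow> ((nat \<Rightarrow> nat) \<Rightarrow> 'a::real_normed_vector) \<Rightarrow> ennreal" where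
  "variation E n f =
     Sup {ennreal (norm (f x - f y)) |x y. x \<in> E \<and> y \<in> E \<and> (\<forall>i<n. x i = y i)}"

definition theta_seminorm ::
  "real \<Rightarrow> (nat \<Rightarrow> nat) set \<Rightarrow> ((nat \<Rightarrow> nat) \<Rightarrow> 'a::real_normed_vector) \<Rightarrow> ennreal" where
  "theta_seminorm \<theta> E f = (SUP n\<in>{1..}. variation E n f / ennreal (\<theta> ^ n))"

definition sup_norm :: "(nat \<Rightarrow> nat) set \<Rightarrow> ((nat \<Rightarrow> nat) \<Rightarrow> 'a::real_normed_vector) \<Rightarrow> ennreal" where
  "sup_norm E f = (SUP x\<in>E. ennreal (norm (f x)))"

definition theta_functions :: "real \<Rightarrow> (nat \<Rightarrow> nat) set \<Rightarrow> ((nat \<Rightarrow> nat) \<Rightarrow> real) set" where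
  "theta_functions \<theta> E = {f. continuous_on E f \<and> theta_seminorm \<theta> E f < \<infinity>}"

text \<open>Elements of the Banach space are normalised to vanish off \<open>E\<close>, so that equality of total
  functions is equality of functions on \<open>E\<close>.\<close>

definition bounded_theta_functions :: "real \<Rightarrow> (nat \<Rightarrow> nat) set \<Rightarrow> ((nat \<Rightarrow> nat) \<Rightarrow> complex) set" where
  "bounded_theta_functions \<theta> E =
     {g. continuous_on E g \<and> bounded (g ` E) \<and> theta_seminorm \<theta> E g < \<infinity> \<and> (\<forall>x. x \<notin> E \<longrightarrow> g x = 0)}"

definition banach_norm :: "real \<Rightarrow> (nat \<Rightarrow> nat) set \<Rightarrow> ((nat \<Rightarrow> nat) \<Rightarrow> complex) \<Rightarrow> ennreal" where
  "banach_norm \<theta> E g = theta_seminorm \<theta> E g + sup_norm E g"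

section \<open>Operators\<close>

type_synonym fun_op = "((nat \<Rightarrow> nat) \<Rightarrow> complex) \<Rightarrow> (nat \<Rightarrow> nat) \<Rightarrow> complex"

text \<open>Operators are total maps of which only the restriction to
  \<^term>\<open>bounded_theta_functions \<theta> E\<close> matters.\<close>

definition op_norm :: "real \<Rightarrow> (nat \<Rightarrow> nat) set \<Rightarrow> fun_op \<Rightarrow> ennreal" where
  "op_norm \<theta> E T =
     (SUP g\<in>{g \<in> bounded_theta_functions \<theta> E. banach_norm \<theta> E g \<le> 1}. banach_norm \<theta> E (T g))"

definition bounded_operators :: "real \<Rightarrow> (nat \<Rightarrow> nat) set \<Rightarrow> fun_op set" where
  "bounded_operators \<theta> E =
     {T. (\<forall>g\<in>bounded_theta_functions \<theta> E. T g \<in> bounded_theta_functions \<theta> E) \<and>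
         (\<forall>g\<in>bounded_theta_functions \<theta> E. \<forall>h\<in>bounded_theta_functions \<theta> E.
            T (\<lambda>x. g x + h x) = (\<lambda>x. T g x + T h x)) \<and>
         (\<forall>c. \<forall>g\<in>bounded_theta_functions \<theta> E. T (\<lambda>x. c * g x) = (\<lambda>x. c * T g x)) \<and>
         op_norm \<theta> E T < \<infinity>}"

definition transfer_op :: "(nat \<Rightarrow> nat) set \<Rightarrow> ((nat \<Rightarrow> nat) \<Rightarrow> complex) \<Rightarrow> fun_op" where
  "transfer_op E f g =
     (\<lambda>\<omega>. if \<omega> \<in> E then (\<Sum>\<^sub>\<infinity>y\<in>{y \<in> E. shift y = \<omega>}. exp (f y) * g y) else 0)"

definition id_minus_transfer ::
  "(nat \<Rightarrow> nat) set \<Rightarrow> ((nat \<Rightarrow> nat) \<Rightarrow> real) \<Rightarrow> ((nat \<Rightarrow> nat) \<Rightarrow> real) \<Rightarrow> complex \<Rightarrow> fun_op" where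
  "id_minus_transfer E \<eta> \<xi> z g =
     (\<lambda>x. g x - transfer_op E (\<lambda>y. of_real (\<eta> y) + z * of_real (\<xi> y)) g x)"

definition invertible_op :: "real \<Rightarrow> (nat \<Rightarrow> nat) set \<Rightarrow> fun_op \<Rightarrow> bool" where
  "invertible_op \<theta> E T \<longleftrightarrow>
     T \<in> bounded_operators \<theta> E \<and>
     bij_betw T (bounded_theta_functions \<theta> E) (bounded_theta_functions \<theta> E) \<and>
     inv_into (bounded_theta_functions \<theta> E) T \<in> bounded_operators \<theta> E"

definition resolvent ::
  "real \<Rightarrow> (nat \<Rightarrow> nat) set \<Rightarrow> ((nat \<Rightarrow> nat) \<Rightarrow> real) \<Rightarrow> ((nat \<Rightarrow> nat) \<Rightarrow> real) \<Rightarrow> complex \<Rightarrow> fun_op" where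
  "resolvent \<theta> E \<eta> \<xi> z = inv_into (bounded_theta_functions \<theta> E) (id_minus_transfer E \<eta> \<xi> z)"

text \<open>Holomorphy on an open set \<open>U\<close> means complex differentiability with respect to the operator norm.\<close>

definition op_holomorphic_on ::
  "real \<Rightarrow> (nat \<Rightarrow> nat) set \<Rightarrow> (complex \<Rightarrow> fun_op) \<Rightarrow> complex set \<Rightarrow> bool" where
  "op_holomorphic_on \<theta> E R U \<longleftrightarrow>
     (\<forall>z\<in>U. R z \<in> bounded_operators \<theta> E) \<and>
     (\<forall>z\<in>U. \<exists>D\<in>bounded_operators \<theta> E.
        ((\<lambda>w. op_norm \<theta> E (\<lambda>g x. (R w g x - R z g x) / (w - z) - D g x)) \<longlongrightarrow> 0) (at z))"

definition resolvent_holomorphic_near ::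
  "real \<Rightarrow> (nat \<Rightarrow> nat) set \<Rightarrow> ((nat \<Rightarrow> nat) \<Rightarrow> real) \<Rightarrow> ((nat \<Rightarrow> nat) \<Rightarrow> real) \<Rightarrow> complex \<Rightarrow> bool" where
  "resolvent_holomorphic_near \<theta> E \<eta> \<xi> z \<longleftrightarrow>
     (\<exists>U. open U \<and> z \<in> U \<and>
        (\<forall>w\<in>U. invertible_op \<theta> E (id_minus_transfer E \<eta> \<xi> w)) \<and>
        op_holomorphic_on \<theta> E (resolvent \<theta> E \<eta> \<xi>) U)"

text \<open>The resolvent is a partial function of \<open>z\<close>: periodicity includes that of its domain.\<close>

definition resolvent_periodic ::
  "real \<Rightarrow> (nat \<Rightarrow> nat) set \<Rightarrow> ((nat \<Rightarrow> nat) \<Rightarrow> real) \<Rightarrow> ((nat \<Rightarrow> nat) \<Rightarrow> real) \<Rightarrow> complex \<Rightarrow> bool" where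
  "resolvent_periodic \<theta> E \<eta> \<xi> p \<longleftrightarrow>
     (\<forall>z. (invertible_op \<theta> E (id_minus_transfer E \<eta> \<xi> (z + p)) \<longleftrightarrow>
             invertible_op \<theta> E (id_minus_transfer E \<eta> \<xi> z)) \<and>
          (invertible_op \<theta> E (id_minus_transfer E \<eta> \<xi> z) \<longrightarrow>
             (\<forall>g\<in>bounded_theta_functions \<theta> E.
                resolvent \<theta> E \<eta> \<xi> (z + p) g = resolvent \<theta> E \<eta> \<xi> z g)))"

section \<open>Lattice conditions\<close>

definition real_group :: "real monoid" where
  "real_group = \<lparr>carrier = UNIV, monoid.mult = (+), one = 0\<rparr>"

definition lattice_potential :: "(nat \<Rightarrow> nat) set \<Rightarrow> ((nat \<Rightarrow> nat) \<Rightarrow> real) \<Rightarrow> bool" where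
  "lattice_potential E \<xi> \<longleftrightarrow>
     (\<exists>\<psi> :: (nat \<Rightarrow> nat) \<Rightarrow> real. \<exists>H. continuous_on E \<psi> \<and> subgroup H real_group \<and> discrete H \<and>
        (\<forall>x\<in>E. \<xi> x - \<psi> x + \<psi> (shift x) \<in> H))"

definition cohomologous_into_proper_subgroup :: "(nat \<Rightarrow> nat) set \<Rightarrow> ((nat \<Rightarrow> nat) \<Rightarrow> real) \<Rightarrow> bool" where
  "cohomologous_into_proper_subgroup E \<xi> \<longleftrightarrow>
     (\<exists>\<psi> :: (nat \<Rightarrow> nat) \<Rightarrow> complex. \<exists>H. continuous_on E \<psi> \<and> subgroup H integer_group \<and> H \<noteq> UNIV \<and>
        (\<forall>x\<in>E. of_real (\<xi> x) - \<psi> x + \<psi> (shift x) \<in> of_int ` H))"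

end

theory Submission
  imports Defs
begin

text \<open>
  Let \<open>u = \<eta> - \<delta> \<xi>\<close>, so that \<open>u\<close> has pressure 0, and let \<open>z = -\<delta> + \<i> b\<close>. The operator \<open>L\<^sub>z\<close> is the
  transfer operator of \<open>u\<close>, which is positive, twisted by the phases \<open>exp (\<i> b \<xi>)\<close>. If \<open>Id - L\<^sub>z\<close> is not
  invertible, then, as shown below, there is a function \<open>\<phi>\<close> of modulus 1 with
  \<open>exp (\<i> b \<xi>) \<phi> = \<phi> \<circ> shift\<close>. Such a function is exactly a cohomology of \<open>b \<xi>\<close> into \<open>2\<pi>\<int>\<close>. Its continuous
  logarithm shows that \<open>\<xi>\<close> is lattice if \<open>b \<noteq> 0\<close>. If \<open>\<xi>\<close> is integer-valued and \<open>b / 2\<pi>\<close> is not an integer,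
  there are two cases. For irrational \<open>b / 2\<pi>\<close>, the sums of \<open>\<xi>\<close> over periodic orbits vanish, so \<open>\<xi> = 0\<close>
  because \<open>\<xi> \<ge> 0\<close>. For \<open>b / 2\<pi> = p / q\<close> in lowest terms, \<open>\<phi>\<^sup>q\<close> is constant, and the exponents of the roots
  of unity that \<open>\<phi>\<close> runs through move \<open>\<xi>\<close> into \<open>q \<int>\<close>.

  The existence of \<open>\<phi>\<close> is obtained without a spectral decomposition. If \<open>Id - s L\<^sub>z\<close> were bounded below,
  uniformly in \<open>0 \<le> s \<le> 1\<close>, bijectivity would pass from \<open>Id\<close> to \<open>Id - L\<^sub>z\<close> in finitely many small steps
  (lemma \<open>bij_id_minus_by_continuity\<close>). Otherwise there are functions \<open>g\<close> of norm 1 and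
  numbers \<open>s\<close> for which \<open>g - s L\<^sub>z g\<close> is arbitrarily small. They are measured against positive functions \<open>h\<close> with
  \<open>L\<^sub>u h \<le> (1 + \<epsilon>) h\<close> whose bounds and Lipschitz constants do not depend on \<open>\<epsilon>\<close>. Such \<open>h\<close> are normalized
  partial sums of \<open>\<Sum>n. r\<^sup>n L\<^sub>u\<^sup>n 1\<close> (lemma \<open>approximate_eigenfunctions\<close>): vanishing pressure bounds the
  first omitted term, and finite irreducibility bounds the ratio of any two values. For \<open>k = g / h\<close> a single application
  of the operator contracts Lipschitz constants (lemma \<open>lasota_yorke\<close>), so \<open>k\<close> may be normalized to
  supremum 1 with bounded Lipschitz constant.

  The state space need not be compact, and a pointwise limit of the \<open>k\<close> could a priori vanish. It
  does not: where \<open>\<bar>k\<bar>\<close> is nearly 1, the averaging inequality forces it to be nearly 1 at those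
  preimages whose weight is bounded below (lemma \<open>branch_alignment\<close>). By finite irreducibility these reach every
  cylinder in boundedly many steps, so the limit \<open>\<phi>\<close> has modulus 1 everywhere, and the equality case of the
  triangle inequality gives the equation for \<open>\<phi>\<close> (lemma \<open>unimodular_eigenfunction\<close>).

  Holomorphy follows from a second order Taylor estimate for the operators in the operator norm, valid
  to the left of the critical exponent, together with the stability of invertibility
  (lemma \<open>inverse_holomorphic\<close>). Periodicity holds because for integer-valued \<open>\<xi>\<close> the operators at \<open>z\<close> and
  \<open>z + 2\<pi>\<i>\<close> coincide.
\<close>

section \<open>Perturbation of bijective operators on a complete function space\<close>

text \<open>The space depends on the parameters of the shift, so it is a set of functions with a norm rather
  than a type, and operators are total maps of which only the restriction to the set matters.\<close>

locale complete_function_norm =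
  fixes B :: "('x \<Rightarrow> complex) set" and N :: "('x \<Rightarrow> complex) \<Rightarrow> real"
  assumes zero_mem: "(\<lambda>x. 0) \<in> B"
    and add_mem: "f \<in> B \<Longrightarrow> g \<in> B \<Longrightarrow> (\<lambda>x. f x + g x) \<in> B"
    and scale_mem: "g \<in> B \<Longrightarrow> (\<lambda>x. c * g x) \<in> B"
    and N_nonneg: "0 \<le> N f"
    and N_eq_0: "g \<in> B \<Longrightarrow> N g = 0 \<Longrightarrow> g = (\<lambda>x. 0)"
    and N_add: "f \<in> B \<Longrightarrow> g \<in> B \<Longrightarrow> N (\<lambda>x. f x + g x) \<le> N f + N g"
    and N_scale: "N (\<lambda>x. c * g x) = cmod c * N g"
    and N_complete: "(\<And>n::nat. s n \<in> B) \<Longrightarrow>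
      (\<And>e. e > 0 \<Longrightarrow> \<exists>M. \<forall>m\<ge>M. \<forall>n\<ge>M. N (\<lambda>x. s m x - s n x) < e) \<Longrightarrow>
      \<exists>l\<in>B. \<forall>e>0. \<exists>M. \<forall>n\<ge>M. N (\<lambda>x. s n x - l x) < e"
begin

definition bounded_lin :: "(('x \<Rightarrow> complex) \<Rightarrow> 'x \<Rightarrow> complex) \<Rightarrow> real \<Rightarrow> bool" where
  "bounded_lin T K \<longleftrightarrow> (\<forall>g\<in>B. T g \<in> B \<and> N (T g) \<le> K * N g) \<and>
     (\<forall>g\<in>B. \<forall>h\<in>B. T (\<lambda>x. g x + h x) = (\<lambda>x. T g x + T h x)) \<and>
     (\<forall>c. \<forall>g\<in>B. T (\<lambda>x. c * g x) = (\<lambda>x. c * T g x))"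

lemma bounded_linD:
  assumes "bounded_lin T K"
  shows "g \<in> B \<Longrightarrow> T g \<in> B" "g \<in> B \<Longrightarrow> N (T g) \<le> K * N g"
    "g \<in> B \<Longrightarrow> h \<in> B \<Longrightarrow> T (\<lambda>x. g x + h x) = (\<lambda>x. T g x + T h x)"
    "g \<in> B \<Longrightarrow> T (\<lambda>x. c * g x) = (\<lambda>x. c * T g x)"
  using assms unfolding bounded_lin_def by blast+

lemma diff_mem: "f \<in> B \<Longrightarrow> g \<in> B \<Longrightarrow> (\<lambda>x. f x - g x) \<in> B"
  using add_mem[OF _ scale_mem[of g "-1"], of f] by simp

lemma N_diff_commute: "N (\<lambda>x. f x - g x) = N (\<lambda>x. g x - f x)"
  using N_scale[of "-1" "\<lambda>x. f x - g x"] by simp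

lemma N_diff: "f \<in> B \<Longrightarrow> g \<in> B \<Longrightarrow> N (\<lambda>x. f x - g x) \<le> N f + N g"
  using N_add[OF _ scale_mem[of g "-1"], of f] N_scale[of "-1" g] by simp

lemma N_zero: "N (\<lambda>x. 0) = 0"
  using N_scale[of 0 "\<lambda>x. 0"] by simp

lemma bounded_lin_diff:
  assumes "bounded_lin T K" "f \<in> B" "g \<in> B"
  shows "T (\<lambda>x. f x - g x) = (\<lambda>x. T f x - T g x)"
  using bounded_linD(3)[OF assms(1,2) scale_mem[OF assms(3), of "-1"]]
    bounded_linD(4)[OF assms(1,3), of "-1"] by simp

lemma metric_space: "Metric_space B (\<lambda>f g. N (\<lambda>x. f x - g x))"
proof
  show "0 \<le> N (\<lambda>x. f x - g x)" for f g by (rule N_nonneg)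
  show "N (\<lambda>x. f x - g x) = N (\<lambda>x. g x - f x)" for f g by (rule N_diff_commute)
  show "N (\<lambda>x. f x - g x) = 0 \<longleftrightarrow> f = g" if "f \<in> B" "g \<in> B" for f g
  proof
    assume "N (\<lambda>x. f x - g x) = 0"
    then have "(\<lambda>x. f x - g x) = (\<lambda>x. 0)" by (intro N_eq_0 diff_mem that)
    then show "f = g" by (metis eq_iff_diff_eq_0 ext)
  qed (simp add: N_zero)
  show "N (\<lambda>x. f x - h x) \<le> N (\<lambda>x. f x - g x) + N (\<lambda>x. g x - h x)"
    if "f \<in> B" "g \<in> B" "h \<in> B" for f g h
    using N_add[OF diff_mem[OF that(1,2)] diff_mem[OF that(2,3)]] by simp
qed

lemma contraction_fixpoint:
  assumes maps: "\<And>g. g \<in> B \<Longrightarrow> \<Phi> g \<in> B"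
    and contr: "\<And>f g. f \<in> B \<Longrightarrow> g \<in> B \<Longrightarrow> N (\<lambda>x. \<Phi> f x - \<Phi> g x) \<le> 1/2 * N (\<lambda>x. f x - g x)"
  obtains g where "g \<in> B" "\<Phi> g = g"
proof -
  interpret M: Metric_space B "\<lambda>f g. N (\<lambda>x. f x - g x)" by (rule metric_space)
  have "M.mcomplete"
    unfolding M.mcomplete_def M.MCauchy_def M.limit_metric_sequentially
  proof (intro allI impI, elim conjE)
    fix s :: "nat \<Rightarrow> 'x \<Rightarrow> complex" assume s: "range s \<subseteq> B" "\<forall>e>0. \<exists>M. \<forall>m n. M \<le> m \<longrightarrow> M \<le> n \<longrightarrow> N (\<lambda>x. s m x - s n x) < e"
    have "\<exists>l\<in>B. \<forall>e>0. \<exists>M. \<forall>n\<ge>M. N (\<lambda>x. s n x - l x) < e"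
    proof (rule N_complete)
      show "s n \<in> B" for n using s(1) by auto
      show "\<exists>M. \<forall>m\<ge>M. \<forall>n\<ge>M. N (\<lambda>x. s m x - s n x) < e" if "e > 0" for e
        using s(2) that by meson
    qed
    then show "\<exists>l. l \<in> B \<and> (\<forall>e>0. \<exists>M. \<forall>n\<ge>M. s n \<in> B \<and> N (\<lambda>x. s n x - l x) < e)"
      using s(1) by (meson range_subsetD)
  qed
  then show thesis
    using M.Banach_fixedpoint_thm[of \<Phi> "1/2"] maps contr zero_mem that by (auto simp: Pi_iff)
qed

text \<open>Bijectivity survives a perturbation that is small against the lower bound:
  \<open>S g = r\<close> is the fixed point equation \<open>g = T\<^sup>-\<^sup>1 (r - (S - T) g)\<close>, a contraction.\<close>

lemma bij_perturb:
  assumes T: "bounded_lin T K" "bij_betw T B B" and S: "bounded_lin S K'"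
    and below: "\<And>g. g \<in> B \<Longrightarrow> N g \<le> c * N (T g)" and "c \<ge> 0"
    and close: "\<And>g. g \<in> B \<Longrightarrow> N (\<lambda>x. S g x - T g x) \<le> k * N g" and ck: "c * k \<le> 1/2"
  shows "bij_betw S B B" and "\<And>g. g \<in> B \<Longrightarrow> N g \<le> 2 * c * N (S g)"
proof -
  note TD = bounded_linD[OF T(1)] and SD = bounded_linD[OF S]
  have pert: "c * N (\<lambda>x. S g x - T g x) \<le> 1/2 * N g" if "g \<in> B" for g
  proof -
    have "c * N (\<lambda>x. S g x - T g x) \<le> c * (k * N g)"
      using close[OF that] \<open>c \<ge> 0\<close> by (rule mult_left_mono)
    also have "\<dots> \<le> 1/2 * N g"
      using mult_right_mono[OF ck N_nonneg[of g]] by (simp add: mult.assoc)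
    finally show ?thesis .
  qed
  show lower: "N g \<le> 2 * c * N (S g)" if "g \<in> B" for g
  proof -
    have "N (T g) \<le> N (S g) + N (\<lambda>x. S g x - T g x)"
      using N_diff[OF SD(1)[OF that] diff_mem[OF SD(1)[OF that] TD(1)[OF that]]] by simp
    then have "N g \<le> c * (N (S g) + N (\<lambda>x. S g x - T g x))"
      using below[OF that] \<open>c \<ge> 0\<close> by (meson mult_left_mono order_trans)
    then show ?thesis using pert[OF that] by (simp add: algebra_simps)
  qed
  have inj: "inj_on S B"
  proof (rule inj_onI)
    fix f g assume fg: "f \<in> B" "g \<in> B" "S f = S g"
    then have "S (\<lambda>x. f x - g x) = (\<lambda>x. 0)" by (simp add: bounded_lin_diff[OF S])
    then have "N (\<lambda>x. f x - g x) \<le> 0" using lower[OF diff_mem[OF fg(1,2)]] by (simp add: N_zero)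
    then have "(\<lambda>x. f x - g x) = (\<lambda>x. 0)"
      using N_eq_0[OF diff_mem[OF fg(1,2)]] N_nonneg by (meson order_antisym)
    then show "f = g" by (metis eq_iff_diff_eq_0 ext)
  qed
  define R where "R = inv_into B T"
  have R: "R r \<in> B" "T (R r) = r" if "r \<in> B" for r
    using T(2) that unfolding R_def bij_betw_def by (metis inv_into_into f_inv_into_f)+
  have "\<exists>g\<in>B. S g = r" if r: "r \<in> B" for r
  proof -
    define q where "q g = (\<lambda>x. r x - (S g x - T g x))" for g
    have q: "q g \<in> B" if "g \<in> B" for g
      unfolding q_def using that r by (intro diff_mem SD TD)
    obtain g where g: "g \<in> B" "R (q g) = g"
    proof (rule contraction_fixpoint[of "\<lambda>g. R (q g)"])
      show "R (q g) \<in> B" if "g \<in> B" for g using R q that by blast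
      fix f g assume fg: "f \<in> B" "g \<in> B"
      have "N (\<lambda>x. R (q f) x - R (q g) x) \<le> c * N (T (\<lambda>x. R (q f) x - R (q g) x))"
        using fg by (intro below diff_mem R q)
      also have "T (\<lambda>x. R (q f) x - R (q g) x) = (\<lambda>x. q f x - q g x)"
        using fg by (simp add: bounded_lin_diff[OF T(1)] R q)
      also have "N \<dots> = N (\<lambda>x. S (\<lambda>x. f x - g x) x - T (\<lambda>x. f x - g x) x)"
        using fg by (subst N_diff_commute)
          (simp add: q_def bounded_lin_diff[OF T(1)] bounded_lin_diff[OF S] algebra_simps)
      also have "c * \<dots> \<le> 1/2 * N (\<lambda>x. f x - g x)" using fg by (intro pert diff_mem)
      finally show "N (\<lambda>x. R (q f) x - R (q g) x) \<le> 1/2 * N (\<lambda>x. f x - g x)" .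
    qed blast
    then have "T g = q g" using R q by metis
    then have "S g x = r x" for x unfolding q_def by (metis add_diff_cancel_left' diff_add_cancel diff_diff_eq2 right_minus_eq)
    then show ?thesis using g(1) by blast
  qed
  then show "bij_betw S B B"
    using inj SD(1) unfolding bij_betw_def by blast
qed

lemma inv_bounded_lin:
  assumes T: "bounded_lin T K" "bij_betw T B B"
    and below: "\<And>g. g \<in> B \<Longrightarrow> N g \<le> c * N (T g)"
  shows "bounded_lin (inv_into B T) c"
proof -
  let ?R = "inv_into B T"
  note TD = bounded_linD[OF T(1)]
  have R: "?R r \<in> B" "T (?R r) = r" if "r \<in> B" for r
    using T(2) that unfolding bij_betw_def by (metis inv_into_into f_inv_into_f)+
  have RT: "?R (T g) = g" if "g \<in> B" for g
    using T(2) that by (metis bij_betw_inv_into_left)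
  show ?thesis
    unfolding bounded_lin_def
  proof (intro conjI ballI allI)
    fix g assume g: "g \<in> B"
    show "?R g \<in> B" using R g by blast
    show "N (?R g) \<le> c * N g" using below[OF R(1)[OF g]] R(2)[OF g] by simp
    show "?R (\<lambda>x. a * g x) = (\<lambda>x. a * ?R g x)" for a
      using RT[OF scale_mem[OF R(1)[OF g], of a]] TD(4)[OF R(1)[OF g], of a] R(2)[OF g] by simp
    fix h assume h: "h \<in> B"
    show "?R (\<lambda>x. g x + h x) = (\<lambda>x. ?R g x + ?R h x)"
      using RT[OF add_mem[OF R(1)[OF g] R(1)[OF h]]] TD(3)[OF R(1)[OF g] R(1)[OF h]] R(2) g h by simp
  qed
qed

lemma bounded_lin_id_minus:
  assumes "bounded_lin L K"
  shows "bounded_lin (\<lambda>g x. g x - a * L g x) (1 + cmod a * K)"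
  unfolding bounded_lin_def
proof (intro conjI ballI allI)
  note LD = bounded_linD[OF assms]
  fix g assume g: "g \<in> B"
  have aL: "(\<lambda>x. a * L g x) \<in> B" by (intro scale_mem LD g)
  show "(\<lambda>x. g x - a * L g x) \<in> B" by (intro diff_mem g aL)
  have "N (\<lambda>x. a * L g x) \<le> cmod a * (K * N g)"
    unfolding N_scale using LD(2)[OF g] by (intro mult_left_mono) auto
  then show "N (\<lambda>x. g x - a * L g x) \<le> (1 + cmod a * K) * N g"
    using N_diff[OF g aL] by (simp add: algebra_simps)
  show "(\<lambda>x. b * g x - a * L (\<lambda>x. b * g x) x) = (\<lambda>x. b * (g x - a * L g x))" for b
    using LD(4)[OF g, of b] by (simp add: algebra_simps)
  fix h assume h: "h \<in> B"
  show "(\<lambda>x. g x + h x - a * L (\<lambda>x. g x + h x) x) = (\<lambda>x. g x - a * L g x + (h x - a * L h x))"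
    using LD(3)[OF g h] by (simp add: algebra_simps)
qed

text \<open>A boundary point of the spectrum is an approximate eigenvalue: an a priori lower bound along
  the segment from \<open>Id\<close> to \<open>Id - L\<close> lets bijectivity travel along it in steps of fixed length.\<close>

lemma bij_id_minus_by_continuity:
  assumes L: "bounded_lin L K" and "c > 0"
    and below: "\<And>s g. 0 \<le> s \<Longrightarrow> s \<le> 1 \<Longrightarrow> g \<in> B \<Longrightarrow> N g \<le> c * N (\<lambda>x. g x - of_real s * L g x)"
  shows "bij_betw (\<lambda>g x. g x - L g x) B B"
proof -
  note LD = bounded_linD[OF L]
  obtain m :: nat where m: "2 * c * \<bar>K\<bar> < real m" using reals_Archimedean2 by blast
  have m0: "m > 0" using m \<open>c > 0\<close> by (cases m) (auto simp: not_less mult_less_0_iff)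
  define S where "S j = (\<lambda>g x. g x - of_real (real j / real m) * L g x)" for j :: nat
  have lin: "bounded_lin (S j) (1 + cmod (of_real (real j / real m)) * K)" for j
    unfolding S_def by (rule bounded_lin_id_minus[OF L])
  have "j \<le> m \<Longrightarrow> bij_betw (S j) B B" for j
  proof (induction j)
    case 0
    have "S 0 = (\<lambda>g. g)" by (auto simp: S_def)
    then show ?case by (simp add: bij_betw_def)
  next
    case (Suc j)
    show ?case
    proof (rule bij_perturb(1)[OF lin[of j] _ lin[of "Suc j"], of c "\<bar>K\<bar> / m"])
      show "bij_betw (S j) B B" using Suc by simp
      show "N g \<le> c * N (S j g)" if "g \<in> B" for g
        unfolding S_def using Suc.prems m0 that by (intro below) auto
      show "c \<ge> 0" using \<open>c > 0\<close> by simp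
      show "c * (\<bar>K\<bar> / real m) \<le> 1 / 2" using m m0 by (simp add: field_simps)
      fix g assume g: "g \<in> B"
      have "S (Suc j) g x - S j g x = - of_real (1 / real m) * L g x" for x
        using m0 by (simp add: S_def field_simps)
      then have "N (\<lambda>x. S (Suc j) g x - S j g x) = 1 / real m * N (L g)"
        by (simp only: N_scale norm_minus_cancel norm_of_real) simp
      also have "\<dots> \<le> 1 / real m * (\<bar>K\<bar> * N g)"
        using LD(2)[OF g] N_nonneg[of g]
        by (intro mult_left_mono) (auto intro: order_trans[OF _ mult_right_mono[OF abs_ge_self]])
      finally show "N (\<lambda>x. S (Suc j) g x - S j g x) \<le> \<bar>K\<bar> / real m * N g" by simp
    qed
  qed
  from this[of m] show ?thesis using m0 by (simp add: S_def)
qed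

text \<open>Differentiability of the inverse. Writing \<open>a = T\<^sub>z\<^sup>-\<^sup>1 g\<close> and \<open>p = T\<^sub>z\<^sup>-\<^sup>1 (D\<^sub>z a)\<close>, the error
  \<open>v\<close> of the difference quotient against \<open>- p\<close> satisfies
  \<open>T\<^sub>w v = (T\<^sub>w p - T\<^sub>z p) - (T\<^sub>w a - T\<^sub>z a - (w - z) D\<^sub>z a) / (w - z)\<close>, which is of order \<open>w - z\<close>.\<close>

lemma inverse_holomorphic:
  assumes "open U" "z0 \<in> U" and T: "\<And>w. w \<in> U \<Longrightarrow> bounded_lin (T w) (K w)"
    and D: "\<And>w. w \<in> U \<Longrightarrow> bounded_lin (D w) C" and "C \<ge> 0"
    and taylor: "\<And>w z g. w \<in> U \<Longrightarrow> z \<in> U \<Longrightarrow> g \<in> B \<Longrightarrow>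
      N (\<lambda>x. T w g x - T z g x - (w - z) * D z g x) \<le> C * (cmod (w - z))\<^sup>2 * N g"
    and bij: "bij_betw (T z0) B B" and below: "\<And>g. g \<in> B \<Longrightarrow> N g \<le> c * N (T z0 g)" and "c \<ge> 0"
  obtains V where "open V" "z0 \<in> V" "V \<subseteq> U" "\<And>w. w \<in> V \<Longrightarrow> bij_betw (T w) B B"
    "\<And>w. w \<in> V \<Longrightarrow> bounded_lin (inv_into B (T w)) (2 * c)"
    "\<And>z. z \<in> V \<Longrightarrow> \<exists>D' K' C'. bounded_lin D' K' \<and> (\<forall>w\<in>V. \<forall>g\<in>B. w \<noteq> z \<longrightarrow>
       N (\<lambda>x. (inv_into B (T w) g x - inv_into B (T z) g x) / (w - z) - D' g x)
         \<le> C' * cmod (w - z) * N g)"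
proof -
  obtain r0 where r0: "r0 > 0" "ball z0 r0 \<subseteq> U"
    using \<open>open U\<close> \<open>z0 \<in> U\<close> open_contains_ball by blast
  define r where "r = min (min r0 (1/2)) (1 / (4 * c * C + 1))"
  have cC: "c * C \<ge> 0" using \<open>c \<ge> 0\<close> \<open>C \<ge> 0\<close> by simp
  have r: "r > 0" "r \<le> 1/2" "r \<le> r0" "r \<le> 1 / (4 * c * C + 1)" 
    using r0 cC by (auto simp: r_def field_simps add_pos_nonneg)
  define V where "V = ball z0 r"
  have VU: "V \<subseteq> U" using r r0 by (auto simp: V_def)
  have lip: "N (\<lambda>x. T w g x - T z g x) \<le> 2 * C * cmod (w - z) * N g"
    if wz: "w \<in> V" "z \<in> V" and g: "g \<in> B" for w z g
  proof -
    have U: "w \<in> U" "z \<in> U" using wz VU by auto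
    have "dist w z \<le> 1" using wz r(2) dist_triangle2[of w z z0] by (auto simp: V_def dist_commute)
    then have d1: "cmod (w - z) \<le> 1" by (simp add: dist_norm)
    let ?e = "\<lambda>x. T w g x - T z g x - (w - z) * D z g x"
    have mem: "?e \<in> B" "(\<lambda>x. (w - z) * D z g x) \<in> B"
      by (intro diff_mem scale_mem bounded_linD(1)[OF T] bounded_linD(1)[OF D] U g)+
    have "N (\<lambda>x. T w g x - T z g x) \<le> N ?e + N (\<lambda>x. (w - z) * D z g x)"
      using N_add[OF mem] by simp
    also have "N (\<lambda>x. (w - z) * D z g x) \<le> cmod (w - z) * (C * N g)"
      unfolding N_scale using bounded_linD(2)[OF D[OF U(2)] g] by (intro mult_left_mono) auto
    also have "N ?e \<le> C * (cmod (w - z))\<^sup>2 * N g" by (rule taylor[OF U g])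
    also have "\<dots> \<le> C * cmod (w - z) * N g"
    proof -
      have "(cmod (w - z))\<^sup>2 \<le> cmod (w - z)"
        using mult_left_mono[OF d1 norm_ge_zero[of "w - z"]] by (simp add: power2_eq_square)
      then show ?thesis by (intro mult_right_mono mult_left_mono N_nonneg \<open>C \<ge> 0\<close>)
    qed
    finally show ?thesis by (simp add: algebra_simps)
  qed
  have bij_below: "bij_betw (T w) B B \<and> (\<forall>g\<in>B. N g \<le> 2 * c * N (T w g))" if w: "w \<in> V" for w
  proof -
    have z0V: "z0 \<in> V" using r by (simp add: V_def)
    have U: "w \<in> U" "z0 \<in> U" using w z0V VU by auto
    have close: "N (\<lambda>x. T w g x - T z0 g x) \<le> (2 * C * r) * N g" if g: "g \<in> B" for g
    proof -
      have "cmod (w - z0) \<le> r" using w by (simp add: V_def dist_norm norm_minus_commute)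
      then have "2 * C * cmod (w - z0) * N g \<le> 2 * C * r * N g"
        by (intro mult_right_mono mult_left_mono N_nonneg) (use \<open>C \<ge> 0\<close> in auto)
      with lip[OF w z0V g] show ?thesis by simp
    qed
    have "r * (4 * c * C + 1) \<le> 1" using r(4) cC by (simp add: pos_le_divide_eq add_nonneg_pos)
    then have "c * (2 * C * r) \<le> 1/2" using r(1) by (simp add: algebra_simps)
    from bij_perturb[OF T[OF U(2)] bij T[OF U(1)] below \<open>c \<ge> 0\<close> close this]
    show ?thesis by blast
  qed
  have deriv: "\<exists>D' K' C'. bounded_lin D' K' \<and> (\<forall>w\<in>V. \<forall>g\<in>B. w \<noteq> z \<longrightarrow>
       N (\<lambda>x. (inv_into B (T w) g x - inv_into B (T z) g x) / (w - z) - D' g x)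
         \<le> C' * cmod (w - z) * N g)" if z: "z \<in> V" for z
  proof -
    let ?R = "\<lambda>w. inv_into B (T w)"
    have zU: "z \<in> U" using z VU by auto
    have lR: "bounded_lin (?R w) (2 * c)" if "w \<in> V" for w
      using inv_bounded_lin[OF T] bij_below[OF that] VU that by blast
    have TR: "T w (?R w g) = g" if "w \<in> V" "g \<in> B" for w g
      using bij_below[OF that(1)] that(2) unfolding bij_betw_def by (metis f_inv_into_f)
    note RD = bounded_linD[OF lR[OF z]] and DD = bounded_linD[OF D[OF zU]]
    define p where "p g = ?R z (D z (?R z g))" for g
    have p: "p g \<in> B" if "g \<in> B" for g unfolding p_def by (intro RD DD that)
    have Np: "N (p g) \<le> (2 * c * (C * (2 * c))) * N g" if "g \<in> B" for g
    proof -
      have "N (p g) \<le> 2 * c * N (D z (?R z g))" unfolding p_def by (intro RD DD that)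
      also have "\<dots> \<le> 2 * c * (C * N (?R z g))" using \<open>c \<ge> 0\<close> by (intro mult_left_mono DD RD that) auto
      also have "\<dots> \<le> 2 * c * (C * (2 * c * N g))"
        using \<open>c \<ge> 0\<close> \<open>C \<ge> 0\<close> by (intro mult_left_mono RD that) auto
      finally show ?thesis by (simp add: mult.assoc)
    qed
    have lin: "bounded_lin (\<lambda>g x. (-1) * p g x) (2 * c * (C * (2 * c)))"
      unfolding bounded_lin_def
    proof (intro conjI ballI allI)
      fix g assume g: "g \<in> B"
      show "(\<lambda>x. (-1) * p g x) \<in> B" by (intro scale_mem p g)
      show "N (\<lambda>x. (-1) * p g x) \<le> 2 * c * (C * (2 * c)) * N g"
        unfolding N_scale using Np[OF g] by simp
      show "(\<lambda>x. - 1 * p (\<lambda>x. a * g x) x) = (\<lambda>x. a * (- 1 * p g x))" for a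
        unfolding p_def using g by (simp add: RD DD)
      fix h assume h: "h \<in> B"
      show "(\<lambda>x. - 1 * p (\<lambda>x. g x + h x) x) = (\<lambda>x. - 1 * p g x + - 1 * p h x)"
        unfolding p_def using g h by (simp add: RD DD)
    qed
    define C' where "C' = 2 * c * (C * (2 * c) + 2 * C * (2 * c * (C * (2 * c))))"
    have "N (\<lambda>x. (?R w g x - ?R z g x) / (w - z) - (-1) * p g x) \<le> C' * cmod (w - z) * N g"
      if w: "w \<in> V" and g: "g \<in> B" and ne: "w \<noteq> z" for w g
    proof -
      have wU: "w \<in> U" using w VU by auto
      note TD = bounded_linD[OF T[OF wU]]
      define a where "a = ?R z g"
      define b where "b = ?R w g"
      have ab: "a \<in> B" "b \<in> B" "T z a = g" "T w b = g"
        unfolding a_def b_def using RD(1)[OF g] bounded_linD(1)[OF lR[OF w] g] TR z w g by auto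
      have Na: "N a \<le> 2 * c * N g" unfolding a_def by (rule RD(2)[OF g])
      define v where "v = (\<lambda>x. (1 / (w - z)) * (b x - a x) + p g x)"
      have v: "v \<in> B" unfolding v_def by (intro add_mem scale_mem diff_mem ab p g)
      have Da: "D z a = T z (p g)" unfolding p_def a_def using TR[OF z] DD(1) RD(1) g by simp
      let ?e = "\<lambda>x. (- 1 / (w - z)) * (T w a x - T z a x - (w - z) * D z a x)"
      let ?d = "\<lambda>x. T w (p g) x - T z (p g) x"
      have "T w v = (\<lambda>x. (1 / (w - z)) * (T w b x - T w a x) + T w (p g) x)"
        unfolding v_def
        by (simp add: TD(3)[OF scale_mem[OF diff_mem[OF ab(2,1)]] p[OF g]]
            TD(4)[OF diff_mem[OF ab(2,1)]] bounded_lin_diff[OF T[OF wU] ab(2,1)] del: times_divide_eq_left)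
      also have "\<dots> = (\<lambda>x. ?e x + ?d x)"
        using ne by (intro ext) (simp add: ab Da field_simps)
      finally have Tv: "T w v = (\<lambda>x. ?e x + ?d x)" .
      have mem: "?e \<in> B" "?d \<in> B"
        by (intro diff_mem scale_mem TD bounded_linD(1)[OF T[OF zU]] DD p g ab)+
      have "N ?e = 1 / cmod (w - z) * N (\<lambda>x. T w a x - T z a x - (w - z) * D z a x)"
        unfolding N_scale by (simp add: norm_divide)
      also have "\<dots> \<le> 1 / cmod (w - z) * (C * (cmod (w - z))\<^sup>2 * N a)"
        by (intro mult_left_mono taylor wU zU ab) auto
      also have "\<dots> = C * cmod (w - z) * N a" using ne by (simp add: power2_eq_square)
      also have "\<dots> \<le> C * cmod (w - z) * (2 * c * N g)"
        using Na \<open>C \<ge> 0\<close> by (intro mult_left_mono) auto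
      finally have Ne: "N ?e \<le> C * cmod (w - z) * (2 * c * N g)" .
      have "N ?d \<le> 2 * C * cmod (w - z) * N (p g)" by (rule lip[OF w z p[OF g]])
      also have "\<dots> \<le> 2 * C * cmod (w - z) * ((2 * c * (C * (2 * c))) * N g)"
        using Np[OF g] \<open>C \<ge> 0\<close> by (intro mult_left_mono) auto
      finally have Nd: "N ?d \<le> 2 * C * cmod (w - z) * ((2 * c * (C * (2 * c))) * N g)" .
      have "N v \<le> 2 * c * N (T w v)" using bij_below[OF w] v by blast
      also have "\<dots> \<le> 2 * c * (C * cmod (w - z) * (2 * c * N g) + 2 * C * cmod (w - z) * ((2 * c * (C * (2 * c))) * N g))"
        unfolding Tv using N_add[OF mem] Ne Nd \<open>c \<ge> 0\<close> by (intro mult_left_mono) auto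
      also have "\<dots> = C' * cmod (w - z) * N g" by (simp add: C'_def algebra_simps)
      finally show ?thesis by (simp add: v_def a_def b_def)
    qed
    with lin show ?thesis by blast
  qed
  show thesis
  proof (rule that[of V])
    show "open V" "z0 \<in> V" "V \<subseteq> U" using r VU by (auto simp: V_def)
    show "bij_betw (T w) B B" if "w \<in> V" for w using bij_below[OF that] by blast
    show "bounded_lin (inv_into B (T w)) (2 * c)" if "w \<in> V" for w
      using inv_bounded_lin[OF T] bij_below[OF that] VU that by blast
  qed (rule deriv)
qed

end

section \<open>Symbolic dynamics\<close>

definition agree :: "nat \<Rightarrow> (nat \<Rightarrow> nat) \<Rightarrow> (nat \<Rightarrow> nat) \<Rightarrow> bool" where
  "agree n x y \<longleftrightarrow> (\<forall>i<n. x i = y i)"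

lemma agree_sym: "agree n x y \<Longrightarrow> agree n y x"
  by (simp add: agree_def)

lemma agree_mono: "agree n x y \<Longrightarrow> m \<le> n \<Longrightarrow> agree m x y"
  by (simp add: agree_def)

lemma funpow_shift: "(shift ^^ j) x = (\<lambda>i. x (i + j))"
  by (induction j arbitrary: x) (auto simp: shift_def fun_eq_iff funpow_swap1)

lemma shift_case_nat [simp]: "shift (case_nat e x) = x"
  by (simp add: shift_def)

lemma case_nat_shift: "case_nat (y 0) (shift y) = y"
  by (auto simp: shift_def fun_eq_iff split: nat.splits)

lemma open_agree: "open {y. agree n x y}"
proof -
  have "{y. agree n x y} = (\<Inter>i\<in>{..<n}. (\<lambda>y::nat \<Rightarrow> nat. y i) -` {x i})"
    by (auto simp: agree_def)
  moreover have "open ((\<lambda>y::nat \<Rightarrow> nat. y i) -` {x i})" for i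
    by (intro open_vimage) (auto simp: open_discrete)
  ultimately show ?thesis by auto
qed

locale markov_shift =
  fixes I :: "nat set" and A :: "nat \<Rightarrow> nat \<Rightarrow> nat" and E :: "(nat \<Rightarrow> nat) set" and \<theta> :: real
  assumes E_eq: "E = shift_space I A" and irreducible: "finitely_irreducible I A"
    and E_nonempty: "E \<noteq> {}" and \<theta>_pos: "0 < \<theta>" and \<theta>_less: "\<theta> < 1"
begin

lemma mem_E: "x \<in> E \<longleftrightarrow> (\<forall>j. x j \<in> I \<and> A (x j) (x (Suc j)) = 1)"
  by (auto simp: E_eq shift_space_def)

lemma shift_mem: "x \<in> E \<Longrightarrow> shift x \<in> E"
  by (auto simp: mem_E shift_def)

lemma funpow_shift_mem: "x \<in> E \<Longrightarrow> (shift ^^ n) x \<in> E"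
  by (induction n) (auto intro: shift_mem)

definition preimages :: "(nat \<Rightarrow> nat) \<Rightarrow> (nat \<Rightarrow> nat) set" where
  "preimages x = {y \<in> E. shift y = x}"

lemma preimagesD: "y \<in> preimages x \<Longrightarrow> y \<in> E" "y \<in> preimages x \<Longrightarrow> shift y = x"
  by (auto simp: preimages_def)

lemma case_nat_mem:
  assumes "y \<in> E" "x \<in> E" "shift y 0 = x 0"
  shows "case_nat (y 0) x \<in> E"
proof -
  have "A (y 0) (y (Suc 0)) = 1" using assms(1) mem_E by blast
  then have "A (y 0) (x 0) = 1" using assms(3) by (simp add: shift_def)
  then show ?thesis using assms by (auto simp: mem_E split: nat.splits)
qed

text \<open>Points with the same first letter have the same inverse branches.\<close>

lemma bij_preimages:
  assumes "x \<in> E" "x' \<in> E" "agree 1 x x'"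
  shows "bij_betw (\<lambda>y. case_nat (y 0) x') (preimages x) (preimages x')"
proof (rule bij_betw_byWitness[where f' = "\<lambda>y. case_nat (y 0) x"])
  show "\<forall>y\<in>preimages x. case_nat (case_nat (y 0) x' 0) x = y"
    by (auto simp: preimages_def case_nat_shift)
  show "\<forall>y\<in>preimages x'. case_nat (case_nat (y 0) x 0) x' = y"
    by (auto simp: preimages_def case_nat_shift)
  show "(\<lambda>y. case_nat (y 0) x') ` preimages x \<subseteq> preimages x'"
    using assms case_nat_mem by (auto simp: preimages_def agree_def)
  show "(\<lambda>y. case_nat (y 0) x) ` preimages x' \<subseteq> preimages x"
    using assms case_nat_mem by (auto simp: preimages_def agree_def)
qed

lemma agree_branch:
  assumes "y \<in> preimages x" "agree n x x'"
  shows "agree (Suc n) y (case_nat (y 0) x')"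
  using assms by (auto simp: agree_def preimages_def shift_def split: nat.splits)

text \<open>Finite irreducibility, in the form of admissible paths of bounded length whose inner vertices
  are taken from one finite set.\<close>

lemma connecting_paths:
  obtains F L where "finite F" "\<And>i j. i \<in> I \<Longrightarrow> j \<in> I \<Longrightarrow>
    \<exists>u m. 1 \<le> m \<and> m \<le> L \<and> u 0 = i \<and> u m = j \<and> (\<forall>t<m. A (u t) (u (Suc t)) = 1) \<and>
      (\<forall>t. u t \<in> I) \<and> (\<forall>t. 0 < t \<and> t < m \<longrightarrow> u t \<in> F)"
proof -
  obtain \<Lambda> where \<Lambda>: "finite \<Lambda>"
    "\<And>i j. i \<in> I \<Longrightarrow> j \<in> I \<Longrightarrow> \<exists>w\<in>\<Lambda>. [i] @ w @ [j] \<in> all_words E"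
    using irreducible unfolding finitely_irreducible_def E_eq by blast
  define F where "F = \<Union> (set ` \<Lambda>)"
  define L where "L = Suc (Max (insert 0 (length ` \<Lambda>)))"
  show thesis
  proof (rule that[of F L])
    show "finite F" using \<Lambda>(1) by (auto simp: F_def)
    fix i j assume ij: "i \<in> I" "j \<in> I"
    obtain w where w: "w \<in> \<Lambda>" "[i] @ w @ [j] \<in> all_words E" using \<Lambda>(2)[OF ij] by blast
    then obtain n \<omega> k where \<omega>: "\<omega> \<in> E" "[i] @ w @ [j] = map \<omega> [k..<k + n]"
      unfolding all_words_def words_def by blast
    from arg_cong[OF \<omega>(2), of length] have n: "n = length w + 2" by simp
    define u where "u t = \<omega> (k + t)" for t
    have u: "([i] @ w @ [j]) ! t = u t" if "t < length w + 2" for t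
      unfolding \<omega>(2) u_def using that n by (subst nth_map_upt) auto
    have "u 0 = i" "u (Suc (length w)) = j" using u[of 0] u[of "Suc (length w)"] by auto
    moreover have "A (u t) (u (Suc t)) = 1" "u t \<in> I" for t
      using \<omega>(1) by (auto simp: mem_E u_def)
    moreover have "u t \<in> F" if t: "0 < t" "t < Suc (length w)" for t
    proof -
      have "u t = w ! (t - 1)" using u[of t] t by (auto simp: nth_Cons nth_append split: nat.splits)
      moreover have "w ! (t - 1) \<in> set w" using t by (intro nth_mem) auto
      ultimately show ?thesis using w(1) unfolding F_def by auto
    qed
    moreover have "Suc (length w) \<le> L" using w(1) \<Lambda>(1) by (auto simp: L_def)
    ultimately show "\<exists>u m. 1 \<le> m \<and> m \<le> L \<and> u 0 = i \<and> u m = j \<and> (\<forall>t<m. A (u t) (u (Suc t)) = 1) \<and>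
      (\<forall>t. u t \<in> I) \<and> (\<forall>t. 0 < t \<and> t < m \<longrightarrow> u t \<in> F)"
      by (intro exI[of _ u] exI[of _ "Suc (length w)"]) auto
  qed
qed

text \<open>Backward orbits of any point \<open>x\<close> meet every cylinder, with a bounded delay and, up to the word of
  the cylinder, through letters of one finite set. Losses along these orbits are thus bounded
  uniformly in \<open>x\<close>, although the alphabet may be infinite.\<close>

lemma joining:
  obtains F L where "finite F" "\<And>N z x. z \<in> E \<Longrightarrow> x \<in> E \<Longrightarrow>
    \<exists>y\<in>E. \<exists>j\<le>N + L. N < j \<and> agree (Suc N) y z \<and> (\<forall>i. N < i \<and> i < j \<longrightarrow> y i \<in> F) \<and> (shift ^^ j) y = x"
proof -
  obtain F L where FL: "finite F" "\<And>i j. i \<in> I \<Longrightarrow> j \<in> I \<Longrightarrow>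
    \<exists>u m. 1 \<le> m \<and> m \<le> L \<and> u 0 = i \<and> u m = j \<and> (\<forall>t<m. A (u t) (u (Suc t)) = 1) \<and>
      (\<forall>t. u t \<in> I) \<and> (\<forall>t. 0 < t \<and> t < m \<longrightarrow> u t \<in> F)"
    by (rule connecting_paths) blast
  show thesis
  proof (rule that[of F L, OF FL(1)])
    fix N z x assume zx: "z \<in> E" "x \<in> E"
    then have "z N \<in> I" "x 0 \<in> I" by (auto simp: mem_E)
    then obtain u m where u: "1 \<le> m" "m \<le> L" "u 0 = z N" "u m = x 0"
      "\<And>t. t < m \<Longrightarrow> A (u t) (u (Suc t)) = 1" "\<And>t. u t \<in> I" "\<And>t. 0 < t \<Longrightarrow> t < m \<Longrightarrow> u t \<in> F"
      using FL(2) by metis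
    define y where "y t = (if t < N then z t else if t < N + m then u (t - N) else x (t - N - m))" for t
    have "y t \<in> I \<and> A (y t) (y (Suc t)) = 1" for t
    proof -
      consider "Suc t < N" | "Suc t = N" | "N \<le> t" "Suc t < N + m" | "N \<le> t" "Suc t = N + m" | "N + m \<le> t"
        by linarith
      then show ?thesis
      proof cases
        case 1 then show ?thesis using zx by (auto simp: y_def mem_E)
      next
        case 2 then show ?thesis using zx u by (auto simp: y_def mem_E)
      next
        case 3 then show ?thesis using u(5)[of "t - N"] u(6) by (auto simp: y_def Suc_diff_le)
      next
        case 4 then have "t - N < m" "Suc (t - N) = m" by auto
        then show ?thesis using 4 u(5)[of "t - N"] u(4,6) by (auto simp: y_def)
      next
        case 5
        then have "Suc t - N - m = Suc (t - N - m)" by auto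
        then show ?thesis using 5 zx(2) by (auto simp: y_def mem_E)
      qed
    qed
    then have "y \<in> E" by (auto simp: mem_E)
    moreover have "agree (Suc N) y z" using u(1,3) by (auto simp: agree_def y_def less_Suc_eq)
    moreover have "(shift ^^ (N + m)) y = x" by (auto simp: funpow_shift y_def)
    moreover have "\<forall>i. N < i \<and> i < N + m \<longrightarrow> y i \<in> F" using u(7) by (auto simp: y_def)
    ultimately show "\<exists>y\<in>E. \<exists>j\<le>N + L. N < j \<and> agree (Suc N) y z \<and> (\<forall>i. N < i \<and> i < j \<longrightarrow> y i \<in> F) \<and> (shift ^^ j) y = x"
      using u(1,2) by (intro bexI[of _ y] exI[of _ "N + m"]) auto
  qed
qed

text \<open>A word and a connecting path back to its first letter form a loop; repeating it gives a periodic
  point.\<close>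

lemma periodic_point:
  assumes z: "z \<in> E"
  shows "\<exists>y\<in>E. \<exists>n>0. agree (Suc N) y z \<and> (shift ^^ n) y = y"
proof -
  obtain u m where u: "1 \<le> m" "u 0 = z N" "u m = z 0"
    "\<And>t. t < m \<Longrightarrow> A (u t) (u (Suc t)) = 1" "\<And>t. u t \<in> I"
    using connecting_paths z unfolding mem_E by metis
  define n where "n = N + m"
  define c where "c t = (if t < N then z t else u (t - N))" for t
  have c: "A (c t) (c (Suc t)) = 1" if "t < n" for t
  proof -
    consider "Suc t < N" | "Suc t = N" | "N \<le> t" by linarith
    then show ?thesis
    proof cases
      case 1 then show ?thesis using z by (auto simp: c_def mem_E)
    next
      case 2 then show ?thesis using z u by (auto simp: c_def mem_E)
    next
      case 3 then show ?thesis using u(4)[of "t - N"] that by (auto simp: c_def n_def Suc_diff_le)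
    qed
  qed
  have n: "n > 0" and cn: "c n = c 0" using u by (auto simp: n_def c_def)
  define y where "y t = c (t mod n)" for t
  have "y t \<in> I" for t using z u(5) by (auto simp: y_def c_def mem_E)
  moreover have "A (y t) (y (Suc t)) = 1" for t
    using c[of "t mod n"] n cn by (auto simp: y_def mod_Suc)
  ultimately have "y \<in> E" by (auto simp: mem_E)
  moreover have "agree (Suc N) y z" using u(1,2) by (auto simp: agree_def y_def c_def n_def less_Suc_eq)
  moreover have "(shift ^^ n) y = y" by (auto simp: funpow_shift y_def)
  ultimately show ?thesis using n by blast
qed

end

section \<open>The Banach space of bounded Hoelder functions\<close>

lemma ennreal_divide_le_iff:
  fixes v :: ennreal
  assumes "c > 0" "b \<ge> 0"
  shows "v / ennreal c \<le> ennreal b \<longleftrightarrow> v \<le> ennreal (b * c)"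
proof (cases v)
  case (real r)
  then show ?thesis using assms by (simp add: divide_ennreal field_simps)
next
  case top
  then show ?thesis using assms by (simp add: ennreal_top_divide top_unique)
qed

context markov_shift
begin

definition lip_bound :: "((nat \<Rightarrow> nat) \<Rightarrow> 'a::real_normed_vector) \<Rightarrow> real \<Rightarrow> bool" where
  "lip_bound g b \<longleftrightarrow> (\<forall>n\<ge>1. \<forall>x\<in>E. \<forall>y\<in>E. agree n x y \<longrightarrow> norm (g x - g y) \<le> b * \<theta> ^ n)"

lemma lip_boundD: "lip_bound g b \<Longrightarrow> n \<ge> 1 \<Longrightarrow> x \<in> E \<Longrightarrow> y \<in> E \<Longrightarrow> agree n x y \<Longrightarrow> norm (g x - g y) \<le> b * \<theta> ^ n"
  by (auto simp: lip_bound_def)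

lemma lip_bound_nonneg: "lip_bound g b \<Longrightarrow> b \<ge> 0"
proof -
  obtain x where x: "x \<in> E" using E_nonempty by blast
  assume "lip_bound g b"
  from lip_boundD[OF this order_refl x x] show "b \<ge> 0"
    using \<theta>_pos by (simp add: agree_def zero_le_mult_iff)
qed

text \<open>All estimates use real Lipschitz constants; the extended seminorm enters through this
  equivalence.\<close>

lemma theta_seminorm_le_iff:
  assumes "b \<ge> 0"
  shows "theta_seminorm \<theta> E g \<le> ennreal b \<longleftrightarrow> lip_bound g b"
proof -
  have "variation E n g \<le> ennreal (b * \<theta> ^ n) \<longleftrightarrow>
     (\<forall>x\<in>E. \<forall>y\<in>E. agree n x y \<longrightarrow> norm (g x - g y) \<le> b * \<theta> ^ n)" for n
  proof -
    have "variation E n g \<le> ennreal (b * \<theta> ^ n) \<longleftrightarrow>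
       (\<forall>x\<in>E. \<forall>y\<in>E. agree n x y \<longrightarrow> ennreal (norm (g x - g y)) \<le> ennreal (b * \<theta> ^ n))"
      unfolding variation_def agree_def Sup_le_iff by blast
    then show ?thesis using assms \<theta>_pos by (simp add: ennreal_le_iff)
  qed
  then show ?thesis
    unfolding theta_seminorm_def SUP_le_iff lip_bound_def
    using assms \<theta>_pos by (auto simp: ennreal_divide_le_iff)
qed

lemma lip_bound_continuous:
  assumes "lip_bound g b"
  shows "continuous_on E g"
  unfolding continuous_on_def
proof (intro ballI tendstoI)
  fix x and e :: real assume x: "x \<in> E" and "e > 0"
  have "(\<lambda>n. b * \<theta> ^ n) \<longlonglongrightarrow> b * 0"
    using \<theta>_pos \<theta>_less by (intro tendsto_intros LIMSEQ_realpow_zero) auto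
  then have "\<forall>\<^sub>F n in sequentially. b * \<theta> ^ n < e" using \<open>e > 0\<close> by (auto simp: order_tendsto_iff)
  then have "\<forall>\<^sub>F n in sequentially. b * \<theta> ^ n < e \<and> n \<ge> 1"
    using eventually_ge_at_top by (rule eventually_conj)
  then obtain n where n: "b * \<theta> ^ n < e" "n \<ge> 1" using eventually_happens by force
  have "\<forall>\<^sub>F y in at x within E. agree n x y \<and> y \<in> E"
    unfolding eventually_at_topological using open_agree[of n x]
    by (intro exI[of _ "{y. agree n x y}"]) (auto simp: agree_def)
  then show "\<forall>\<^sub>F y in at x within E. dist (g y) (g x) < e"
  proof eventually_elim
    case (elim y)
    then have "norm (g x - g y) \<le> b * \<theta> ^ n" using lip_boundD[OF assms n(2) x] by blast
    then show ?case using n(1) by (simp add: dist_norm norm_minus_commute)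
  qed
qed

abbreviation "\<B> \<equiv> bounded_theta_functions \<theta> E"

definition nrm :: "((nat \<Rightarrow> nat) \<Rightarrow> complex) \<Rightarrow> real" where
  "nrm g = enn2real (banach_norm \<theta> E g)"

lemma nrm_nonneg: "nrm g \<ge> 0" by (simp add: nrm_def)

definition lip :: "((nat \<Rightarrow> nat) \<Rightarrow> complex) \<Rightarrow> real" where
  "lip g = enn2real (theta_seminorm \<theta> E g)"

lemma \<B>I:
  assumes "\<And>x. x \<in> E \<Longrightarrow> norm (g x) \<le> a" "lip_bound g b" "\<And>x. x \<notin> E \<Longrightarrow> g x = 0"
  shows "g \<in> \<B>"
proof -
  have "theta_seminorm \<theta> E g \<le> ennreal b"
    using assms(2) lip_bound_nonneg theta_seminorm_le_iff by blast
  then have "theta_seminorm \<theta> E g < \<infinity>" by (simp add: le_less_trans)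
  moreover have "bounded (g ` E)" using assms(1) by (auto simp: bounded_iff)
  ultimately show ?thesis
    using lip_bound_continuous[OF assms(2)] assms(3) by (simp add: bounded_theta_functions_def)
qed

lemma theta_functions_lip:
  assumes "g \<in> theta_functions \<theta> E"
  obtains b where "lip_bound g b" "b \<ge> 0"
proof -
  have "theta_seminorm \<theta> E g < \<infinity>" using assms by (simp add: theta_functions_def)
  then obtain b where b: "b \<ge> 0" "theta_seminorm \<theta> E g = ennreal b"
    by (cases "theta_seminorm \<theta> E g") auto
  then have "lip_bound g b" using theta_seminorm_le_iff[OF b(1), of g] by simp
  then show thesis using that b(1) by blast
qed

lemma \<B>D:
  assumes "g \<in> \<B>"
  shows "lip_bound g (lip g)" "lip g \<ge> 0" "banach_norm \<theta> E g = ennreal (nrm g)"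
    "\<And>x. x \<in> E \<Longrightarrow> norm (g x) + lip g \<le> nrm g" "\<And>x. x \<notin> E \<Longrightarrow> g x = 0"
proof -
  have s: "theta_seminorm \<theta> E g < \<infinity>" and bd: "bounded (g ` E)"
    using assms by (auto simp: bounded_theta_functions_def)
  show l: "lip g \<ge> 0" by (simp add: lip_def)
  have lip: "theta_seminorm \<theta> E g = ennreal (lip g)" using s by (simp add: lip_def)
  then show "lip_bound g (lip g)" using theta_seminorm_le_iff[OF l, of g] by simp
  obtain a where a: "\<And>x. x \<in> E \<Longrightarrow> norm (g x) \<le> a" using bd by (auto simp: bounded_iff)
  have "sup_norm E g \<le> ennreal a" unfolding sup_norm_def using a by (intro SUP_least ennreal_leI)
  then have "sup_norm E g < \<infinity>" by (simp add: le_less_trans)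
  then have "banach_norm \<theta> E g < \<infinity>" using s by (simp add: banach_norm_def)
  then show nn: "banach_norm \<theta> E g = ennreal (nrm g)" by (simp add: nrm_def)
  show "norm (g x) + lip g \<le> nrm g" if "x \<in> E" for x
  proof -
    have "ennreal (norm (g x)) \<le> sup_norm E g" unfolding sup_norm_def using that by (rule SUP_upper)
    then have "ennreal (norm (g x) + lip g) \<le> banach_norm \<theta> E g"
      using l by (simp add: banach_norm_def lip add.commute add_mono)
    then show ?thesis unfolding nn by (simp add: nrm_nonneg)
  qed
  show "g x = 0" if "x \<notin> E" for x using assms that by (auto simp: bounded_theta_functions_def)
qed

lemma norm_le_nrm: "g \<in> \<B> \<Longrightarrow> x \<in> E \<Longrightarrow> norm (g x) \<le> nrm g"
  using \<B>D(2,4) by force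

lemma lip_le_nrm: "g \<in> \<B> \<Longrightarrow> lip g \<le> nrm g"
  using \<B>D(4) E_nonempty norm_ge_zero by (smt (verit, best) all_not_in_conv)

lemma lip_bound_nrm: "g \<in> \<B> \<Longrightarrow> lip_bound g (nrm g)"
  using \<B>D(1) lip_le_nrm \<theta>_pos unfolding lip_bound_def
  by (meson mult_right_mono order_trans zero_le_power less_imp_le)

lemma lip_le: "lip_bound g b \<Longrightarrow> lip g \<le> b"
  using theta_seminorm_le_iff[of b g] lip_bound_nonneg[of g b] unfolding lip_def
  by (metis enn2real_leI)

text \<open>The sum of two suprema, as one supremum of a jointly varying expression. In this form a
  bound on the norm passes to pointwise limits.\<close>

lemma nrm_leI:
  assumes "\<And>x n y z. x \<in> E \<Longrightarrow> n \<ge> 1 \<Longrightarrow> y \<in> E \<Longrightarrow> z \<in> E \<Longrightarrow> agree n y z \<Longrightarrow>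
      norm (g x) + norm (g y - g z) / \<theta> ^ n \<le> c"
    and "\<And>x. x \<notin> E \<Longrightarrow> g x = 0"
  shows "g \<in> \<B>" "nrm g \<le> c"
proof -
  have lb: "lip_bound g (c - norm (g x))" if "x \<in> E" for x
    unfolding lip_bound_def
  proof (intro allI impI ballI)
    fix n y z assume "1 \<le> n" "y \<in> E" "z \<in> E" "agree n y z"
    from assms(1)[OF that this] show "norm (g y - g z) \<le> (c - norm (g x)) * \<theta> ^ n"
      using \<theta>_pos by (simp add: field_simps)
  qed
  obtain x0 where x0: "x0 \<in> E" using E_nonempty by blast
  have le: "norm (g x) \<le> c" if "x \<in> E" for x using lip_bound_nonneg[OF lb[OF that]] by simp
  show "g \<in> \<B>" by (rule \<B>I[OF le lb[OF x0] assms(2)])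
  note gD = \<B>D[OF this]
  have "lip g \<le> c - norm (g x)" if "x \<in> E" for x by (rule lip_le[OF lb[OF that]])
  then have "norm (g x) \<le> c - lip g" if "x \<in> E" for x using that by force
  then have s: "sup_norm E g \<le> ennreal (c - lip g)"
    unfolding sup_norm_def by (intro SUP_least ennreal_leI)
  have cl: "c - lip g \<ge> 0" using lip_le[OF lb[OF x0]] norm_ge_zero[of "g x0"] by linarith
  have "theta_seminorm \<theta> E g \<le> ennreal (lip g)" using gD(1,2) theta_seminorm_le_iff by blast
  with s have "banach_norm \<theta> E g \<le> ennreal (lip g) + ennreal (c - lip g)"
    unfolding banach_norm_def by (rule add_mono[rotated])
  also have "\<dots> = ennreal c" using gD(2) cl by (simp flip: ennreal_plus)
  finally show "nrm g \<le> c" unfolding nrm_def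
    using cl gD(2) by (intro enn2real_leI) auto
qed

lemma nrm_le_add:
  assumes "\<And>x. x \<in> E \<Longrightarrow> norm (g x) \<le> a" "lip_bound g b" "\<And>x. x \<notin> E \<Longrightarrow> g x = 0"
  shows "g \<in> \<B>" "nrm g \<le> a + b"
proof -
  have "norm (g x) + norm (g y - g z) / \<theta> ^ n \<le> a + b"
    if "x \<in> E" "n \<ge> 1" "y \<in> E" "z \<in> E" "agree n y z" for x n y z
    using assms(1)[OF that(1)] lip_boundD[OF assms(2) that(2-5)] \<theta>_pos
    by (intro add_mono) (auto simp: field_simps)
  from nrm_leI[OF this assms(3)] show "g \<in> \<B>" "nrm g \<le> a + b" by auto
qed

lemma nrm_joint_bound:
  assumes "g \<in> \<B>" "x \<in> E" "n \<ge> 1" "y \<in> E" "z \<in> E" "agree n y z"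
  shows "norm (g x) + norm (g y - g z) / \<theta> ^ n \<le> nrm g"
proof -
  have "norm (g y - g z) / \<theta> ^ n \<le> lip g"
    using lip_boundD[OF \<B>D(1)[OF assms(1)] assms(3-6)] \<theta>_pos by (simp add: field_simps)
  then show ?thesis using \<B>D(4)[OF assms(1,2)] by simp
qed

lemma banach_norm_scale: "banach_norm \<theta> E (\<lambda>x. c * g x) \<le> ennreal (cmod c) * banach_norm \<theta> E g"
proof -
  have v: "variation E n (\<lambda>x. c * g x) \<le> ennreal (cmod c) * variation E n g" for n
    unfolding variation_def
  proof (rule Sup_least, clarify)
    fix x y assume xy: "x \<in> E" "y \<in> E" "\<forall>i<n. x i = y i"
    have "ennreal (cmod (c * g x - c * g y)) = ennreal (cmod c) * ennreal (cmod (g x - g y))"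
      by (simp add: norm_mult ennreal_mult flip: right_diff_distrib)
    also have "\<dots> \<le> ennreal (cmod c) * Sup {ennreal (norm (g x - g y)) |x y. x \<in> E \<and> y \<in> E \<and> (\<forall>i<n. x i = y i)}"
      using xy by (intro mult_left_mono Sup_upper) auto
    finally show "ennreal (cmod (c * g x - c * g y)) \<le> \<dots>" .
  qed
  have "theta_seminorm \<theta> E (\<lambda>x. c * g x) \<le> ennreal (cmod c) * theta_seminorm \<theta> E g"
    unfolding theta_seminorm_def
  proof (rule SUP_least)
    fix n :: nat assume n: "n \<in> {1..}"
    have "variation E n (\<lambda>x. c * g x) / ennreal (\<theta> ^ n) \<le> ennreal (cmod c) * variation E n g / ennreal (\<theta> ^ n)"
      by (rule divide_right_mono_ennreal[OF v])
    also have "\<dots> = ennreal (cmod c) * (variation E n g / ennreal (\<theta> ^ n))"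
      by (simp add: ennreal_times_divide)
    also have "\<dots> \<le> ennreal (cmod c) * (SUP n\<in>{1..}. variation E n g / ennreal (\<theta> ^ n))"
      using n by (intro mult_left_mono SUP_upper) auto
    finally show "variation E n (\<lambda>x. c * g x) / ennreal (\<theta> ^ n) \<le> \<dots>" .
  qed
  moreover have "sup_norm E (\<lambda>x. c * g x) \<le> ennreal (cmod c) * sup_norm E g"
    unfolding sup_norm_def
    by (intro SUP_least) (auto simp: norm_mult ennreal_mult intro!: mult_left_mono SUP_upper)
  ultimately show ?thesis unfolding banach_norm_def by (simp add: distrib_left add_mono)
qed

lemma nrm_scale: "nrm (\<lambda>x. c * g x) = cmod c * nrm g"
proof (cases "c = 0")
  case True
  then show ?thesis using banach_norm_scale[of 0 g] by (simp add: nrm_def)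
next
  case False
  have "banach_norm \<theta> E g = banach_norm \<theta> E (\<lambda>x. (1 / c) * (c * g x))" using False by simp
  also have "\<dots> \<le> ennreal (cmod (1 / c)) * banach_norm \<theta> E (\<lambda>x. c * g x)" by (rule banach_norm_scale)
  finally have "ennreal (cmod c) * banach_norm \<theta> E g
      \<le> ennreal (cmod c) * (ennreal (cmod (1 / c)) * banach_norm \<theta> E (\<lambda>x. c * g x))"
    by (intro mult_left_mono) auto
  also have "\<dots> = banach_norm \<theta> E (\<lambda>x. c * g x)"
    using False by (simp add: norm_divide mult.assoc[symmetric] flip: ennreal_mult)
  finally have "banach_norm \<theta> E (\<lambda>x. c * g x) = ennreal (cmod c) * banach_norm \<theta> E g"
    using banach_norm_scale[of c g] by (intro antisym)
  then show ?thesis by (simp add: nrm_def enn2real_mult)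
qed

text \<open>Joint bounds in the form above survive the passage to the pointwise limit of a Cauchy
  sequence.\<close>

lemma \<B>_complete:
  assumes s: "\<And>n::nat. s n \<in> \<B>"
    and cauchy: "\<And>e. e > 0 \<Longrightarrow> \<exists>M. \<forall>m\<ge>M. \<forall>n\<ge>M. nrm (\<lambda>x. s m x - s n x) < e"
    and diff: "\<And>m n. (\<lambda>x. s m x - s n x) \<in> \<B>"
  shows "\<exists>l\<in>\<B>. \<forall>e>0. \<exists>M. \<forall>n\<ge>M. nrm (\<lambda>x. s n x - l x) < e"
proof -
  have "Cauchy (\<lambda>n. s n x)" if x: "x \<in> E" for x
  proof (rule CauchyI)
    fix e :: real assume "e > 0"
    then obtain M where "\<forall>m\<ge>M. \<forall>n\<ge>M. nrm (\<lambda>x. s m x - s n x) < e" using cauchy by blast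
    then show "\<exists>M. \<forall>m\<ge>M. \<forall>n\<ge>M. norm (s m x - s n x) < e"
      using norm_le_nrm[OF diff x] by (meson le_less_trans)
  qed
  then have "\<exists>v. (\<lambda>n. s n x) \<longlonglongrightarrow> v" if "x \<in> E" for x
    using that Cauchy_convergent_iff convergent_def by blast
  then obtain l0 where l0: "\<And>x. x \<in> E \<Longrightarrow> (\<lambda>n. s n x) \<longlonglongrightarrow> l0 x" by metis
  define l where "l x = (if x \<in> E then l0 x else 0)" for x
  have l: "(\<lambda>n. s n x) \<longlonglongrightarrow> l x" if "x \<in> E" for x using l0[OF that] that by (simp add: l_def)
  have near: "(\<lambda>x. s n x - l x) \<in> \<B> \<and> nrm (\<lambda>x. s n x - l x) \<le> e"
    if M: "\<forall>m\<ge>M. \<forall>n\<ge>M. nrm (\<lambda>x. s m x - s n x) < e" and n: "n \<ge> M" for e M n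
  proof -
    have "norm (s n x - l x) + norm ((s n y - l y) - (s n z - l z)) / \<theta> ^ k \<le> e"
      if xyz: "x \<in> E" "k \<ge> 1" "y \<in> E" "z \<in> E" "agree k y z" for x k y z
    proof (rule tendsto_upperbound)
      show "((\<lambda>m. norm (s n x - s m x) + norm ((s n y - s m y) - (s n z - s m z)) / \<theta> ^ k)
         \<longlongrightarrow> norm (s n x - l x) + norm ((s n y - l y) - (s n z - l z)) / \<theta> ^ k) sequentially"
        using xyz \<theta>_pos by (intro tendsto_intros l) auto
      show "\<forall>\<^sub>F m in sequentially. norm (s n x - s m x) + norm ((s n y - s m y) - (s n z - s m z)) / \<theta> ^ k \<le> e"
        using eventually_ge_at_top[of M]
      proof eventually_elim
        case (elim m)
        then have "nrm (\<lambda>x. s n x - s m x) < e" using M n by blast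
        then show ?case using nrm_joint_bound[OF diff[of n m] xyz] by simp
      qed
    qed simp
    from nrm_leI[of "\<lambda>x. s n x - l x", OF this] show ?thesis
      using \<B>D(5)[OF s] by (auto simp: l_def)
  qed
  obtain M where "\<forall>m\<ge>M. \<forall>n\<ge>M. nrm (\<lambda>x. s m x - s n x) < 1" using cauchy[of 1] by auto
  then have d: "(\<lambda>x. s M x - l x) \<in> \<B>" using near by blast
  have "l \<in> \<B>"
  proof (rule \<B>I)
    show "norm (l x) \<le> nrm (s M) + nrm (\<lambda>x. s M x - l x)" if "x \<in> E" for x
      using norm_le_nrm[OF s that, of M] norm_le_nrm[OF d that] norm_triangle_sub[of "l x" "s M x"]
      by (simp add: norm_minus_commute)
    show "lip_bound l (nrm (s M) + nrm (\<lambda>x. s M x - l x))"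
      unfolding lip_bound_def
    proof (intro allI ballI impI)
      fix n x y assume h: "1 \<le> n" "x \<in> E" "y \<in> E" "agree n x y"
      have "norm (l x - l y) \<le> norm (s M x - s M y) + norm ((s M x - l x) - (s M y - l y))"
        using norm_triangle_ineq4[of "s M x - s M y" "(s M x - l x) - (s M y - l y)"] by simp
      then show "norm (l x - l y) \<le> (nrm (s M) + nrm (\<lambda>x. s M x - l x)) * \<theta> ^ n"
        using lip_boundD[OF lip_bound_nrm[OF s] h, of M] lip_boundD[OF lip_bound_nrm[OF d] h]
        by (simp add: distrib_right)
    qed
  qed (simp add: l_def)
  moreover have "\<exists>M. \<forall>n\<ge>M. nrm (\<lambda>x. s n x - l x) < e" if e: "e > 0" for e
  proof -
    obtain M where "\<forall>m\<ge>M. \<forall>n\<ge>M. nrm (\<lambda>x. s m x - s n x) < e/2" using cauchy[OF half_gt_zero[OF e]] by blast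
    then have "\<forall>n\<ge>M. nrm (\<lambda>x. s n x - l x) \<le> e/2" using near by blast
    then show ?thesis using e by (intro exI[of _ M]) force
  qed
  ultimately show ?thesis by blast
qed

end

section \<open>Weighted transfer operators\<close>

lemma infsum_diff:
  fixes f g :: "'a \<Rightarrow> 'b::real_normed_vector"
  assumes "f summable_on A" "g summable_on A"
  shows "infsum (\<lambda>x. f x - g x) A = infsum f A - infsum g A"
  using infsum_add[OF assms(1), of "\<lambda>x. - g x"] assms(2) by (simp add: infsum_uminus summable_on_uminus)

context markov_shift
begin

lemma lip_bound_add:
  assumes "lip_bound f a" "lip_bound g b"
  shows "lip_bound (\<lambda>x. f x + g x) (a + b)"
  unfolding lip_bound_def
proof (intro allI ballI impI)
  fix n x y assume h: "1 \<le> n" "x \<in> E" "y \<in> E" "agree n x y"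
  have "norm (f x + g x - (f y + g y)) \<le> norm (f x - f y) + norm (g x - g y)"
    using norm_triangle_ineq[of "f x - f y" "g x - g y"] by (simp add: algebra_simps)
  then show "norm (f x + g x - (f y + g y)) \<le> (a + b) * \<theta> ^ n"
    using lip_boundD[OF assms(1) h] lip_boundD[OF assms(2) h] by (simp add: distrib_right)
qed

lemma \<B>_zero: "(\<lambda>x. 0) \<in> \<B>"
  by (rule \<B>I[of _ 0 0]) (auto simp: lip_bound_def)

lemma lip_bound_scale: "lip_bound g b \<Longrightarrow> lip_bound (\<lambda>x. c * g x) (cmod c * b)"
  unfolding lip_bound_def
  by (auto simp: norm_mult mult.assoc simp flip: right_diff_distrib intro!: mult_left_mono)

lemma \<B>_scale: 
  assumes g: "g \<in> \<B>"
  shows "(\<lambda>x. c * g x) \<in> \<B>"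
proof (rule \<B>I)
  show "norm (c * g x) \<le> cmod c * nrm g" if "x \<in> E" for x
    using norm_le_nrm[OF g that] by (simp add: norm_mult mult_left_mono)
qed (use lip_bound_scale[OF lip_bound_nrm[OF g]] \<B>D(5)[OF g] in auto)

lemma \<B>_add:
  assumes f: "f \<in> \<B>" and g: "g \<in> \<B>"
  shows "(\<lambda>x. f x + g x) \<in> \<B>"
proof (rule \<B>I)
  show "norm (f x + g x) \<le> nrm f + nrm g" if "x \<in> E" for x
    using norm_le_nrm[OF f that] norm_le_nrm[OF g that] norm_triangle_ineq[of "f x" "g x"] by linarith
  show "lip_bound (\<lambda>x. f x + g x) (nrm f + nrm g)" by (intro lip_bound_add lip_bound_nrm f g)
qed (simp add: \<B>D(5)[OF f] \<B>D(5)[OF g])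

lemma \<B>_diff: "f \<in> \<B> \<Longrightarrow> g \<in> \<B> \<Longrightarrow> (\<lambda>x. f x - g x) \<in> \<B>"
  using \<B>_add[OF _ \<B>_scale[of g "-1"], of f] by simp

lemma nrm_add:
  assumes f: "f \<in> \<B>" and g: "g \<in> \<B>"
  shows "nrm (\<lambda>x. f x + g x) \<le> nrm f + nrm g"
proof (rule nrm_leI(2))
  show "norm (f x + g x) + norm ((f y + g y) - (f z + g z)) / \<theta> ^ n \<le> nrm f + nrm g"
    if h: "x \<in> E" "n \<ge> 1" "y \<in> E" "z \<in> E" "agree n y z" for x n y z
  proof -
    have "norm ((f y + g y) - (f z + g z)) \<le> norm (f y - f z) + norm (g y - g z)"
      using norm_triangle_ineq[of "f y - f z" "g y - g z"] by (simp add: algebra_simps)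
    then have "norm ((f y + g y) - (f z + g z)) / \<theta> ^ n \<le> norm (f y - f z) / \<theta> ^ n + norm (g y - g z) / \<theta> ^ n"
      using \<theta>_pos by (simp add: divide_right_mono flip: add_divide_distrib)
    then show ?thesis
      using nrm_joint_bound[OF f h] nrm_joint_bound[OF g h] norm_triangle_ineq[of "f x" "g x"] by linarith
  qed
qed (simp add: \<B>D(5)[OF f] \<B>D(5)[OF g])

sublocale fs: complete_function_norm \<B> nrm
proof
  show "g = (\<lambda>x. 0)" if "g \<in> \<B>" "nrm g = 0" for g
  proof
    show "g x = 0" for x
      using norm_le_nrm[OF that(1), of x] \<B>D(5)[OF that(1), of x] that(2) by (cases "x \<in> E") auto
  qed
  show "\<exists>l\<in>\<B>. \<forall>e>0. \<exists>M. \<forall>n\<ge>M. nrm (\<lambda>x. s n x - l x) < e"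
    if "\<And>n::nat. s n \<in> \<B>" "\<And>e. e > 0 \<Longrightarrow> \<exists>M. \<forall>m\<ge>M. \<forall>n\<ge>M. nrm (\<lambda>x. s m x - s n x) < e" for s
    using that by (intro \<B>_complete \<B>_diff)
qed (fact \<B>_zero \<B>_add \<B>_scale nrm_nonneg nrm_add nrm_scale)+

lemma inj_on_preimages: "inj_on (\<lambda>y. y 0) (preimages x)"
  by (metis (no_types, lifting) case_nat_shift inj_onI preimagesD(2))

lemma summable_letters:
  fixes b :: "nat \<Rightarrow> real"
  assumes b: "b summable_on I" "\<And>e. e \<in> I \<Longrightarrow> b e \<ge> 0"
  shows "(\<lambda>y. b (y 0)) summable_on preimages x" "(\<Sum>\<^sub>\<infinity>y\<in>preimages x. b (y 0)) \<le> infsum b I"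
proof -
  let ?J = "(\<lambda>y. y 0) ` preimages x"
  have J: "?J \<subseteq> I" by (auto simp: preimages_def mem_E)
  have s: "b summable_on ?J" by (rule summable_on_subset_banach[OF b(1) J])
  then show "(\<lambda>y. b (y 0)) summable_on preimages x"
    using summable_on_reindex[OF inj_on_preimages, of b x] by (simp add: o_def)
  have "(\<Sum>\<^sub>\<infinity>y\<in>preimages x. b (y 0)) = infsum b ?J"
    using infsum_reindex[OF inj_on_preimages, of b x] by (simp add: o_def)
  also have "\<dots> \<le> infsum b I" using s b J by (intro infsum_mono_neutral) auto
  finally show "(\<Sum>\<^sub>\<infinity>y\<in>preimages x. b (y 0)) \<le> infsum b I" .
qed

lemma summable_preimages:
  fixes F :: "(nat \<Rightarrow> nat) \<Rightarrow> 'a::banach" and b :: "nat \<Rightarrow> real"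
  assumes b: "b summable_on I" "\<And>e. e \<in> I \<Longrightarrow> b e \<ge> 0"
    and F: "\<And>y. y \<in> preimages x \<Longrightarrow> norm (F y) \<le> b (y 0)"
  shows "F summable_on preimages x" "norm (\<Sum>\<^sub>\<infinity>y\<in>preimages x. F y) \<le> infsum b I"
proof -
  have "(\<lambda>y. norm (F y)) summable_on preimages x"
    by (rule summable_on_comparison_test[OF summable_letters(1)[OF b]]) (auto intro: F)
  then show s: "F summable_on preimages x" by (rule abs_summable_summable)
  have "norm (\<Sum>\<^sub>\<infinity>y\<in>preimages x. F y) \<le> (\<Sum>\<^sub>\<infinity>y\<in>preimages x. b (y 0))"
    by (rule norm_infsum_le[OF has_sum_infsum[OF s] has_sum_infsum[OF summable_letters(1)[OF b]] F])
  also have "\<dots> \<le> infsum b I" by (rule summable_letters(2)[OF b])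
  finally show "norm (\<Sum>\<^sub>\<infinity>y\<in>preimages x. F y) \<le> infsum b I" .
qed

text \<open>Arbitrary weights are allowed because the derivative of the transfer operator in the parameter
  and the remainder of its Taylor expansion are operators of this kind as well.\<close>

definition weighted_op :: "((nat \<Rightarrow> nat) \<Rightarrow> complex) \<Rightarrow> fun_op" where
  "weighted_op W g = (\<lambda>x. if x \<in> E then (\<Sum>\<^sub>\<infinity>y\<in>preimages x. W y * g y) else 0)"

lemma transfer_op_eq: "transfer_op E f = weighted_op (\<lambda>y. exp (f y))"
  by (simp add: transfer_op_def weighted_op_def preimages_def fun_eq_iff)

text \<open>\<open>b e\<close> bounds both the supremum and the Lipschitz constant of \<open>W\<close> on the cylinder \<open>[e]\<close>.\<close>

definition weight_bound :: "((nat \<Rightarrow> nat) \<Rightarrow> complex) \<Rightarrow> (nat \<Rightarrow> real) \<Rightarrow> bool" where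
  "weight_bound W b \<longleftrightarrow> b summable_on I \<and> (\<forall>e\<in>I. 0 \<le> b e) \<and> (\<forall>y\<in>E. cmod (W y) \<le> b (y 0)) \<and>
     (\<forall>n\<ge>1. \<forall>x\<in>E. \<forall>y\<in>E. agree n x y \<longrightarrow> cmod (W x - W y) \<le> b (x 0) * \<theta> ^ n)"

lemma weight_boundD:
  assumes "weight_bound W b"
  shows "b summable_on I" "\<And>e. e \<in> I \<Longrightarrow> 0 \<le> b e" "\<And>y. y \<in> E \<Longrightarrow> cmod (W y) \<le> b (y 0)"
    "\<And>n x y. n \<ge> 1 \<Longrightarrow> x \<in> E \<Longrightarrow> y \<in> E \<Longrightarrow> agree n x y \<Longrightarrow> cmod (W x - W y) \<le> b (x 0) * \<theta> ^ n"
  using assms by (auto simp: weight_bound_def)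

lemma weighted_summable:
  assumes W: "weight_bound W b" and g: "\<And>y. y \<in> E \<Longrightarrow> cmod (g y) \<le> c"
  shows "(\<lambda>y. W y * g y) summable_on preimages x"
    "cmod (\<Sum>\<^sub>\<infinity>y\<in>preimages x. W y * g y) \<le> infsum b I * c"
proof -
  note WD = weight_boundD[OF W]
  obtain x0 where "x0 \<in> E" using E_nonempty by blast
  then have c: "c \<ge> 0" using g norm_ge_zero order_trans by blast
  have b: "(\<lambda>e. b e * c) summable_on I" "\<And>e. e \<in> I \<Longrightarrow> b e * c \<ge> 0"
    using WD c by (auto intro: summable_on_cmult_left)
  have F: "cmod (W y * g y) \<le> b (y 0) * c" if "y \<in> preimages x" for y
    unfolding norm_mult using that WD c g by (intro mult_mono) (auto simp: preimages_def mem_E)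
  show "(\<lambda>y. W y * g y) summable_on preimages x" using b F by (rule summable_preimages(1))
  show "cmod (\<Sum>\<^sub>\<infinity>y\<in>preimages x. W y * g y) \<le> infsum b I * c"
    using summable_preimages(2)[of "\<lambda>e. b e * c" x "\<lambda>y. W y * g y"] b F by (simp add: infsum_cmult_left')
qed

lemma branch_mem:
  assumes "x \<in> E" "x' \<in> E" "agree 1 x x'" "y \<in> preimages x"
  shows "case_nat (y 0) x' \<in> E" "case_nat (y 0) x' \<in> preimages x'"
  using bij_preimages[OF assms(1-3)] assms(4) by (auto simp: bij_betw_def preimages_def)

lemma infsum_branch:
  assumes "x \<in> E" "x' \<in> E" "agree 1 x x'"
  shows "infsum F (preimages x') = (\<Sum>\<^sub>\<infinity>y\<in>preimages x. F (case_nat (y 0) x'))"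
  using infsum_reindex_bij_betw[OF bij_preimages[OF assms], of F] by simp

text \<open>Comparison of two sums over inverse branches, letter by letter. One application of the operator
  gains a factor \<open>\<theta>\<close>, since corresponding preimages agree in one more letter.\<close>

lemma transfer_variation:
  assumes W: "weight_bound W b" and k: "\<And>y. y \<in> E \<Longrightarrow> cmod (k y) \<le> m" and \<Lambda>: "lip_bound k \<Lambda>"
    and n: "n \<ge> 1" and x: "x \<in> E" "x' \<in> E" and ag: "agree n x x'"
  shows "cmod ((\<Sum>\<^sub>\<infinity>y\<in>preimages x. W y * k y) - (\<Sum>\<^sub>\<infinity>y\<in>preimages x'. W y * k y))
    \<le> ((\<Sum>\<^sub>\<infinity>y\<in>preimages x. cmod (W y)) * \<Lambda> + infsum b I * m) * \<theta> ^ Suc n"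
proof -
  note WD = weight_boundD[OF W]
  have m0: "m \<ge> 0" using k[OF x(1)] norm_ge_zero order_trans by blast
  have ag1: "agree 1 x x'" using agree_mono[OF ag n] .
  let ?y' = "\<lambda>y. case_nat (y 0) x'"
  let ?d = "\<lambda>y. W y * k y - W (?y' y) * k (?y' y)"
  have s: "(\<lambda>y. W y * k y) summable_on preimages v" for v
    by (rule weighted_summable(1)[OF W k])
  have s': "(\<lambda>y. W (?y' y) * k (?y' y)) summable_on preimages x"
    using s[of x'] summable_on_reindex_bij_betw[OF bij_preimages[OF x ag1], of "\<lambda>y. W y * k y"] by simp
  have sd: "?d summable_on preimages x"
    using summable_on_add[OF s[of x], of "\<lambda>y. - (W (?y' y) * k (?y' y))"] s' by (simp add: summable_on_uminus)
  have sW: "(\<lambda>y. cmod (W y)) summable_on preimages x"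
    by (rule summable_preimages(1)[OF WD(1,2)]) (auto intro: WD(3) dest: preimagesD(1))
  let ?f = "\<lambda>y. cmod (W y) * (\<Lambda> * \<theta> ^ Suc n) + b (y 0) * (m * \<theta> ^ Suc n)"
  have f: "(?f has_sum ((\<Sum>\<^sub>\<infinity>y\<in>preimages x. cmod (W y)) * (\<Lambda> * \<theta> ^ Suc n)
      + (\<Sum>\<^sub>\<infinity>y\<in>preimages x. b (y 0)) * (m * \<theta> ^ Suc n))) (preimages x)"
    by (intro has_sum_add has_sum_cmult_left has_sum_infsum sW summable_letters(1)[OF WD(1,2)])
  have "cmod (infsum ?d (preimages x)) \<le> (\<Sum>\<^sub>\<infinity>y\<in>preimages x. cmod (W y)) * (\<Lambda> * \<theta> ^ Suc n)
      + (\<Sum>\<^sub>\<infinity>y\<in>preimages x. b (y 0)) * (m * \<theta> ^ Suc n)"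
  proof (rule norm_infsum_le[OF has_sum_infsum[OF sd] f])
    fix y assume y: "y \<in> preimages x"
    note y' = branch_mem[OF x ag1 y] agree_branch[OF y ag] preimagesD(1)[OF y]
    have "?d y = W y * (k y - k (?y' y)) + (W y - W (?y' y)) * k (?y' y)" by (simp add: algebra_simps)
    then have "cmod (?d y) \<le> cmod (W y) * cmod (k y - k (?y' y)) + cmod (W y - W (?y' y)) * cmod (k (?y' y))"
      by (metis norm_mult norm_triangle_ineq)
    also have "\<dots> \<le> cmod (W y) * (\<Lambda> * \<theta> ^ Suc n) + (b (y 0) * \<theta> ^ Suc n) * m"
      using lip_boundD[OF \<Lambda> _ y'(4,1,3)] WD(4)[OF _ y'(4,1,3)] k[OF y'(1)] m0
      by (intro add_mono mult_mono mult_left_mono) (auto intro: order_trans[OF norm_ge_zero])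
    finally show "cmod (?d y) \<le> ?f y" by (simp add: mult_ac)
  qed
  also have "\<dots> \<le> (\<Sum>\<^sub>\<infinity>y\<in>preimages x. cmod (W y)) * (\<Lambda> * \<theta> ^ Suc n) + infsum b I * (m * \<theta> ^ Suc n)"
    using summable_letters(2)[OF WD(1,2)] m0 \<theta>_pos by (intro add_left_mono mult_right_mono) auto
  finally show ?thesis
    by (simp add: infsum_branch[OF x ag1] infsum_diff[OF s s'] algebra_simps)
qed

lemma weighted_op_bounded:
  assumes W: "weight_bound W b"
  shows "fs.bounded_lin (weighted_op W) (2 * infsum b I)"
proof -
  note WD = weight_boundD[OF W]
  have \<beta>: "infsum b I \<ge> 0" by (intro infsum_nonneg WD)
  have bound: "weighted_op W g \<in> \<B> \<and> nrm (weighted_op W g) \<le> 2 * infsum b I * nrm g" if g: "g \<in> \<B>" for g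
  proof -
    have sup: "cmod (weighted_op W g x) \<le> infsum b I * nrm g" if "x \<in> E" for x
      using weighted_summable(2)[OF W norm_le_nrm[OF g]] that by (simp add: weighted_op_def)
    have lip: "lip_bound (weighted_op W g) (infsum b I * nrm g)"
      unfolding lip_bound_def
    proof (intro allI ballI impI)
      fix n x x' assume xx: "1 \<le> n" "x \<in> E" "x' \<in> E" "agree n x x'"
      have m: "cmod (g y) \<le> nrm g - lip g" if "y \<in> E" for y using \<B>D(4)[OF g that] by simp
      have "(\<Sum>\<^sub>\<infinity>y\<in>preimages x. cmod (W y)) \<le> infsum b I"
        using summable_preimages(2)[OF WD(1,2), of x "\<lambda>y. cmod (W y)"] WD(3) preimagesD(1) by fastforce
      then have "((\<Sum>\<^sub>\<infinity>y\<in>preimages x. cmod (W y)) * lip g + infsum b I * (nrm g - lip g)) * \<theta> ^ Suc n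
          \<le> (infsum b I * lip g + infsum b I * (nrm g - lip g)) * \<theta> ^ Suc n"
        using \<B>D(2)[OF g] \<theta>_pos by (intro mult_right_mono add_right_mono) auto
      also have "\<dots> = infsum b I * nrm g * \<theta> ^ Suc n" by (simp add: algebra_simps)
      also have "\<dots> \<le> infsum b I * nrm g * \<theta> ^ n"
        using \<beta> nrm_nonneg \<theta>_pos \<theta>_less by (intro mult_left_mono power_decreasing) auto
      finally show "cmod (weighted_op W g x - weighted_op W g x') \<le> infsum b I * nrm g * \<theta> ^ n"
        using transfer_variation[OF W m \<B>D(1)[OF g] xx] xx(2,3) by (simp add: weighted_op_def)
    qed
    from nrm_le_add[OF sup lip] show ?thesis by (simp add: weighted_op_def)
  qed
  have s: "(\<lambda>y. W y * g y) summable_on preimages x" if "g \<in> \<B>" for g x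
    by (rule weighted_summable(1)[OF W norm_le_nrm[OF that]])
  show ?thesis
    unfolding fs.bounded_lin_def
  proof (intro conjI ballI allI)
    fix g assume g: "g \<in> \<B>"
    show "weighted_op W g \<in> \<B>" "nrm (weighted_op W g) \<le> 2 * infsum b I * nrm g" using bound[OF g] by auto
    show "weighted_op W (\<lambda>x. c * g x) = (\<lambda>x. c * weighted_op W g x)" for c
      by (auto simp: weighted_op_def fun_eq_iff mult.left_commute infsum_cmult_right')
    fix h assume h: "h \<in> \<B>"
    show "weighted_op W (\<lambda>x. g x + h x) = (\<lambda>x. weighted_op W g x + weighted_op W h x)"
      by (auto simp: weighted_op_def fun_eq_iff distrib_left infsum_add s g h)
  qed
qed

lemma weighted_op_scale: "weighted_op (\<lambda>y. c * W y) g = (\<lambda>x. c * weighted_op W g x)"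
  by (auto simp: weighted_op_def fun_eq_iff mult.assoc infsum_cmult_right')

lemma op_norm_le:
  assumes TD: "\<And>g. g \<in> \<B> \<Longrightarrow> T g \<in> \<B>" "\<And>g. g \<in> \<B> \<Longrightarrow> nrm (T g) \<le> K * nrm g"
  shows "op_norm \<theta> E T \<le> ennreal K"
  unfolding op_norm_def
proof (rule SUP_least, clarify)
  fix g assume g: "g \<in> \<B>" "banach_norm \<theta> E g \<le> 1"
  then have g1: "nrm g \<le> 1" using \<B>D(3)[OF g(1)] by simp
  have "0 \<le> K * nrm g" using TD(2)[OF g(1)] nrm_nonneg order_trans by blast
  then have "K * nrm g \<le> max K 0 * 1" using g1 nrm_nonneg by (intro mult_mono) auto
  then have "nrm (T g) \<le> max K 0" using TD(2)[OF g(1)] by simp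
  then have "ennreal (nrm (T g)) \<le> ennreal (max K 0)" by (rule ennreal_leI)
  then show "banach_norm \<theta> E (T g) \<le> ennreal K" using \<B>D(3)[OF TD(1)[OF g(1)]]
    by (metis ennreal_neg max.absorb1 max.absorb2 linear ennreal_0)
qed

lemma bounded_lin_imp_bounded_operators:
  assumes "fs.bounded_lin T K"
  shows "T \<in> bounded_operators \<theta> E"
proof -
  note TD = fs.bounded_linD[OF assms]
  have "op_norm \<theta> E T \<le> ennreal K" by (rule op_norm_le[OF TD(1,2)])
  then have "op_norm \<theta> E T < \<infinity>" by (simp add: le_less_trans)
  then show ?thesis using TD unfolding bounded_operators_def by blast
qed

end

section \<open>Holomorphic dependence of the operators on the parameter\<close>

lemma cmod_exp_minus_1_le: "cmod (exp s - 1) \<le> cmod s * exp (cmod s)"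
  using Taylor_exp_field[of s 0] by (simp add: mult.commute)

lemma cmod_exp_minus_1_minus_le: "cmod (exp s - 1 - s) \<le> (cmod s)\<^sup>2 * exp (cmod s)"
  using Taylor_exp_field[of s 1] by (simp add: mult.commute power2_eq_square algebra_simps)

text \<open>Here \<open>t\<close> is an exponent at which the potential is summable, with the summable bound \<open>b0\<close> for the
  weights. All estimates for \<open>Re z < t\<close> are made relative to \<open>b0\<close>.\<close>

locale potential_family = markov_shift +
  fixes \<eta> \<xi> :: "(nat \<Rightarrow> nat) \<Rightarrow> real" and t H X :: real and b0 :: "nat \<Rightarrow> real"
  assumes \<eta>_lip: "lip_bound \<eta> H" and \<xi>_lip: "lip_bound \<xi> X" and \<xi>_nonneg: "x \<in> E \<Longrightarrow> \<xi> x \<ge> 0"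
    and b0_summable: "b0 summable_on I" and b0_nonneg: "0 \<le> b0 e"
    and b0_bound: "y \<in> E \<Longrightarrow> exp (\<eta> y + t * \<xi> y) \<le> b0 (y 0)"
begin

lemma H_nonneg: "H \<ge> 0" and X_nonneg: "X \<ge> 0"
  using \<eta>_lip \<xi>_lip lip_bound_nonneg by auto

definition weight :: "complex \<Rightarrow> (nat \<Rightarrow> nat) \<Rightarrow> complex" where
  "weight z y = exp (of_real (\<eta> y) + z * of_real (\<xi> y))"

lemma id_minus_transfer_eq: "id_minus_transfer E \<eta> \<xi> z = (\<lambda>g x. g x - weighted_op (weight z) g x)"
  by (simp add: id_minus_transfer_def transfer_op_eq weight_def[abs_def] fun_eq_iff)

text \<open>By symmetry, only pairs with \<open>\<xi> y \<le> \<xi> y'\<close> have to be compared; then every term can be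
  estimated through \<open>\<xi> y'\<close>.\<close>

lemma weight_boundI:
  assumes sup: "\<And>y. y \<in> E \<Longrightarrow> cmod (W y) \<le> C * b0 (y 0)"
    and lip: "\<And>n y y'. n \<ge> 1 \<Longrightarrow> y \<in> E \<Longrightarrow> y' \<in> E \<Longrightarrow> agree n y y' \<Longrightarrow> \<xi> y \<le> \<xi> y' \<Longrightarrow>
      cmod (W y - W y') \<le> C * b0 (y' 0) * \<theta> ^ n"
    and "C \<ge> 0"
  shows "weight_bound W (\<lambda>e. C * b0 e)"
  unfolding weight_bound_def
proof (intro conjI allI ballI impI)
  show "(\<lambda>e. C * b0 e) summable_on I" by (intro summable_on_cmult_right b0_summable)
  show "0 \<le> C * b0 e" for e using b0_nonneg \<open>C \<ge> 0\<close> by simp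
  show "cmod (W y) \<le> C * b0 (y 0)" if "y \<in> E" for y by (rule sup[OF that])
  fix n y y' assume h: "1 \<le> n" "y \<in> E" "y' \<in> E" "agree n y y'"
  have eq: "y 0 = y' 0" using h by (auto simp: agree_def)
  show "cmod (W y - W y') \<le> C * b0 (y 0) * \<theta> ^ n"
    using lip[OF h] lip[OF h(1,3,2) agree_sym[OF h(4)]] eq
    by (cases "\<xi> y \<le> \<xi> y'") (auto simp: norm_minus_commute)
qed

lemma cmod_weight: "cmod (weight z y) = exp (\<eta> y + Re z * \<xi> y)"
  by (simp add: weight_def)

text \<open>These estimates trade powers of \<open>\<xi>\<close> for a small exponential \<open>exp (\<rho> \<xi>)\<close>, which the
  gap between \<open>Re z\<close> and \<open>t\<close> absorbs.\<close>

lemma weight_absorb: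
  assumes "y \<in> E" "\<rho> > 0" "Re z + r + \<rho> \<le> t" "r \<ge> 0"
  shows "cmod (weight z y) * exp (r * \<xi> y) \<le> b0 (y 0)"
    "cmod (weight z y) * exp (r * \<xi> y) * \<xi> y \<le> b0 (y 0) / \<rho>"
    "cmod (weight z y) * exp (r * \<xi> y) * (\<xi> y)\<^sup>2 \<le> 2 * b0 (y 0) / \<rho>\<^sup>2"
proof -
  let ?w = "cmod (weight z y) * exp (r * \<xi> y)"
  have x: "\<xi> y \<ge> 0" by (rule \<xi>_nonneg[OF assms(1)])
  have w: "?w * exp (\<rho> * \<xi> y) \<le> b0 (y 0)"
  proof -
    have "(Re z + r + \<rho>) * \<xi> y \<le> t * \<xi> y" using assms(3) x by (rule mult_right_mono)
    then have "?w * exp (\<rho> * \<xi> y) \<le> exp (\<eta> y + t * \<xi> y)"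
      unfolding cmod_weight by (simp add: algebra_simps flip: exp_add)
    then show ?thesis using b0_bound[OF assms(1)] by simp
  qed
  have abs: "?w * c \<le> k * b0 (y 0)" if "c \<le> k * exp (\<rho> * \<xi> y)" "k \<ge> 0" for c k
  proof -
    have "?w * c \<le> ?w * (k * exp (\<rho> * \<xi> y))" using that(1) by (intro mult_left_mono) auto
    also have "\<dots> = k * (?w * exp (\<rho> * \<xi> y))" by (simp add: algebra_simps)
    also have "\<dots> \<le> k * b0 (y 0)" by (intro mult_left_mono w that(2))
    finally show ?thesis .
  qed
  have \<rho>x: "\<rho> * \<xi> y \<ge> 0" using x assms(2) by simp
  show "?w \<le> b0 (y 0)" using abs[of 1 1] \<rho>x by simp
  have "\<rho> * \<xi> y \<le> exp (\<rho> * \<xi> y)" using exp_ge_add_one_self[of "\<rho> * \<xi> y"] by linarith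
  then show "?w * \<xi> y \<le> b0 (y 0) / \<rho>"
    using abs[of "\<xi> y" "1 / \<rho>"] assms(2) by (simp add: field_simps)
  have "(\<rho> * \<xi> y)\<^sup>2 / 2 \<le> exp (\<rho> * \<xi> y)"
    using exp_lower_Taylor_quadratic[OF \<rho>x] \<rho>x by linarith
  then show "?w * (\<xi> y)\<^sup>2 \<le> 2 * b0 (y 0) / \<rho>\<^sup>2"
    using abs[of "(\<xi> y)\<^sup>2" "2 / \<rho>\<^sup>2"] assms(2) by (simp add: field_simps)
qed

text \<open>Weights at points that agree in \<open>n\<close> letters have a quotient within \<open>S z \<theta>\<^sup>n\<close> of 1.\<close>

definition S :: "complex \<Rightarrow> real" where
  "S z = (H + cmod z * X) * exp (H + cmod z * X)"

lemma S_nonneg: "S z \<ge> 0"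
  using H_nonneg X_nonneg by (simp add: S_def)

lemma weight_ratio:
  assumes "n \<ge> 1" "y \<in> E" "y' \<in> E" "agree n y y'"
  obtains q where "weight z y = weight z y' * q" "cmod (q - 1) \<le> S z * \<theta> ^ n"
proof -
  define s where "s = of_real (\<eta> y - \<eta> y') + z * of_real (\<xi> y - \<xi> y')"
  have "\<bar>\<eta> y - \<eta> y'\<bar> \<le> H * \<theta> ^ n" "\<bar>\<xi> y - \<xi> y'\<bar> \<le> X * \<theta> ^ n"
    using lip_boundD[OF \<eta>_lip assms] lip_boundD[OF \<xi>_lip assms] by auto
  then have "cmod s \<le> H * \<theta> ^ n + cmod z * (X * \<theta> ^ n)"
    unfolding s_def
    by (intro norm_triangle_le add_mono) (auto simp: norm_mult mult_left_mono simp del: of_real_diff)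
  then have s: "cmod s \<le> (H + cmod z * X) * \<theta> ^ n" by (simp add: algebra_simps)
  have "(H + cmod z * X) * \<theta> ^ n \<le> (H + cmod z * X) * 1"
    using H_nonneg X_nonneg \<theta>_pos \<theta>_less by (intro mult_left_mono power_le_one) auto
  then have s1: "cmod s \<le> H + cmod z * X" using s by simp
  have "cmod (exp s - 1) \<le> cmod s * exp (cmod s)" by (rule cmod_exp_minus_1_le)
  also have "\<dots> \<le> ((H + cmod z * X) * \<theta> ^ n) * exp (H + cmod z * X)"
    using s s1 by (intro mult_mono) (auto intro: order_trans[OF norm_ge_zero])
  finally have "cmod (exp s - 1) \<le> S z * \<theta> ^ n" by (simp add: S_def algebra_simps)
  moreover have "weight z y = weight z y' * exp s"
    unfolding weight_def s_def by (simp add: algebra_simps flip: exp_add)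
  ultimately show thesis using that by blast
qed

lemma weight_weight_bound:
  assumes "\<rho> > 0" "Re z + \<rho> \<le> t"
  shows "weight_bound (weight z) (\<lambda>e. (1 + S z) * b0 e)"
proof (rule weight_boundI)
  have w: "cmod (weight z y) \<le> b0 (y 0)" if "y \<in> E" for y
    using weight_absorb(1)[OF that assms(1), of z 0] assms by simp
  show "cmod (weight z y) \<le> (1 + S z) * b0 (y 0)" if "y \<in> E" for y
    using w[OF that] S_nonneg[of z] b0_nonneg[of "y 0"] by (simp add: algebra_simps add_increasing2)
  fix n y y' assume h: "n \<ge> 1" "y \<in> E" "y' \<in> E" "agree n y y'"
  obtain q where q: "weight z y = weight z y' * q" "cmod (q - 1) \<le> S z * \<theta> ^ n"
    by (rule weight_ratio[OF h])
  have "cmod (weight z y - weight z y') = cmod (weight z y') * cmod (q - 1)"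
    unfolding q(1) by (simp add: right_diff_distrib flip: norm_mult)
  also have "\<dots> \<le> b0 (y' 0) * (S z * \<theta> ^ n)" using q(2) w[OF h(3)] b0_nonneg by (intro mult_mono) auto
  also have "\<dots> \<le> (1 + S z) * b0 (y' 0) * \<theta> ^ n"
    using \<theta>_pos b0_nonneg[of "y' 0"] by (simp add: algebra_simps)
  finally show "cmod (weight z y - weight z y') \<le> (1 + S z) * b0 (y' 0) * \<theta> ^ n" .
qed (use S_nonneg[of z] in simp)

lemma weight_deriv_bound:
  assumes "\<rho> > 0" "Re z + \<rho> \<le> t"
  shows "weight_bound (\<lambda>y. of_real (\<xi> y) * weight z y) (\<lambda>e. ((1 + S z) / \<rho> + X) * b0 e)"
proof (rule weight_boundI)
  have w: "cmod (weight z y) \<le> b0 (y 0)" "cmod (weight z y) * \<xi> y \<le> b0 (y 0) / \<rho>" if "y \<in> E" for y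
    using weight_absorb(1,2)[OF that assms(1), of z 0] assms by simp_all
  have C: "0 \<le> S z / \<rho>" "0 \<le> 1 / \<rho>" "0 \<le> X" using S_nonneg X_nonneg assms by auto
  then show "0 \<le> (1 + S z) / \<rho> + X" by (simp add: add_divide_distrib)
  show "cmod (of_real (\<xi> y) * weight z y) \<le> ((1 + S z) / \<rho> + X) * b0 (y 0)" if "y \<in> E" for y
  proof -
    have "cmod (of_real (\<xi> y) * weight z y) = cmod (weight z y) * \<xi> y"
      using \<xi>_nonneg[OF that] by (simp add: norm_mult)
    also have "\<dots> \<le> 1 / \<rho> * b0 (y 0)" using w(2)[OF that] by simp
    also have "\<dots> \<le> ((1 + S z) / \<rho> + X) * b0 (y 0)"
      using C b0_nonneg by (intro mult_right_mono) (auto simp: add_divide_distrib)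
    finally show ?thesis .
  qed
  fix n y y' assume h: "n \<ge> 1" "y \<in> E" "y' \<in> E" "agree n y y'" "\<xi> y \<le> \<xi> y'"
  obtain q where q: "weight z y = weight z y' * q" "cmod (q - 1) \<le> S z * \<theta> ^ n"
    by (rule weight_ratio[OF h(1-4)])
  have x: "\<xi> y \<ge> 0" using \<xi>_nonneg h by auto
  have d: "\<bar>\<xi> y - \<xi> y'\<bar> \<le> X * \<theta> ^ n" using lip_boundD[OF \<xi>_lip h(1-4)] by simp
  have "of_real (\<xi> y) * weight z y - of_real (\<xi> y') * weight z y' =
      weight z y' * (of_real (\<xi> y) * (q - 1) + of_real (\<xi> y - \<xi> y'))"
    unfolding q(1) by (simp add: algebra_simps)
  then have "cmod (of_real (\<xi> y) * weight z y - of_real (\<xi> y') * weight z y') =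
      cmod (weight z y') * cmod (of_real (\<xi> y) * (q - 1) + of_real (\<xi> y - \<xi> y'))"
    by (simp only: norm_mult)
  also have "\<dots> \<le> cmod (weight z y') * (\<xi> y' * (S z * \<theta> ^ n) + X * \<theta> ^ n)"
    using x d q(2) h(5)
    by (intro mult_left_mono norm_triangle_le add_mono)
      (auto simp: norm_mult simp del: of_real_diff intro!: mult_mono)
  also have "\<dots> = (cmod (weight z y') * \<xi> y') * (S z * \<theta> ^ n) + cmod (weight z y') * (X * \<theta> ^ n)"
    by (simp add: algebra_simps)
  also have "\<dots> \<le> (b0 (y' 0) / \<rho>) * (S z * \<theta> ^ n) + b0 (y' 0) * (X * \<theta> ^ n)"
    using w[OF h(3)] S_nonneg X_nonneg \<theta>_pos by (intro add_mono mult_right_mono) auto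
  also have "\<dots> = (S z / \<rho> + X) * b0 (y' 0) * \<theta> ^ n" by (simp add: algebra_simps)
  also have "\<dots> \<le> ((1 + S z) / \<rho> + X) * b0 (y' 0) * \<theta> ^ n"
    using C b0_nonneg \<theta>_pos by (intro mult_right_mono) (auto simp: add_divide_distrib)
  finally show "cmod (of_real (\<xi> y) * weight z y - of_real (\<xi> y') * weight z y')
      \<le> ((1 + S z) / \<rho> + X) * b0 (y' 0) * \<theta> ^ n" .
qed

text \<open>For fixed \<open>\<rho>\<close> and \<open>r\<close> this is bounded on bounded sets of \<open>z\<close>, because \<open>S\<close> is.\<close>

definition taylor_const :: "real \<Rightarrow> real \<Rightarrow> complex \<Rightarrow> real" where
  "taylor_const \<rho> r z = 2 * (1 + S z) / \<rho>\<^sup>2 + X\<^sup>2 * exp (r * X) + X / \<rho>"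

text \<open>The remainder is \<open>exp (\<eta> + z \<xi>) Q(\<xi>)\<close> with \<open>Q(x) = exp (\<zeta> x) - 1 - \<zeta> x\<close> and \<open>\<zeta> = w - z\<close>. For its
  Lipschitz constant, \<open>Q(x' + d) - Q(x')\<close> is expanded algebraically as
  \<open>exp (\<zeta> x') (exp (\<zeta> d) - 1 - \<zeta> d) + \<zeta> d (exp (\<zeta> x') - 1)\<close>, where both terms are quadratic in \<open>\<zeta>\<close>
  and linear in \<open>d\<close>.\<close>

lemma weight_taylor_bound:
  assumes "\<rho> > 0" "Re z + r + \<rho> \<le> t" "cmod (w - z) \<le> r"
  shows "weight_bound (\<lambda>y. weight w y - weight z y - (w - z) * (of_real (\<xi> y) * weight z y))
     (\<lambda>e. (cmod (w - z))\<^sup>2 * taylor_const \<rho> r z * b0 e)"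
proof (rule weight_boundI)
  define \<zeta> where "\<zeta> = w - z"
  define Q where "Q x = exp (\<zeta> * of_real x) - 1 - \<zeta> * of_real x" for x :: real
  have r: "cmod \<zeta> \<le> r" "r \<ge> 0" using assms(3) norm_ge_zero[of "w - z"] by (auto simp: \<zeta>_def simp del: norm_ge_zero)
  have eq: "weight w y - weight z y - (w - z) * (of_real (\<xi> y) * weight z y) = weight z y * Q (\<xi> y)" for y
  proof -
    have "weight w y = weight z y * exp (\<zeta> * of_real (\<xi> y))"
      by (simp add: weight_def \<zeta>_def algebra_simps flip: exp_add)
    then show ?thesis by (simp add: Q_def \<zeta>_def algebra_simps)
  qed
  have exp_le: "exp (cmod \<zeta> * x) \<le> exp (r * x)" if "x \<ge> 0" for x
    using r that by (simp add: mult_right_mono)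
  have Q: "cmod (Q x) \<le> (cmod \<zeta>)\<^sup>2 * (x'\<^sup>2 * exp (r * x'))" if "0 \<le> x" "x \<le> x'" for x x'
  proof -
    have "cmod (Q x) \<le> (cmod \<zeta>)\<^sup>2 * (x\<^sup>2 * exp (cmod \<zeta> * x))"
      using cmod_exp_minus_1_minus_le[of "\<zeta> * of_real x"] that(1)
      by (simp add: Q_def norm_mult power_mult_distrib mult.assoc)
    also have "\<dots> \<le> (cmod \<zeta>)\<^sup>2 * (x'\<^sup>2 * exp (r * x'))"
      using that r by (intro mult_left_mono mult_mono power_mono) (auto intro!: mult_mono)
    finally show ?thesis .
  qed
  note wa = weight_absorb[OF _ assms(1,2) r(2)]
  have C: "0 \<le> S z / \<rho>\<^sup>2" "0 \<le> 1 / \<rho>\<^sup>2" "0 \<le> X\<^sup>2 * exp (r * X)" "0 \<le> X / \<rho>"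
    using S_nonneg X_nonneg assms by auto
  then show nonneg: "0 \<le> (cmod (w - z))\<^sup>2 * taylor_const \<rho> r z"
    unfolding taylor_const_def by (intro mult_nonneg_nonneg add_nonneg_nonneg) (auto simp: S_nonneg)
  show "cmod (weight w y - weight z y - (w - z) * (of_real (\<xi> y) * weight z y))
      \<le> (cmod (w - z))\<^sup>2 * taylor_const \<rho> r z * b0 (y 0)" if y: "y \<in> E" for y
  proof -
    have "cmod (weight z y * Q (\<xi> y)) \<le> cmod (weight z y) * ((cmod \<zeta>)\<^sup>2 * ((\<xi> y)\<^sup>2 * exp (r * \<xi> y)))"
      unfolding norm_mult using \<xi>_nonneg[OF y] by (intro mult_left_mono Q) auto
    also have "\<dots> = (cmod \<zeta>)\<^sup>2 * (cmod (weight z y) * exp (r * \<xi> y) * (\<xi> y)\<^sup>2)" by (simp add: algebra_simps)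
    also have "\<dots> \<le> (cmod \<zeta>)\<^sup>2 * (2 * b0 (y 0) / \<rho>\<^sup>2)" by (intro mult_left_mono wa(3)[OF y]) auto
    also have "\<dots> = (cmod \<zeta>)\<^sup>2 * (2 / \<rho>\<^sup>2) * b0 (y 0)" by simp
    also have "\<dots> \<le> (cmod \<zeta>)\<^sup>2 * taylor_const \<rho> r z * b0 (y 0)"
      using C b0_nonneg unfolding taylor_const_def
      by (intro mult_right_mono mult_left_mono) (auto simp: add_divide_distrib)
    finally show ?thesis unfolding eq by (simp add: \<zeta>_def)
  qed
  fix n y y' assume h: "n \<ge> 1" "y \<in> E" "y' \<in> E" "agree n y y'" "\<xi> y \<le> \<xi> y'"
  obtain q where q: "weight z y = weight z y' * q" "cmod (q - 1) \<le> S z * \<theta> ^ n"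
    by (rule weight_ratio[OF h(1-4)])
  define x where "x = \<xi> y"
  define x' where "x' = \<xi> y'"
  define d where "d = x - x'"
  have x: "0 \<le> x" "x \<le> x'" "0 \<le> x'" using \<xi>_nonneg h by (auto simp: x_def x'_def)
  have th: "0 < \<theta> ^ n" "\<theta> ^ n \<le> 1" using \<theta>_pos \<theta>_less by (auto intro: power_le_one)
  have d: "\<bar>d\<bar> \<le> X * \<theta> ^ n" using lip_boundD[OF \<xi>_lip h(1-4)] by (simp add: d_def x_def x'_def)
  have dX: "\<bar>d\<bar> \<le> X" using d th X_nonneg by (meson mult_left_le order_trans)
  have QQ: "cmod (Q x - Q x') \<le> (cmod \<zeta>)\<^sup>2 * exp (r * x') * ((X\<^sup>2 * exp (r * X)) * \<theta> ^ n + X * \<theta> ^ n * x')"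
  proof -
    have "exp (\<zeta> * of_real x) = exp (\<zeta> * of_real x') * exp (\<zeta> * of_real d)"
      by (simp add: d_def algebra_simps flip: exp_add)
    then have "Q x - Q x' = exp (\<zeta> * of_real x') * (exp (\<zeta> * of_real d) - 1 - \<zeta> * of_real d)
        + \<zeta> * of_real d * (exp (\<zeta> * of_real x') - 1)"
      by (simp add: Q_def d_def algebra_simps)
    then have "cmod (Q x - Q x') \<le> cmod (exp (\<zeta> * of_real x')) * cmod (exp (\<zeta> * of_real d) - 1 - \<zeta> * of_real d)
        + cmod \<zeta> * \<bar>d\<bar> * cmod (exp (\<zeta> * of_real x') - 1)"
      by (metis norm_mult norm_of_real norm_triangle_ineq)
    also have "\<dots> \<le> exp (r * x') * ((cmod \<zeta>)\<^sup>2 * (X\<^sup>2 * exp (r * X) * \<theta> ^ n))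
        + cmod \<zeta> * \<bar>d\<bar> * (cmod \<zeta> * x' * exp (r * x'))"
    proof (intro add_mono mult_mono mult_left_mono)
      have "Re (\<zeta> * of_real x') \<le> cmod \<zeta> * x'" using complex_Re_le_cmod[of \<zeta>] x by (simp add: mult_right_mono)
      then show "cmod (exp (\<zeta> * of_real x')) \<le> exp (r * x')"
        using exp_le[OF x(3)] by (simp add: order_trans[OF _ exp_le[OF x(3)]])
      have "cmod (exp (\<zeta> * of_real d) - 1 - \<zeta> * of_real d) \<le> (cmod \<zeta>)\<^sup>2 * (\<bar>d\<bar> * \<bar>d\<bar> * exp (cmod \<zeta> * \<bar>d\<bar>))"
        using cmod_exp_minus_1_minus_le[of "\<zeta> * of_real d"]
        by (simp add: norm_mult power2_eq_square algebra_simps)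
      also have "\<dots> \<le> (cmod \<zeta>)\<^sup>2 * ((X * \<theta> ^ n) * X * exp (r * X))"
        using d dX r X_nonneg th by (intro mult_left_mono mult_mono) (auto intro!: mult_mono)
      finally show "cmod (exp (\<zeta> * of_real d) - 1 - \<zeta> * of_real d) \<le> (cmod \<zeta>)\<^sup>2 * (X\<^sup>2 * exp (r * X) * \<theta> ^ n)"
        by (simp add: power2_eq_square algebra_simps)
      have "cmod (exp (\<zeta> * of_real x') - 1) \<le> cmod \<zeta> * x' * exp (cmod \<zeta> * x')"
        using cmod_exp_minus_1_le[of "\<zeta> * of_real x'"] x by (simp add: norm_mult)
      also have "\<dots> \<le> cmod \<zeta> * x' * exp (r * x')" using x exp_le by (intro mult_left_mono) auto
      finally show "cmod (exp (\<zeta> * of_real x') - 1) \<le> cmod \<zeta> * x' * exp (r * x')" .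
    qed auto
    also have "cmod \<zeta> * \<bar>d\<bar> * (cmod \<zeta> * x' * exp (r * x')) \<le> cmod \<zeta> * (X * \<theta> ^ n) * (cmod \<zeta> * x' * exp (r * x'))"
      using d x by (intro mult_right_mono mult_left_mono) auto
    finally show ?thesis by (simp add: power2_eq_square algebra_simps)
  qed
  have "weight z y * Q x - weight z y' * Q x' = weight z y' * ((q - 1) * Q x + (Q x - Q x'))"
    unfolding q(1) by (simp add: algebra_simps)
  then have "cmod (weight z y * Q x - weight z y' * Q x') = cmod (weight z y') * cmod ((q - 1) * Q x + (Q x - Q x'))"
    by (simp only: norm_mult)
  also have "\<dots> \<le> cmod (weight z y') * ((S z * \<theta> ^ n) * ((cmod \<zeta>)\<^sup>2 * (x'\<^sup>2 * exp (r * x')))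
      + (cmod \<zeta>)\<^sup>2 * exp (r * x') * ((X\<^sup>2 * exp (r * X)) * \<theta> ^ n + X * \<theta> ^ n * x'))"
    using q(2) Q[OF x(1,2)] QQ S_nonneg th
    by (intro mult_left_mono norm_triangle_le add_mono) (auto simp: norm_mult intro!: mult_mono)
  also have "\<dots> = (cmod \<zeta>)\<^sup>2 * \<theta> ^ n * (S z * (cmod (weight z y') * exp (r * x') * x'\<^sup>2)
      + X\<^sup>2 * exp (r * X) * (cmod (weight z y') * exp (r * x')) + X * (cmod (weight z y') * exp (r * x') * x'))"
    by (simp add: algebra_simps)
  also have "\<dots> \<le> (cmod \<zeta>)\<^sup>2 * \<theta> ^ n * (S z * (2 * b0 (y' 0) / \<rho>\<^sup>2)
      + X\<^sup>2 * exp (r * X) * b0 (y' 0) + X * (b0 (y' 0) / \<rho>))"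
    using wa[OF h(3)] S_nonneg X_nonneg th unfolding x'_def
    by (intro mult_left_mono add_mono) auto
  also have "\<dots> = (cmod \<zeta>)\<^sup>2 * (2 * S z / \<rho>\<^sup>2 + X\<^sup>2 * exp (r * X) + X / \<rho>) * (b0 (y' 0) * \<theta> ^ n)"
    by (simp add: algebra_simps)
  also have "\<dots> \<le> (cmod \<zeta>)\<^sup>2 * taylor_const \<rho> r z * (b0 (y' 0) * \<theta> ^ n)"
    using C b0_nonneg th unfolding taylor_const_def
    by (intro mult_right_mono mult_left_mono) (auto simp: add_divide_distrib)
  finally show "cmod (weight w y - weight z y - (w - z) * (of_real (\<xi> y) * weight z y) -
      (weight w y' - weight z y' - (w - z) * (of_real (\<xi> y') * weight z y')))
      \<le> (cmod (w - z))\<^sup>2 * taylor_const \<rho> r z * b0 (y' 0) * \<theta> ^ n"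
    unfolding eq by (simp add: \<zeta>_def x_def x'_def mult.assoc)
qed

end

section \<open>Pressure\<close>

lemma finite_sum_le_infsum_ennreal:
  fixes f :: "'a \<Rightarrow> ennreal"
  assumes "finite F" "F \<subseteq> A"
  shows "sum f F \<le> infsum f A"
  using assms by (subst nonneg_infsum_complete) (auto intro!: SUP_upper)

text \<open>Fekete's lemma, with the limit taken in the extended reals so that it covers the
  value \<open>-\<infinity>\<close>.\<close>

lemma subadditive_tendsto_INF:
  fixes a :: "nat \<Rightarrow> real"
  assumes sub: "\<And>m n. m \<ge> 1 \<Longrightarrow> n \<ge> 1 \<Longrightarrow> a (m + n) \<le> a m + a n"
  shows "(\<lambda>n. ereal (a n / real n)) \<longlonglongrightarrow> (INF n\<in>{1..}. ereal (a n / real n))"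
proof (rule order_tendstoI)
  let ?L = "INF n\<in>{1..}. ereal (a n / real n)"
  show "\<forall>\<^sub>F n in sequentially. b < ereal (a n / real n)" if "b < ?L" for b
    using eventually_ge_at_top[of 1]
  proof eventually_elim
    case (elim n)
    then have "?L \<le> ereal (a n / real n)" by (intro INF_lower) auto
    with that show ?case by simp
  qed
  show "\<forall>\<^sub>F n in sequentially. ereal (a n / real n) < b" if "?L < b" for b
  proof -
    from that obtain m where m: "m \<ge> 1" "ereal (a m / real m) < b" by (auto simp: INF_less_iff)
    \<comment> \<open>absorbs the remainder of the division of \<open>n\<close> by \<open>m\<close>\<close>
    define M where "M = Max ((\<lambda>r. \<bar>a r\<bar>) ` {..<m}) + \<bar>a m\<bar>"
    have mult: "a (Suc q * m) \<le> real (Suc q) * a m" for q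
    proof (induction q)
      case (Suc q)
      then show ?case using sub[of m "Suc q * m"] m(1) by (simp add: algebra_simps)
    qed simp
    have le: "a n \<le> real n * (a m / real m) + M" if nm: "n \<ge> m" for n
    proof -
      define q where "q = n div m"
      define r where "r = n mod m"
      have n: "n = q * m + r" "r < m" using m(1) by (auto simp: q_def r_def)
      obtain q' where q': "q = Suc q'" using nm m(1) n by (cases q) auto
      have ar: "\<bar>a r\<bar> \<le> M - \<bar>a m\<bar>" using n(2) by (simp add: M_def)
      have "a n \<le> real q * a m + \<bar>a r\<bar>"
      proof (cases "r = 0")
        case True
        then show ?thesis using mult[of q'] n(1) q' by simp
      next
        case False
        have "a n \<le> a (q * m) + a r" unfolding n(1) using False m(1) q' by (intro sub) auto
        then show ?thesis using mult[of q'] q' by simp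
      qed
      moreover have "real q * a m = real n * (a m / real m) - real r * (a m / real m)"
        using m(1) n(1) by (simp add: field_simps)
      moreover have "- (real r * (a m / real m)) \<le> \<bar>a m\<bar>"
      proof -
        have "real r / real m * \<bar>a m\<bar> \<le> 1 * \<bar>a m\<bar>" using n(2) by (intro mult_right_mono) auto
        moreover have "real r / real m * \<bar>a m\<bar> = \<bar>real r * (a m / real m)\<bar>" by (simp add: abs_mult)
        ultimately show ?thesis by linarith
      qed
      ultimately show ?thesis using ar by linarith
    qed
    have "(\<lambda>n. a m / real m + M * (1 / real n)) \<longlonglongrightarrow> a m / real m + M * 0"
      by (intro tendsto_intros lim_1_over_n)
    then have "(\<lambda>n. ereal (a m / real m + M * (1 / real n))) \<longlonglongrightarrow> ereal (a m / real m)" by simp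
    then have "\<forall>\<^sub>F n in sequentially. ereal (a m / real m + M * (1 / real n)) < b"
      using m(2) by (rule order_tendstoD)
    then show ?thesis using eventually_ge_at_top[of m]
    proof eventually_elim
      case (elim n)
      then have "a n / real n \<le> a m / real m + M * (1 / real n)"
        using le[OF elim(2)] m(1) by (simp add: field_simps)
      then show ?case using elim(1) by (meson ereal_less_eq(3) le_less_trans)
    qed
  qed
qed

lemma exp_ext_mono: "a \<le> b \<Longrightarrow> exp_ext a \<le> exp_ext b"
  by (cases a; cases b) (auto simp: exp_ext_def)

locale summable_weight = markov_shift +
  fixes u :: "(nat \<Rightarrow> nat) \<Rightarrow> real" and U :: real and b0 :: "nat \<Rightarrow> real"
  assumes u_lip: "lip_bound u U"
    and b0_summable: "b0 summable_on I" and b0_nonneg: "\<And>e. 0 \<le> b0 e"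
    and b0_bound: "\<And>y. y \<in> E \<Longrightarrow> exp (u y) \<le> b0 (y 0)"
begin

definition cyl_weight :: "nat \<Rightarrow> nat list \<Rightarrow> ennreal" where
  "cyl_weight n w = exp_ext (SUP \<tau>\<in>cylinder E w. ereal (birkhoff_sum n u \<tau>))"

lemma partition_sum_eq: "partition_sum E u n = (\<Sum>\<^sub>\<infinity>w\<in>words E n. cyl_weight n w)"
  by (simp add: partition_sum_def cyl_weight_def)

lemma exp_le_cyl_weight: "\<tau> \<in> cylinder E w \<Longrightarrow> ennreal (exp (birkhoff_sum n u \<tau>)) \<le> cyl_weight n w"
proof -
  assume "\<tau> \<in> cylinder E w"
  then have "ereal (birkhoff_sum n u \<tau>) \<le> (SUP \<tau>\<in>cylinder E w. ereal (birkhoff_sum n u \<tau>))"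
    by (rule SUP_upper)
  from exp_ext_mono[OF this] show ?thesis by (simp add: cyl_weight_def exp_ext_def)
qed

lemma cyl_weight_le:
  assumes "c > 0" "\<And>\<tau>. \<tau> \<in> cylinder E w \<Longrightarrow> exp (birkhoff_sum n u \<tau>) \<le> c"
  shows "cyl_weight n w \<le> ennreal c"
proof -
  have "birkhoff_sum n u \<tau> \<le> ln c" if "\<tau> \<in> cylinder E w" for \<tau>
    using assms(2)[OF that] assms(1) by (simp add: ln_ge_iff)
  then have "(SUP \<tau>\<in>cylinder E w. ereal (birkhoff_sum n u \<tau>)) \<le> ereal (ln c)" by (intro SUP_least) auto
  from exp_ext_mono[OF this] show ?thesis using assms(1) by (simp add: cyl_weight_def exp_ext_def)
qed

lemma words_eq: "words E n = {w. length w = n \<and> cylinder E w \<noteq> {}}"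
proof (intro equalityI subsetI)
  fix w assume "w \<in> words E n"
  then obtain \<omega> k where w: "w = map \<omega> [k..<k + n]" "\<omega> \<in> E" by (auto simp: words_def)
  then have "(shift ^^ k) \<omega> \<in> cylinder E w"
    using funpow_shift_mem[OF w(2), of k] by (auto simp: cylinder_def funpow_shift add.commute)
  then show "w \<in> {w. length w = n \<and> cylinder E w \<noteq> {}}" using w by auto
next
  fix w assume "w \<in> {w. length w = n \<and> cylinder E w \<noteq> {}}"
  then obtain \<tau> where \<tau>: "length w = n" "\<tau> \<in> cylinder E w" by auto
  then have "w = map \<tau> [0..<0 + n]" by (intro nth_equalityI) (auto simp: cylinder_def)
  then show "w \<in> words E n" using \<tau>(2) unfolding words_def cylinder_def by blast
qed

lemma birkhoff_sum_add: "birkhoff_sum (m + n) u x = birkhoff_sum m u x + birkhoff_sum n u ((shift ^^ m) x)"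
  unfolding birkhoff_sum_def by (induction n) (auto simp: funpow_shift add_ac)

lemma cylinder_split:
  assumes "\<tau> \<in> cylinder E w" "length w = m + n"
  shows "\<tau> \<in> cylinder E (take m w)" "(shift ^^ m) \<tau> \<in> cylinder E (drop m w)"
  using assms funpow_shift_mem[of \<tau> m] by (auto simp: cylinder_def funpow_shift add.commute)

lemma cyl_weight_pos:
  assumes "cylinder E w \<noteq> {}"
  shows "cyl_weight n w > 0"
proof -
  obtain \<tau> where "\<tau> \<in> cylinder E w" using assms by blast
  from exp_le_cyl_weight[OF this, of n] show ?thesis
    by (rule less_le_trans[rotated]) simp
qed

lemma cyl_weight_submult:
  assumes "cylinder E w \<noteq> {}" "length w = m + n"
  shows "cyl_weight (m + n) w \<le> cyl_weight m (take m w) * cyl_weight n (drop m w)"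
proof (cases "cyl_weight m (take m w) = \<infinity> \<or> cyl_weight n (drop m w) = \<infinity>")
  case True
  have "cyl_weight m (take m w) > 0" "cyl_weight n (drop m w) > 0"
    using assms cylinder_split[OF _ assms(2)] by (auto intro!: cyl_weight_pos)
  with True show ?thesis by (auto simp: ennreal_top_mult ennreal_mult_top)
next
  case False
  then obtain p q where pq: "cyl_weight m (take m w) = ennreal p" "cyl_weight n (drop m w) = ennreal q" "p \<ge> 0" "q \<ge> 0"
    by (cases "cyl_weight m (take m w)"; cases "cyl_weight n (drop m w)") auto
  have le: "exp (birkhoff_sum m u \<tau>) \<le> p" "exp (birkhoff_sum n u ((shift ^^ m) \<tau>)) \<le> q" if "\<tau> \<in> cylinder E w" for \<tau>
    using exp_le_cyl_weight[OF cylinder_split(1)[OF that assms(2)], of m]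
      exp_le_cyl_weight[OF cylinder_split(2)[OF that assms(2)], of n] pq by auto
  obtain \<tau> where \<tau>: "\<tau> \<in> cylinder E w" using assms(1) by blast
  have "p > 0" "q > 0"
    using less_le_trans[OF exp_gt_zero le(1)[OF \<tau>]] less_le_trans[OF exp_gt_zero le(2)[OF \<tau>]] by auto
  then have "cyl_weight (m + n) w \<le> ennreal (p * q)"
    using le pq by (intro cyl_weight_le) (auto simp: birkhoff_sum_add exp_add intro!: mult_mono)
  then show ?thesis using pq by (simp add: ennreal_mult)
qed

lemma partition_sum_submult: "partition_sum E u (m + n) \<le> partition_sum E u m * partition_sum E u n"
  unfolding partition_sum_eq[of "m + n"]
proof (rule infsum_le_finite_sums)
  fix F assume F: "finite F" "F \<subseteq> words E (m + n)"
  let ?g = "\<lambda>(v, w). cyl_weight m v * cyl_weight n w"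
  let ?s = "\<lambda>w. (take m w, drop m w)"
  have inj: "inj_on ?s F" by (rule inj_on_inverseI[where g = "\<lambda>(v, w). v @ w"]) simp
  have split: "take m w \<in> words E m \<and> drop m w \<in> words E n" if "w \<in> F" for w
  proof -
    have w: "length w = m + n" "cylinder E w \<noteq> {}" using that F(2) by (auto simp: words_eq)
    then obtain \<tau> where "\<tau> \<in> cylinder E w" by blast
    from cylinder_split[OF this w(1)] w(1) show ?thesis by (auto simp: words_eq)
  qed
  then have sub: "take m ` F \<subseteq> words E m" "drop m ` F \<subseteq> words E n" by auto
  have "sum (cyl_weight (m + n)) F \<le> sum (?g \<circ> ?s) F"
    using F(2) by (intro sum_mono) (auto simp: words_eq intro!: cyl_weight_submult)
  also have "\<dots> = sum ?g (?s ` F)" by (rule sum.reindex[OF inj, symmetric])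
  also have "\<dots> \<le> sum ?g ((take m ` F) \<times> (drop m ` F))" using F(1) by (intro sum_mono2) auto
  also have "\<dots> = sum (cyl_weight m) (take m ` F) * sum (cyl_weight n) (drop m ` F)"
    by (simp add: sum_product sum.cartesian_product)
  also have "\<dots> \<le> partition_sum E u m * partition_sum E u n"
    unfolding partition_sum_eq using F(1) sub by (intro mult_mono finite_sum_le_infsum_ennreal) auto
  finally show "sum (cyl_weight (m + n)) F \<le> partition_sum E u m * partition_sum E u n" .
qed (rule nonneg_summable_on_complete, rule zero_le)

lemma partition_sum_pos: "partition_sum E u n > 0"
proof -
  obtain x where x: "x \<in> E" using E_nonempty by blast
  let ?w = "map x [0..<n]"
  have c: "x \<in> cylinder E ?w" using x by (auto simp: cylinder_def)
  then have "?w \<in> words E n" by (auto simp: words_eq)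
  then have "sum (cyl_weight n) {?w} \<le> partition_sum E u n"
    unfolding partition_sum_eq by (intro finite_sum_le_infsum_ennreal) auto
  moreover have "cyl_weight n ?w > 0" using c by (intro cyl_weight_pos) auto
  ultimately show ?thesis by simp
qed

lemma partition_sum_1_finite: "partition_sum E u 1 < \<infinity>"
proof -
  have "partition_sum E u 1 \<le> ennreal (infsum b0 I)"
    unfolding partition_sum_eq
  proof (rule infsum_le_finite_sums)
    fix F assume F: "finite F" "F \<subseteq> words E 1"
    have w: "w ! 0 \<in> I" "cyl_weight 1 w \<le> ennreal (b0 (w ! 0))" if wF: "w \<in> F" for w
    proof -
      have len: "length w = 1" "cylinder E w \<noteq> {}" using wF F by (auto simp: words_eq)
      then obtain \<tau> where \<tau>: "\<tau> \<in> E" "\<tau> 0 = w ! 0" by (auto simp: cylinder_def)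
      have "\<tau> 0 \<in> I" using \<tau>(1) by (simp add: mem_E)
      then show "w ! 0 \<in> I" using \<tau>(2) by simp
      show "cyl_weight 1 w \<le> ennreal (b0 (w ! 0))"
      proof (rule cyl_weight_le)
        show "0 < b0 (w ! 0)" using less_le_trans[OF exp_gt_zero b0_bound[OF \<tau>(1)]] \<tau>(2) by simp
        show "exp (birkhoff_sum 1 u \<sigma>) \<le> b0 (w ! 0)" if "\<sigma> \<in> cylinder E w" for \<sigma>
          using b0_bound[of \<sigma>] that len(1) by (auto simp: birkhoff_sum_def cylinder_def)
      qed
    qed
    have inj: "inj_on (\<lambda>w. w ! 0) F"
    proof (rule inj_onI)
      fix v w assume "v \<in> F" "w \<in> F" "v ! 0 = w ! 0"
      moreover have "length v = 1" "length w = 1" using F(2) \<open>v \<in> F\<close> \<open>w \<in> F\<close> by (auto simp: words_eq)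
      ultimately show "v = w" by (intro nth_equalityI) auto
    qed
    have "sum (cyl_weight 1) F \<le> (\<Sum>w\<in>F. ennreal (b0 (w ! 0)))" by (intro sum_mono w)
    also have "\<dots> = ennreal (\<Sum>w\<in>F. b0 (w ! 0))" by (simp add: b0_nonneg)
    also have "(\<Sum>w\<in>F. b0 (w ! 0)) = sum b0 ((\<lambda>w. w ! 0) ` F)" by (simp add: sum.reindex[OF inj])
    also have "\<dots> \<le> infsum b0 I"
      using F(1) w(1) by (intro finite_sum_le_infsum b0_summable b0_nonneg) auto
    finally show "sum (cyl_weight 1) F \<le> ennreal (infsum b0 I)" by (simp add: ennreal_leI)
  qed (rule nonneg_summable_on_complete, rule zero_le)
  then show ?thesis by (simp add: le_less_trans)
qed

lemma partition_sum_finite: "partition_sum E u (Suc n) < \<infinity>"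
proof (induction n)
  case 0
  then show ?case using partition_sum_1_finite by simp
next
  case (Suc n)
  have "partition_sum E u (Suc (Suc n)) \<le> partition_sum E u 1 * partition_sum E u (Suc n)"
    using partition_sum_submult[of 1 "Suc n"] by simp
  also have "\<dots> < \<infinity>" using Suc partition_sum_1_finite by (simp add: ennreal_mult_less_top)
  finally show ?case .
qed

text \<open>By Fekete's lemma the limit that defines the pressure exists and is an infimum, so it bounds
  the growth rate of the partition sums.\<close>

lemma pressure_zero_imp_partition_sum_le:
  assumes P: "pressure E u = 0" and r: "0 < r" "r < 1"
  obtains K where "K \<ge> 1" "ennreal (r ^ K) * partition_sum E u K \<le> 1"
proof -
  define Z where "Z n = enn2real (partition_sum E u n)" for n
  have Z: "partition_sum E u n = ennreal (Z n)" "Z n > 0" if "n \<ge> 1" for n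
  proof -
    obtain k where "n = Suc k" using \<open>n \<ge> 1\<close> by (cases n) auto
    then have fin: "partition_sum E u n < \<infinity>" using partition_sum_finite by blast
    then show "partition_sum E u n = ennreal (Z n)" by (simp add: Z_def)
    show "Z n > 0" unfolding Z_def using fin partition_sum_pos[of n] by (simp add: enn2real_positive_iff)
  qed
  define a where "a n = ln (Z n)" for n
  have sub: "a (m + n) \<le> a m + a n" if "m \<ge> 1" "n \<ge> 1" for m n
  proof -
    have "ennreal (Z (m + n)) \<le> ennreal (Z m * Z n)"
      using partition_sum_submult[of m n] Z that by (simp add: ennreal_mult less_imp_le)
    then have "Z (m + n) \<le> Z m * Z n" using Z(2) that by (simp add: ennreal_le_iff less_imp_le)
    then have "a (m + n) \<le> ln (Z m * Z n)" unfolding a_def using Z(2)[of "m + n"] that by simp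
    then show ?thesis using Z(2) that by (simp add: a_def ln_mult_pos)
  qed
  let ?L = "INF n\<in>{1..}. ereal (a n / real n)"
  have lim: "(\<lambda>n. ereal (a n / real n)) \<longlonglongrightarrow> ?L" by (rule subadditive_tendsto_INF[OF sub])
  have "\<forall>\<^sub>F n in sequentially. ereal (1 / real n) * ln_ext (partition_sum E u n) = ereal (a n / real n)"
    using eventually_ge_at_top[of 1]
  proof eventually_elim
    case (elim n)
    then show ?case using Z[OF elim] by (simp add: ln_ext_def a_def less_imp_le)
  qed
  then have "(\<lambda>n. ereal (1 / real n) * ln_ext (partition_sum E u n)) \<longlonglongrightarrow> ?L"
    using lim by (simp add: filterlim_cong)
  then have "?L = 0" using P limI[of _ ?L] unfolding pressure_def by simp
  then have "(\<lambda>n. ereal (a n / real n)) \<longlonglongrightarrow> 0" using lim by simp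
  moreover have "0 < ereal (- ln r)" using r by (simp add: zero_ereal_def)
  ultimately have "\<forall>\<^sub>F n in sequentially. ereal (a n / real n) < ereal (- ln r)" by (rule order_tendstoD)
  then have "\<forall>\<^sub>F n in sequentially. a n / real n < - ln r \<and> n \<ge> 1"
    using eventually_ge_at_top[of 1] by eventually_elim auto
  then obtain K where K: "a K / real K < - ln r" "K \<ge> 1" using eventually_happens by force
  have "a K + real K * ln r < 0" using K by (simp add: field_simps)
  then have "ln (r ^ K * Z K) < 0" using r Z(2)[OF K(2)] by (simp add: a_def ln_mult_pos ln_realpow)
  then have "r ^ K * Z K < 1" using r Z(2)[OF K(2)] by (simp add: ln_less_zero_iff)
  then have "ennreal (r ^ K) * partition_sum E u K \<le> 1"
    using Z[OF K(2)] r by (simp add: ennreal_mult[symmetric])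
  with K(2) show thesis by (rule that)
qed

section \<open>Positive supersolutions\<close>

text \<open>The function \<open>L\<^sup>n 1\<close> for the real potential \<open>u\<close>.\<close>

primrec iterate :: "nat \<Rightarrow> (nat \<Rightarrow> nat) \<Rightarrow> real" where
  "iterate 0 x = 1"
| "iterate (Suc n) x = (\<Sum>\<^sub>\<infinity>y\<in>preimages x. exp (u y) * iterate n y)"

lemma real_summable_preimages:
  assumes "\<And>y. y \<in> preimages x \<Longrightarrow> 0 \<le> F y \<and> F y \<le> c" "c \<ge> 0"
  shows "(\<lambda>y. exp (u y) * F y) summable_on preimages x"
    "(\<Sum>\<^sub>\<infinity>y\<in>preimages x. exp (u y) * F y) \<le> infsum b0 I * c"
proof -
  have b: "(\<lambda>e. b0 e * c) summable_on I" "\<And>e. e \<in> I \<Longrightarrow> b0 e * c \<ge> 0"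
    using assms b0_nonneg b0_summable by (auto intro: summable_on_cmult_left)
  have F: "norm (exp (u y) * F y) \<le> b0 (y 0) * c" if "y \<in> preimages x" for y
    using assms that b0_bound[of y] b0_nonneg[of "y 0"]
    by (auto simp: abs_mult preimages_def intro!: mult_mono)
  show "(\<lambda>y. exp (u y) * F y) summable_on preimages x"
    using b F by (rule summable_preimages(1))
  show "(\<Sum>\<^sub>\<infinity>y\<in>preimages x. exp (u y) * F y) \<le> infsum b0 I * c"
    using summable_preimages(2)[of "\<lambda>e. b0 e * c" x "\<lambda>y. exp (u y) * F y"] b F
    by (simp add: infsum_cmult_left')
qed

lemma b0_sum_nonneg: "infsum b0 I \<ge> 0"
  by (intro infsum_nonneg b0_nonneg)

lemma iterate_bounds: "0 \<le> iterate n x \<and> iterate n x \<le> infsum b0 I ^ n"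
proof (induction n arbitrary: x)
  case (Suc n)
  have "0 \<le> iterate (Suc n) x" using Suc by (auto intro!: infsum_nonneg)
  moreover have "iterate (Suc n) x \<le> infsum b0 I * infsum b0 I ^ n"
    using Suc b0_sum_nonneg by (auto intro!: real_summable_preimages(2))
  ultimately show ?case by simp
qed simp

lemma iterate_has_sum: "((\<lambda>y. exp (u y) * iterate n y) has_sum iterate (Suc n) x) (preimages x)"
  using real_summable_preimages(1)[of x "iterate n" "infsum b0 I ^ n"] iterate_bounds b0_sum_nonneg
  by (auto simp: has_sum_iff)

lemma iterate_eq_birkhoff:
  assumes "x \<in> E"
  shows "((\<lambda>y. exp (birkhoff_sum n u y)) has_sum iterate n x) {y \<in> E. (shift ^^ n) y = x}"
  using assms
proof (induction n arbitrary: x)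
  case 0
  have "{y \<in> E. (shift ^^ 0) y = x} = {x}" using 0 by auto
  then show ?case by (simp add: birkhoff_sum_def has_sum_finite_iff)
next
  case (Suc n)
  let ?B = "\<lambda>y'. {y \<in> E. (shift ^^ n) y = y'}"
  let ?f = "\<lambda>(y', y). exp (u y') * exp (birkhoff_sum n u y)"
  have inner: "((\<lambda>y. ?f (y', y)) has_sum (exp (u y') * iterate n y')) (?B y')" if "y' \<in> preimages x" for y'
    using Suc.IH[OF preimagesD(1)[OF that]] by (auto intro: has_sum_cmult_right)
  have "?f summable_on Sigma (preimages x) ?B"
    by (rule summable_on_SigmaI[OF inner]) (use iterate_has_sum[of n x] in \<open>auto simp: has_sum_iff\<close>)
  from has_sum_SigmaI[OF inner iterate_has_sum this]
  have "(?f has_sum iterate (Suc n) x) (Sigma (preimages x) ?B)" .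
  moreover have "(?f has_sum iterate (Suc n) x) (Sigma (preimages x) ?B) \<longleftrightarrow>
      ((\<lambda>y. exp (birkhoff_sum (Suc n) u y)) has_sum iterate (Suc n) x) {y \<in> E. (shift ^^ Suc n) y = x}"
  proof (rule has_sum_reindex_bij_witness[where i = "\<lambda>y. ((shift ^^ n) y, y)" and j = snd])
    show "exp (birkhoff_sum (Suc n) u (snd a)) = ?f a" if "a \<in> Sigma (preimages x) ?B" for a
      using that by (auto simp: birkhoff_sum_def exp_add mult.commute)
  qed (auto simp: preimages_def funpow_shift_mem)
  ultimately show ?case by blast
qed

text \<open>The points that the shift takes to \<open>x\<close> after \<open>n\<close> steps have distinct initial words of length
  \<open>n\<close>.\<close>

lemma iterate_le_partition_sum:
  assumes "x \<in> E"
  shows "ennreal (iterate n x) \<le> partition_sum E u n"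
proof -
  let ?Y = "{y \<in> E. (shift ^^ n) y = x}"
  let ?s = "\<lambda>y. map y [0..<n]"
  have inj: "inj_on ?s ?Y"
  proof (rule inj_onI)
    fix y y' assume yy: "y \<in> ?Y" "y' \<in> ?Y" "?s y = ?s y'"
    show "y = y'"
    proof
      fix i show "y i = y' i"
      proof (cases "i < n")
        case True
        then show ?thesis using arg_cong[OF yy(3), of "\<lambda>l. l ! i"] by simp
      next
        case False
        have "(shift ^^ n) y (i - n) = (shift ^^ n) y' (i - n)" using yy by simp
        then show ?thesis using False by (simp add: funpow_shift)
      qed
    qed
  qed
  have "ennreal (iterate n x) = ennreal (infsum (\<lambda>y. exp (birkhoff_sum n u y)) ?Y)"
    using iterate_eq_birkhoff[OF assms] by (simp add: has_sum_iff)
  also have "\<dots> = (SUP F\<in>{F. finite F \<and> F \<subseteq> ?Y}. ennreal (\<Sum>y\<in>F. exp (birkhoff_sum n u y)))"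
    using iterate_eq_birkhoff[OF assms, of n]
    by (intro infsum_nonneg_is_SUPREMUM_ennreal) (auto simp: has_sum_iff)
  also have "\<dots> \<le> partition_sum E u n"
  proof (rule SUP_least, clarify)
    fix F assume F: "finite F" "F \<subseteq> ?Y"
    have cyl: "y \<in> cylinder E (?s y)" if "y \<in> F" for y using that F(2) by (auto simp: cylinder_def)
    have "ennreal (\<Sum>y\<in>F. exp (birkhoff_sum n u y)) = (\<Sum>y\<in>F. ennreal (exp (birkhoff_sum n u y)))" by simp
    also have "\<dots> \<le> (\<Sum>y\<in>F. cyl_weight n (?s y))" by (intro sum_mono exp_le_cyl_weight cyl)
    also have "\<dots> = sum (cyl_weight n) (?s ` F)"
      using inj_on_subset[OF inj F(2)] by (simp add: sum.reindex)
    also have "\<dots> \<le> partition_sum E u n" unfolding partition_sum_eq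
    proof (rule finite_sum_le_infsum_ennreal)
      show "?s ` F \<subseteq> words E n" unfolding words_eq using cyl by auto
    qed (simp add: F)
    finally show "ennreal (\<Sum>y\<in>F. exp (birkhoff_sum n u y)) \<le> partition_sum E u n" .
  qed
  finally show ?thesis .
qed

text \<open>The constant solves \<open>U \<theta> + D \<theta> = D\<close>: one more step costs \<open>U \<theta>\<^sup>m\<^sup>+\<^sup>1\<close>, but the points compared then
  agree in one more letter.\<close>

definition D :: real where "D = U * \<theta> / (1 - \<theta>)"

lemma U_nonneg: "U \<ge> 0" using u_lip by (rule lip_bound_nonneg)

lemma D_nonneg: "D \<ge> 0" using U_nonneg \<theta>_pos \<theta>_less by (simp add: D_def)

lemma iterate_distortion:
  assumes "x \<in> E" "x' \<in> E" "agree m x x'" "m \<ge> 1"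
  shows "iterate n x \<le> exp (D * \<theta> ^ m) * iterate n x'"
  using assms
proof (induction n arbitrary: x x' m)
  case 0
  then show ?case using D_nonneg \<theta>_pos by simp
next
  case (Suc n)
  have ag1: "agree 1 x x'" using agree_mono[OF Suc.prems(3,4)] .
  let ?y' = "\<lambda>y. case_nat (y 0) x'"
  have "iterate (Suc n) x' = (\<Sum>\<^sub>\<infinity>y\<in>preimages x. exp (u (?y' y)) * iterate n (?y' y))"
    using infsum_branch[OF Suc.prems(1,2) ag1] by simp
  moreover have "(\<lambda>y. exp (u (?y' y)) * iterate n (?y' y)) summable_on preimages x"
    using summable_on_reindex_bij_betw[OF bij_preimages[OF Suc.prems(1,2) ag1], of "\<lambda>y. exp (u y) * iterate n y"]
      iterate_has_sum[of n x'] by (auto simp: has_sum_iff)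
  ultimately have s': "((\<lambda>y. exp (u (?y' y)) * iterate n (?y' y)) has_sum iterate (Suc n) x') (preimages x)"
    by (simp add: has_sum_iff)
  show ?case
  proof (rule has_sum_mono[OF iterate_has_sum has_sum_cmult_right[OF s']])
    fix y assume y: "y \<in> preimages x"
    note y' = branch_mem[OF Suc.prems(1,2) ag1 y] agree_branch[OF y Suc.prems(3)] preimagesD(1)[OF y]
    have "u y \<le> u (?y' y) + U * \<theta> ^ Suc m"
      using lip_boundD[OF u_lip _ y'(4,1,3)] by (simp add: abs_le_iff)
    then have "exp (u y) * iterate n y \<le> exp (u (?y' y) + U * \<theta> ^ Suc m) * (exp (D * \<theta> ^ Suc m) * iterate n (?y' y))"
      using Suc.IH[OF y'(4,1,3)] iterate_bounds by (intro mult_mono) auto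
    also have "\<dots> = exp ((U * \<theta> + D * \<theta>) * \<theta> ^ m) * (exp (u (?y' y)) * iterate n (?y' y))"
      by (simp add: exp_add algebra_simps)
    also have "U * \<theta> + D * \<theta> = D" using \<theta>_less by (simp add: D_def field_simps)
    finally show "exp (u y) * iterate n y \<le> exp (D * \<theta> ^ m) * (exp (u (?y' y)) * iterate n (?y' y))" .
  qed
qed

lemma exp_minus_u_bounded:
  assumes "finite F"
  shows "\<exists>M. \<forall>v\<in>E. v 0 \<in> F \<longrightarrow> exp (- u v) \<le> M"
  using assms
proof induction
  case (insert e F)
  then obtain M where M: "\<forall>v\<in>E. v 0 \<in> F \<longrightarrow> exp (- u v) \<le> M" by blast
  have "\<exists>M'. \<forall>v\<in>E. v 0 = e \<longrightarrow> exp (- u v) \<le> M'"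
  proof (cases "\<exists>w\<in>E. w 0 = e")
    case True
    then obtain w where w: "w \<in> E" "w 0 = e" by blast
    have "exp (- u v) \<le> exp (- u w + U * \<theta>)" if "v \<in> E" "v 0 = e" for v
      using lip_boundD[OF u_lip order_refl w(1) that(1)] w(2) that(2) by (auto simp: agree_def abs_le_iff)
    then show ?thesis by blast
  qed auto
  then obtain M' where M': "\<forall>v\<in>E. v 0 = e \<longrightarrow> exp (- u v) \<le> M'" by blast
  show ?case
  proof (intro exI[of _ "max M M'"] ballI impI)
    fix v assume "v \<in> E" "v 0 \<in> insert e F"
    then show "exp (- u v) \<le> max M M'" using M M' by (cases "v 0 = e") (auto simp: le_max_iff_disj)
  qed
qed auto

text \<open>Partial sums of the resolvent series \<open>\<Sum>n. r\<^sup>n L\<^sup>n 1\<close> satisfy \<open>r L G \<le> G \<le> 1 + r L G\<close> as soon as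
  the first omitted term is at most 1.\<close>

definition resolvent_like :: "real \<Rightarrow> ((nat \<Rightarrow> nat) \<Rightarrow> real) \<Rightarrow> bool" where
  "resolvent_like r G \<longleftrightarrow> (\<forall>x\<in>E. 1 \<le> G x \<and> (\<lambda>y. exp (u y) * G y) summable_on preimages x \<and>
     r * (\<Sum>\<^sub>\<infinity>y\<in>preimages x. exp (u y) * G y) \<le> G x \<and>
     G x \<le> 1 + r * (\<Sum>\<^sub>\<infinity>y\<in>preimages x. exp (u y) * G y) \<and>
     (\<forall>x'\<in>E. agree 1 x x' \<longrightarrow> G x \<le> exp D * G x'))"

text \<open>Comparison of the values of a supersolution at arbitrary points. Expand the value at \<open>x\<close> over
  the inverse branches, and move each branch \<open>e x\<close> to a point that starts with the same letter
  and reaches \<open>y\<close> after a connecting path through finitely many letters. Distortion controls the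
  move, and the supersolution inequality controls the loss along the path.\<close>

lemma supersolution_harnack:
  obtains C where "C \<ge> 1" "\<And>G r x y. x \<in> E \<Longrightarrow> y \<in> E \<Longrightarrow> 1/2 \<le> r \<Longrightarrow> r < 1 \<Longrightarrow> resolvent_like r G \<Longrightarrow>
    G x \<le> C * G y"
proof -
  obtain F L where FL: "finite F" "\<And>N z x. z \<in> E \<Longrightarrow> x \<in> E \<Longrightarrow>
    \<exists>y\<in>E. \<exists>j\<le>N + L. N < j \<and> agree (Suc N) y z \<and> (\<forall>i. N < i \<and> i < j \<longrightarrow> y i \<in> F) \<and> (shift ^^ j) y = x"
    by (rule joining) blast
  obtain M where M: "\<And>v. v \<in> E \<Longrightarrow> v 0 \<in> F \<Longrightarrow> exp (- u v) \<le> M" using exp_minus_u_bounded[OF FL(1)] by blast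
  define \<kappa> where "\<kappa> = max 1 (2 * M)"
  define Ls where "Ls = {l. set l \<subseteq> F \<and> length l \<le> L}"
  have Ls: "finite Ls" unfolding Ls_def using FL(1) by (rule finite_lists_length_le)
  define app where "app l y = (\<lambda>i. if i < length l then l ! i else y (i - length l))" for l :: "nat list" and y :: "nat \<Rightarrow> nat"
  define C where "C = 1 + exp (U * \<theta>) * exp D * (card Ls * (2 * \<kappa> ^ L))"
  have \<kappa>: "\<kappa> \<ge> 1" by (simp add: \<kappa>_def)
  show thesis
  proof (rule that[of C])
    show "C \<ge> 1" using \<kappa> by (simp add: C_def)
    fix G r x y
    assume x: "x \<in> E" and y: "y \<in> E" and r: "1/2 \<le> r" "r < 1" and G: "resolvent_like r G"
    have G1: "\<And>x. x \<in> E \<Longrightarrow> 1 \<le> G x"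
      and dist: "\<And>x x'. x \<in> E \<Longrightarrow> x' \<in> E \<Longrightarrow> agree 1 x x' \<Longrightarrow> G x \<le> exp D * G x'"
      and summ: "\<And>x. x \<in> E \<Longrightarrow> (\<lambda>y. exp (u y) * G y) summable_on preimages x"
      and super: "\<And>x. x \<in> E \<Longrightarrow> r * (\<Sum>\<^sub>\<infinity>y\<in>preimages x. exp (u y) * G y) \<le> G x"
      and sub: "\<And>x. x \<in> E \<Longrightarrow> G x \<le> 1 + r * (\<Sum>\<^sub>\<infinity>y\<in>preimages x. exp (u y) * G y)"
      using G unfolding resolvent_like_def by blast+
    let ?LG = "\<lambda>x. \<Sum>\<^sub>\<infinity>y\<in>preimages x. exp (u y) * G y"
    have G0: "G x \<ge> 0" if "x \<in> E" for x using G1[OF that] by simp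
    have LG: "?LG v \<le> 2 * G v" if "v \<in> E" for v
    proof -
      have "?LG v \<ge> 0" by (intro infsum_nonneg) (auto simp: preimages_def G0)
      then have "1/2 * ?LG v \<le> r * ?LG v" using r by (intro mult_right_mono)
      then show ?thesis using super[OF that] by simp
    qed
    have path: "G v \<le> \<kappa> ^ j * G y" if "v \<in> E" "(shift ^^ j) v = y" "\<And>i. i < j \<Longrightarrow> v i \<in> F" for v j
      using that
    proof (induction j arbitrary: v)
      case (Suc j)
      have sv: "shift v \<in> E" using Suc.prems(1) by (rule shift_mem)
      have "sum (\<lambda>y. exp (u y) * G y) {v} \<le> ?LG (shift v)"
        using Suc.prems(1) by (intro finite_sum_le_infsum summ sv) (auto simp: preimages_def G0)
      then have "exp (u v) * G v \<le> 2 * G (shift v)" using LG[OF sv] by simp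
      then have "exp (- u v) * (exp (u v) * G v) \<le> exp (- u v) * (2 * G (shift v))"
        by (intro mult_left_mono) auto
      moreover have "exp (- u v) * (exp (u v) * G v) = G v" by (simp flip: exp_add mult.assoc)
      ultimately have "G v \<le> exp (- u v) * (2 * G (shift v))" by simp
      also have "\<dots> \<le> M * (2 * G (shift v))"
        using M[OF Suc.prems(1)] Suc.prems(3)[of 0] G0[OF sv] by (intro mult_right_mono) auto
      also have "\<dots> = (2 * M) * G (shift v)" by simp
      also have "\<dots> \<le> \<kappa> * G (shift v)" using G0[OF sv] by (intro mult_right_mono) (auto simp: \<kappa>_def)
      also have "\<dots> \<le> \<kappa> * (\<kappa> ^ j * G y)"
      proof (intro mult_left_mono Suc.IH sv)
        show "(shift ^^ j) (shift v) = y" using Suc.prems(2) by (simp add: funpow_swap1)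
        show "shift v i \<in> F" if "i < j" for i using Suc.prems(3)[of "Suc i"] that by (simp add: shift_def)
      qed (use \<kappa> in auto)
      finally show ?case by simp
    qed simp
    \<comment> \<open>the finitely many possible positions of the branches after the move, without their first letter\<close>
    define P where "P = {v \<in> (\<lambda>l. app l y) ` Ls. v \<in> E \<and> G v \<le> \<kappa> ^ L * G y}"
    have P: "finite P" "card P \<le> card Ls"
      using Ls card_mono[of "(\<lambda>l. app l y) ` Ls" P] card_image_le[OF Ls, of "\<lambda>l. app l y"]
      by (auto simp: P_def)
    have "\<exists>w'\<in>E. agree 1 w' w \<and> shift w' \<in> P" if wE: "w \<in> E" for w
    proof -
      obtain w' j where w': "w' \<in> E" "j \<le> L" "0 < j" "agree 1 w' w" "\<And>i. 0 < i \<Longrightarrow> i < j \<Longrightarrow> w' i \<in> F"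
        "(shift ^^ j) w' = y" using FL(2)[OF wE y, of 0] by auto
      define l where "l = map (shift w') [0..<j - 1]"
      have sF: "shift w' i \<in> F" if "i < j - 1" for i using w'(5)[of "Suc i"] that by (simp add: shift_def)
      have sj: "(shift ^^ (j - 1)) (shift w') = y"
        using w'(3,6) funpow_Suc_right[of "j - 1" shift] by (simp add: fun_eq_iff)
      have "shift w' i = app l y i" for i
      proof (cases "i < j - 1")
        case False
        then show ?thesis using fun_cong[OF sj, of "i - (j - 1)"] by (simp add: app_def l_def funpow_shift)
      qed (simp add: app_def l_def)
      then have "shift w' = app l y" by blast
      moreover have "l \<in> Ls" unfolding Ls_def l_def using sF w'(2) by auto
      moreover have "G (shift w') \<le> \<kappa> ^ L * G y"
      proof -
        have "G (shift w') \<le> \<kappa> ^ (j - 1) * G y" by (rule path[OF shift_mem[OF w'(1)] sj sF])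
        also have "\<dots> \<le> \<kappa> ^ L * G y"
          using w'(2) \<kappa> G0[OF y] by (intro mult_right_mono power_increasing) auto
        finally show ?thesis .
      qed
      ultimately show ?thesis using w'(1,4) shift_mem unfolding P_def by blast
    qed
    then obtain \<phi> where \<phi>: "\<And>w. w \<in> E \<Longrightarrow> \<phi> w \<in> E" "\<And>w. w \<in> E \<Longrightarrow> agree 1 (\<phi> w) w"
      "\<And>w. w \<in> E \<Longrightarrow> shift (\<phi> w) \<in> P" by metis
    have "?LG x \<le> exp (U * \<theta>) * exp D * (card Ls * (2 * (\<kappa> ^ L * G y)))"
    proof (rule infsum_le_finite_sums[OF summ[OF x]])
      fix W assume W: "finite W" "W \<subseteq> preimages x"
      have WE: "w \<in> E" if "w \<in> W" for w using W(2) that by (auto simp: preimages_def)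
      have inj: "inj_on \<phi> W"
      proof (rule inj_onI)
        fix w w' assume ww: "w \<in> W" "w' \<in> W" "\<phi> w = \<phi> w'"
        have "w 0 = w' 0" using \<phi>(2)[OF WE[OF ww(1)]] \<phi>(2)[OF WE[OF ww(2)]] ww(3) by (simp add: agree_def)
        then show "w = w'" using ww(1,2) W(2) inj_on_preimages[of x] by (auto simp: inj_on_def)
      qed
      let ?f = "\<lambda>y. exp (u y) * G y"
      have "sum ?f W \<le> (\<Sum>w\<in>W. exp (U * \<theta>) * exp D * ?f (\<phi> w))"
      proof (rule sum_mono)
        fix w assume w: "w \<in> W"
        note wE = WE[OF w]
        have "u w \<le> u (\<phi> w) + U * \<theta>"
          using lip_boundD[OF u_lip order_refl \<phi>(1)[OF wE] wE \<phi>(2)[OF wE]] by (simp add: abs_le_iff)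
        then have "?f w \<le> exp (u (\<phi> w) + U * \<theta>) * (exp D * G (\<phi> w))"
          using dist[OF wE \<phi>(1)[OF wE] agree_sym[OF \<phi>(2)[OF wE]]] G0[OF wE] by (intro mult_mono) auto
        then show "?f w \<le> exp (U * \<theta>) * exp D * ?f (\<phi> w)" by (simp add: exp_add algebra_simps)
      qed
      also have "\<dots> = exp (U * \<theta>) * exp D * sum ?f (\<phi> ` W)"
        using inj by (simp add: sum.reindex sum_distrib_left)
      also have "sum ?f (\<phi> ` W) = (\<Sum>v\<in>P. sum ?f {y \<in> \<phi> ` W. shift y = v})"
        using W(1) P(1) \<phi>(3) WE by (intro sum.group[symmetric]) auto
      also have "\<dots> \<le> (\<Sum>v\<in>P. 2 * (\<kappa> ^ L * G y))"
      proof (rule sum_mono)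
        fix v assume v: "v \<in> P"
        then have vE: "v \<in> E" and Gv: "G v \<le> \<kappa> ^ L * G y" by (auto simp: P_def)
        have "sum ?f {y \<in> \<phi> ` W. shift y = v} \<le> ?LG v"
          using W(1) \<phi>(1) WE by (intro finite_sum_le_infsum summ vE) (auto simp: preimages_def G0)
        also have "\<dots> \<le> 2 * (\<kappa> ^ L * G y)" using LG[OF vE] Gv by simp
        finally show "sum ?f {y \<in> \<phi> ` W. shift y = v} \<le> 2 * (\<kappa> ^ L * G y)" .
      qed
      also have "\<dots> = card P * (2 * (\<kappa> ^ L * G y))" by simp
      also have "\<dots> \<le> card Ls * (2 * (\<kappa> ^ L * G y))"
        using P(2) G0[OF y] \<kappa> by (intro mult_right_mono) auto
      finally show "sum ?f W \<le> exp (U * \<theta>) * exp D * (card Ls * (2 * (\<kappa> ^ L * G y)))" by simp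
    qed
    moreover have "0 \<le> ?LG x" by (intro infsum_nonneg) (auto simp: preimages_def G0)
    then have "r * ?LG x \<le> 1 * ?LG x" using r by (intro mult_right_mono) auto
    ultimately have "G x \<le> G y + exp (U * \<theta>) * exp D * (card Ls * (2 * (\<kappa> ^ L * G y)))"
      using sub[OF x] G1[OF y] by linarith
    also have "\<dots> = C * G y" by (simp add: C_def algebra_simps)
    finally show "G x \<le> C * G y" .
  qed
qed

text \<open>A truncated resolvent series \<open>G = \<Sum>n<K. r\<^sup>n L\<^sup>n 1\<close> satisfies \<open>r L G = G - 1 + r\<^sup>K L\<^sup>K 1\<close>, and
  vanishing pressure lets \<open>K\<close> be chosen so that this error term is at most 1. The supersolution is \<open>G\<close>
  divided by its value at one point, which makes the bounds independent of \<open>r\<close>.\<close>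

lemma approximate_eigenfunctions:
  assumes P: "pressure E u = 0"
  obtains C B where "C \<ge> 1" "B \<ge> 0" "\<And>r. 1/2 \<le> r \<Longrightarrow> r < 1 \<Longrightarrow> \<exists>h. (\<forall>x\<in>E. 1 / C \<le> h x \<and> h x \<le> C) \<and>
      lip_bound h B \<and> (\<forall>x\<in>E. (\<Sum>\<^sub>\<infinity>y\<in>preimages x. exp (u y) * h y) \<le> h x / r)"
proof -
  obtain C where C: "C \<ge> 1" "\<And>G r x y. x \<in> E \<Longrightarrow> y \<in> E \<Longrightarrow> 1/2 \<le> r \<Longrightarrow> r < 1 \<Longrightarrow> resolvent_like r G \<Longrightarrow>
      G x \<le> C * G y"
    by (rule supersolution_harnack) blast
  obtain p0 where p0: "p0 \<in> E" using E_nonempty by blast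
  have "\<exists>h. (\<forall>x\<in>E. 1 / C \<le> h x \<and> h x \<le> C) \<and> lip_bound h (C * D * exp D) \<and>
      (\<forall>x\<in>E. (\<Sum>\<^sub>\<infinity>y\<in>preimages x. exp (u y) * h y) \<le> h x / r)" if r: "1/2 \<le> r" "r < 1" for r
  proof -
    have r0: "r > 0" using r by simp
    obtain K where K: "K \<ge> 1" "ennreal (r ^ K) * partition_sum E u K \<le> 1"
      by (rule pressure_zero_imp_partition_sum_le[OF P r0 r(2)])
    define G where "G x = (\<Sum>n<K. r ^ n * iterate n x)" for x
    have last: "r ^ K * iterate K x \<le> 1" if "x \<in> E" for x
    proof -
      have "ennreal (r ^ K * iterate K x) = ennreal (r ^ K) * ennreal (iterate K x)"
        using iterate_bounds r0 by (simp add: ennreal_mult)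
      also have "\<dots> \<le> ennreal (r ^ K) * partition_sum E u K"
        by (intro mult_left_mono iterate_le_partition_sum that) auto
      also have "\<dots> \<le> ennreal 1" using K(2) by simp
      finally show ?thesis by (subst (asm) ennreal_le_iff) simp_all
    qed
    have G1: "1 \<le> G x" for x
    proof -
      have "sum (\<lambda>n. r ^ n * iterate n x) {0} \<le> G x"
        unfolding G_def using K(1) r0 iterate_bounds by (intro sum_mono2) auto
      then show ?thesis by simp
    qed
    have LG: "((\<lambda>y. exp (u y) * G y) has_sum (\<Sum>n<K. r ^ n * iterate (Suc n) x)) (preimages x)" for x
    proof -
      have "((\<lambda>y. exp (u y) * (\<Sum>n<k. r ^ n * iterate n y)) has_sum (\<Sum>n<k. r ^ n * iterate (Suc n) x)) (preimages x)" for k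
      proof (induction k)
        case (Suc k)
        have "((\<lambda>y. exp (u y) * (\<Sum>n<k. r ^ n * iterate n y) + r ^ k * (exp (u y) * iterate k y))
          has_sum ((\<Sum>n<k. r ^ n * iterate (Suc n) x) + r ^ k * iterate (Suc k) x)) (preimages x)"
          by (intro has_sum_add Suc has_sum_cmult_right iterate_has_sum)
        then show ?case by (simp add: algebra_simps)
      qed simp
      then show ?thesis unfolding G_def .
    qed
    let ?LG = "\<lambda>x. \<Sum>\<^sub>\<infinity>y\<in>preimages x. exp (u y) * G y"
    have eq: "r * ?LG x = G x - 1 + r ^ K * iterate K x" for x
    proof -
      have "?LG x = (\<Sum>n<K. r ^ n * iterate (Suc n) x)" using LG[of x] by (simp add: has_sum_iff)
      then have "r * ?LG x = (\<Sum>n<K. r ^ Suc n * iterate (Suc n) x)"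
        by (simp only: sum_distrib_left power_Suc mult.assoc)
      also have "\<dots> = (\<Sum>n<Suc K. r ^ n * iterate n x) - 1"
        by (subst sum.lessThan_Suc_shift) (simp del: iterate.simps(2))
      finally show ?thesis by (simp add: G_def)
    qed
    have super: "r * ?LG x \<le> G x" if "x \<in> E" for x using eq[of x] last[OF that] by simp
    have dist: "G x \<le> exp (D * \<theta> ^ m) * G x'" if "x \<in> E" "x' \<in> E" "agree m x x'" "m \<ge> 1" for x x' m
      unfolding G_def sum_distrib_left
    proof (rule sum_mono)
      fix n
      have "r ^ n * iterate n x \<le> r ^ n * (exp (D * \<theta> ^ m) * iterate n x')"
        using r0 by (intro mult_left_mono iterate_distortion that) auto
      then show "r ^ n * iterate n x \<le> exp (D * \<theta> ^ m) * (r ^ n * iterate n x')" by (simp add: algebra_simps)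
    qed
    have "resolvent_like r G"
      unfolding resolvent_like_def
    proof (intro ballI conjI impI)
      fix x assume x: "x \<in> E"
      show "1 \<le> G x" by (rule G1)
      show "(\<lambda>y. exp (u y) * G y) summable_on preimages x" using LG[of x] by (auto simp: has_sum_iff)
      show "r * ?LG x \<le> G x" by (rule super[OF x])
      show "G x \<le> 1 + r * ?LG x" using eq[of x] iterate_bounds[of K x] r0 by simp
      fix x' assume x': "x' \<in> E" "agree 1 x x'"
      have "exp (D * \<theta> ^ 1) \<le> exp D" using D_nonneg \<theta>_less \<theta>_pos by (simp add: mult_left_le)
      then have "exp (D * \<theta> ^ 1) * G x' \<le> exp D * G x'" using G1[of x'] by (intro mult_right_mono) auto
      then show "G x \<le> exp D * G x'" using dist[OF x x' order_refl] by linarith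
    qed
    then have harnack: "G x \<le> C * G y" if "x \<in> E" "y \<in> E" for x y using C(2)[OF that r] by blast
    define h where "h x = G x / G p0" for x
    have Gp0: "G p0 > 0" using G1[of p0] by simp
    have hb: "1 / C \<le> h x \<and> h x \<le> C" if "x \<in> E" for x
      using harnack[OF that p0] harnack[OF p0 that] Gp0 C(1) by (simp add: h_def field_simps)
    have hd: "h x - h x' \<le> C * D * exp D * \<theta> ^ m" if "x \<in> E" "x' \<in> E" "agree m x x'" "m \<ge> 1" for x x' m
    proof -
      have th: "\<theta> ^ m \<ge> 0" "\<theta> ^ m \<le> 1" using \<theta>_pos \<theta>_less by (auto intro: power_le_one)
      let ?s = "D * \<theta> ^ m"
      have s: "0 \<le> ?s" "?s \<le> D" using D_nonneg th by (auto simp: mult_left_le)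
      have "h x \<le> exp ?s * h x'" using dist[OF that] Gp0 by (simp add: h_def field_simps)
      then have "h x - h x' \<le> (exp ?s - 1) * h x'" by (simp add: algebra_simps)
      also have "\<dots> \<le> (?s * exp D) * C"
      proof (intro mult_mono)
        have "1 - ?s \<le> exp (- ?s)" using exp_ge_add_one_self[of "- ?s"] by simp
        then have "exp ?s * (1 - ?s) \<le> exp ?s * exp (- ?s)" by (intro mult_left_mono) auto
        then have "exp ?s - 1 \<le> ?s * exp ?s" by (simp add: exp_minus algebra_simps)
        also have "\<dots> \<le> ?s * exp D" using s by (intro mult_left_mono) auto
        finally show "exp ?s - 1 \<le> ?s * exp D" .
        show "h x' \<le> C" using hb that by blast
        show "0 \<le> h x'" using G1[of x'] Gp0 by (simp add: h_def)
      qed (use s in auto)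
      finally show ?thesis by (simp add: algebra_simps)
    qed
    have "lip_bound h (C * D * exp D)"
      unfolding lip_bound_def
    proof (intro allI ballI impI)
      fix m x x' assume m: "1 \<le> m" "x \<in> E" "x' \<in> E" "agree m x x'"
      show "norm (h x - h x') \<le> C * D * exp D * \<theta> ^ m"
        using hd[OF m(2-4,1)] hd[OF m(3,2) agree_sym[OF m(4)] m(1)] by (simp add: abs_le_iff)
    qed
    moreover have "(\<Sum>\<^sub>\<infinity>y\<in>preimages x. exp (u y) * h y) \<le> h x / r" if "x \<in> E" for x
    proof -
      have "(\<Sum>\<^sub>\<infinity>y\<in>preimages x. exp (u y) * h y) = ?LG x / G p0"
        by (simp add: h_def divide_inverse infsum_cmult_left' flip: mult.assoc)
      also have "\<dots> \<le> h x / r" using super[OF that] Gp0 r0 by (simp add: h_def field_simps)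
      finally show ?thesis .
    qed
    ultimately show ?thesis using hb by blast
  qed
  with C(1) D_nonneg show thesis by (intro that[of C "C * D * exp D"]) auto
qed

end

section \<open>Limits of approximate eigenfunctions\<close>

text \<open>Tychonoff's theorem in place of a diagonal argument: along a suitable filter finer than the
  cofinite one, a uniformly bounded sequence of functions converges at every point.\<close>

lemma bounded_functions_cluster:
  fixes f :: "nat \<Rightarrow> 'a \<Rightarrow> complex"
  assumes "\<And>n x. cmod (f n x) \<le> 1"
  obtains F \<phi> where "F \<noteq> bot" "F \<le> sequentially" "\<And>x. ((\<lambda>n. f n x) \<longlongrightarrow> \<phi> x) F"
proof -
  define K where "K = PiE UNIV (\<lambda>_::'a. cball (0::complex) 1)"
  have "compactin (product_topology (\<lambda>_. euclidean) UNIV) K"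
    unfolding K_def compactin_PiE by auto
  then have "compact K" by (simp add: euclidean_product_topology)
  moreover have "filtermap f sequentially \<noteq> bot" by (simp add: filtermap_bot_iff)
  moreover have "eventually (\<lambda>g. g \<in> K) (filtermap f sequentially)"
    using assms by (simp add: eventually_filtermap K_def PiE_def)
  ultimately obtain \<phi> where \<phi>: "inf (nhds \<phi>) (filtermap f sequentially) \<noteq> bot"
    unfolding compact_filter by blast
  define F where "F = inf (filtercomap f (nhds \<phi>)) sequentially"
  show thesis
  proof (rule that[of F \<phi>])
    show "F \<noteq> bot"
    proof
      assume "F = bot"
      then have "eventually (\<lambda>_. False) F" by simp
      then obtain P Q where PQ: "eventually P (filtercomap f (nhds \<phi>))" "eventually Q sequentially"
        "\<And>n. P n \<and> Q n \<longrightarrow> False"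
        unfolding F_def eventually_inf by blast
      obtain P' where P': "eventually P' (nhds \<phi>)" "\<And>n. P' (f n) \<Longrightarrow> P n"
        using PQ(1) unfolding eventually_filtercomap by blast
      have "eventually (\<lambda>g. \<not> P' g) (filtermap f sequentially)"
        unfolding eventually_filtermap using PQ(2) by eventually_elim (use PQ(3) P'(2) in blast)
      then have "eventually (\<lambda>_. False) (inf (nhds \<phi>) (filtermap f sequentially))"
        unfolding eventually_inf using P'(1) by blast
      then show False using \<phi> by (simp add: eventually_False)
    qed
    show "F \<le> sequentially" by (simp add: F_def)
    have "filterlim f (nhds \<phi>) F"
      unfolding filterlim_iff_le_filtercomap F_def by simp
    then have lim: "eventually (\<lambda>n. f n \<in> T) F" if "open T" "\<phi> \<in> T" for T
      using that by (auto simp: filterlim_iff eventually_nhds)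
    show "((\<lambda>n. f n x) \<longlongrightarrow> \<phi> x) F" for x
    proof (rule topological_tendstoI)
      fix S :: "complex set" assume "open S" "\<phi> x \<in> S"
      then have "open ((\<lambda>g. g x) -` S)" by (intro open_vimage) auto
      from lim[OF this] show "eventually (\<lambda>n. f n x \<in> S) F" using \<open>\<phi> x \<in> S\<close> by simp
    qed
  qed
qed

lemma (in markov_shift) weight_bound_mult:
  assumes W: "weight_bound W b" and h: "\<And>y. y \<in> E \<Longrightarrow> \<bar>h y\<bar> \<le> C" and B: "lip_bound h B"
  shows "weight_bound (\<lambda>y. W y * of_real (h y)) (\<lambda>e. b e * (B + C))"
  unfolding weight_bound_def
proof (intro conjI allI ballI impI)
  note WD = weight_boundD[OF W]
  have C: "C \<ge> 0" using h E_nonempty abs_ge_zero order_trans by blast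
  have B0: "B \<ge> 0" by (rule lip_bound_nonneg[OF B])
  have b: "b (y 0) \<ge> 0" if "y \<in> E" for y using that WD(2) by (auto simp: mem_E)
  show "(\<lambda>e. b e * (B + C)) summable_on I" by (intro summable_on_cmult_left WD)
  show "0 \<le> b e * (B + C)" if "e \<in> I" for e using WD(2)[OF that] C B0 by simp
  show "cmod (W y * of_real (h y)) \<le> b (y 0) * (B + C)" if "y \<in> E" for y
    using WD(3)[OF that] h[OF that] B0 C b[OF that] unfolding norm_mult by (intro mult_mono) auto
  fix n x y assume xy: "1 \<le> n" "x \<in> E" "y \<in> E" "agree n x y"
  have "W x * of_real (h x) - W y * of_real (h y) = W x * of_real (h x - h y) + (W x - W y) * of_real (h y)"
    by (simp add: algebra_simps)
  then have "cmod (W x * of_real (h x) - W y * of_real (h y)) \<le> cmod (W x) * \<bar>h x - h y\<bar> + cmod (W x - W y) * \<bar>h y\<bar>"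
    by (metis norm_mult norm_of_real norm_triangle_ineq)
  also have "\<dots> \<le> b (x 0) * (B * \<theta> ^ n) + b (x 0) * \<theta> ^ n * C"
    using WD(3)[OF xy(2)] lip_boundD[OF B xy] WD(4)[OF xy] h[OF xy(3)] b[OF xy(2)] \<theta>_pos
    by (intro add_mono mult_mono) auto
  finally show "cmod (W x * of_real (h x) - W y * of_real (h y)) \<le> b (x 0) * (B + C) * \<theta> ^ n"
    by (simp add: algebra_simps)
qed

locale critical_family = potential_family +
  fixes a :: real
  assumes a_less: "a < t" and pressure_zero: "pressure E (\<lambda>x. \<eta> x + a * \<xi> x) = 0"
begin

sublocale sw: summable_weight I A E \<theta> "\<lambda>x. \<eta> x + a * \<xi> x" "H + \<bar>a\<bar> * X" b0
proof
  show "lip_bound (\<lambda>x. \<eta> x + a * \<xi> x) (H + \<bar>a\<bar> * X)"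
    unfolding lip_bound_def
  proof (intro allI ballI impI)
    fix n x y assume xy: "1 \<le> n" "x \<in> E" "y \<in> E" "agree n x y"
    have "(\<eta> x + a * \<xi> x) - (\<eta> y + a * \<xi> y) = (\<eta> x - \<eta> y) + a * (\<xi> x - \<xi> y)" by (simp add: algebra_simps)
    then have "norm ((\<eta> x + a * \<xi> x) - (\<eta> y + a * \<xi> y)) \<le> \<bar>\<eta> x - \<eta> y\<bar> + \<bar>a\<bar> * \<bar>\<xi> x - \<xi> y\<bar>"
      using abs_triangle_ineq[of "\<eta> x - \<eta> y" "a * (\<xi> x - \<xi> y)"] by (simp only: real_norm_def abs_mult)
    also have "\<dots> \<le> H * \<theta> ^ n + \<bar>a\<bar> * (X * \<theta> ^ n)"
      using lip_boundD[OF \<eta>_lip xy] lip_boundD[OF \<xi>_lip xy] by (intro add_mono mult_left_mono) auto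
    finally show "norm ((\<eta> x + a * \<xi> x) - (\<eta> y + a * \<xi> y)) \<le> (H + \<bar>a\<bar> * X) * \<theta> ^ n"
      by (simp add: algebra_simps)
  qed
  show "exp (\<eta> y + a * \<xi> y) \<le> b0 (y 0)" if "y \<in> E" for y
  proof -
    have "a * \<xi> y \<le> t * \<xi> y" using a_less \<xi>_nonneg[OF that] by (intro mult_right_mono) auto
    then have "exp (\<eta> y + a * \<xi> y) \<le> exp (\<eta> y + t * \<xi> y)" by simp
    then show ?thesis using b0_bound[OF that] by linarith
  qed
qed (fact b0_summable b0_nonneg)+

abbreviation u :: "(nat \<Rightarrow> nat) \<Rightarrow> real" where "u x \<equiv> \<eta> x + a * \<xi> x"

abbreviation L :: "complex \<Rightarrow> fun_op" where "L z \<equiv> weighted_op (weight z)"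

text \<open>A Lasota-Yorke inequality for \<open>g / h\<close>. Dividing by the positive supersolution \<open>h\<close> makes a
  single application of the operator contract the Lipschitz constant by a factor close to \<open>\<theta>\<close>.\<close>

lemma lasota_yorke:
  assumes C: "C \<ge> 1" "\<And>x. x \<in> E \<Longrightarrow> 1 / C \<le> h x \<and> h x \<le> C" and B: "lip_bound h B"
    and super: "\<And>x. x \<in> E \<Longrightarrow> (\<Sum>\<^sub>\<infinity>y\<in>preimages x. exp (u y) * h y) \<le> h x / r" and "r > 0"
    and \<rho>: "\<theta> / r \<le> \<rho>" "\<rho> < 1" and z: "Re z = a"
    and g: "g \<in> \<B>" and s: "0 \<le> s" "s \<le> 1" and m: "\<And>x. x \<in> E \<Longrightarrow> cmod (g x) \<le> m * h x"
    and \<beta>: "\<beta> = (\<Sum>\<^sub>\<infinity>e\<in>I. (1 + S z) * b0 e * (B + C))"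
  shows "lip_bound (\<lambda>x. g x / of_real (h x)) ((C * nrm (\<lambda>x. g x - of_real s * L z g x) + (C * \<beta> + B * C) * m) / (1 - \<rho>))"
proof -
  have hpos: "h x > 0" if "x \<in> E" for x using C(2)[OF that] C(1) by (smt (verit) divide_pos_pos)
  have hinv: "1 / h x \<le> C" if "x \<in> E" for x using C(2)[OF that] C(1) hpos[OF that] by (simp add: field_simps)
  have habs: "\<bar>h x\<bar> \<le> C" if "x \<in> E" for x using C(2)[OF that] hpos[OF that] by simp
  have B0: "B \<ge> 0" by (rule lip_bound_nonneg[OF B])
  have m0: "m \<ge> 0"
  proof -
    obtain x where x: "x \<in> E" using E_nonempty by blast
    have "0 \<le> m * h x" using m[OF x] norm_ge_zero order_trans by blast
    then show ?thesis using hpos[OF x] by (simp add: zero_le_mult_iff)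
  qed
  define k where "k x = (if x \<in> E then g x / of_real (h x) else 0)" for x
  have gk: "g x = of_real (h x) * k x" if "x \<in> E" for x using hpos[OF that] that by (simp add: k_def)
  have km: "cmod (k x) \<le> m" if "x \<in> E" for x
    using m[OF that] hpos[OF that] that by (simp add: k_def norm_divide field_simps)
  have kdiff: "cmod (k x - k x') \<le> cmod (g x - g x') / h x + B * C * m * \<theta> ^ n"
    if xx: "n \<ge> 1" "x \<in> E" "x' \<in> E" "agree n x x'" for n x x'
  proof -
    have "k x - k x' = (g x - g x') / of_real (h x) + k x' * of_real ((h x' - h x) / h x)"
      using hpos[OF xx(2)] hpos[OF xx(3)] by (simp add: gk[OF xx(2)] gk[OF xx(3)] field_simps)
    then have "cmod (k x - k x') \<le> cmod (g x - g x') / h x + cmod (k x') * (\<bar>h x' - h x\<bar> / h x)"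
      using norm_triangle_ineq[of "(g x - g x') / of_real (h x)" "k x' * of_real ((h x' - h x) / h x)"]
        hpos[OF xx(2)] by (simp add: norm_divide norm_mult del: of_real_divide of_real_diff)
    also have "cmod (k x') * (\<bar>h x' - h x\<bar> / h x) \<le> m * ((B * \<theta> ^ n) * C)"
    proof (intro mult_mono km xx)
      have "\<bar>h x' - h x\<bar> * (1 / h x) \<le> (B * \<theta> ^ n) * C"
        using lip_boundD[OF B xx(1,3,2) agree_sym[OF xx(4)]] hinv[OF xx(2)] hpos[OF xx(2)] B0 \<theta>_pos
        by (intro mult_mono) auto
      then show "\<bar>h x' - h x\<bar> / h x \<le> (B * \<theta> ^ n) * C" by simp
    qed (use m0 hpos[OF xx(2)] in auto)
    finally show ?thesis by (simp add: algebra_simps)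
  qed
  have "lip_bound k (C * nrm g + B * C * m)"
    unfolding lip_bound_def
  proof (intro allI ballI impI)
    fix n x x' assume xx: "1 \<le> n" "x \<in> E" "x' \<in> E" "agree n x x'"
    have "cmod (g x - g x') * (1 / h x) \<le> (nrm g * \<theta> ^ n) * C"
      using lip_boundD[OF lip_bound_nrm[OF g] xx] hinv[OF xx(2)] hpos[OF xx(2)] nrm_nonneg \<theta>_pos
      by (intro mult_mono) auto
    then show "cmod (k x - k x') \<le> (C * nrm g + B * C * m) * \<theta> ^ n"
      using kdiff[OF xx] by (simp add: algebra_simps)
  qed
  then have k\<B>: "k \<in> \<B>" by (intro \<B>I[of k m, OF km]) (auto simp: k_def)
  define \<Lambda> where "\<Lambda> = lip k"
  have \<Lambda>: "lip_bound k \<Lambda>" "\<Lambda> \<ge> 0" unfolding \<Lambda>_def using \<B>D[OF k\<B>] by auto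
  define V where "V y = weight z y * of_real (h y)" for y
  have W: "weight_bound (weight z) (\<lambda>e. (1 + S z) * b0 e)"
    using a_less z by (intro weight_weight_bound[of "t - a"]) auto
  have V: "weight_bound V (\<lambda>e. (1 + S z) * b0 e * (B + C))"
    unfolding V_def[abs_def] by (rule weight_bound_mult[OF W habs B])
  note VD = weight_boundD[OF V]
  have \<beta>0: "\<beta> \<ge> 0" unfolding \<beta> using VD(2) by (intro infsum_nonneg)
  define e where "e = (\<lambda>x. g x - of_real s * L z g x)"
  have Lin: "fs.bounded_lin (L z) (2 * (\<Sum>\<^sub>\<infinity>e\<in>I. (1 + S z) * b0 e))" by (rule weighted_op_bounded[OF W])
  have e\<B>: "e \<in> \<B>" unfolding e_def by (intro \<B>_diff \<B>_scale g fs.bounded_linD(1)[OF Lin])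
  have Lg: "L z g x = (\<Sum>\<^sub>\<infinity>y\<in>preimages x. V y * k y)" if "x \<in> E" for x
    using that unfolding weighted_op_def V_def
    by (auto intro!: infsum_cong simp: preimages_def gk algebra_simps)
  have cV: "cmod (V y) = exp (u y) * h y" if "y \<in> E" for y
    using hpos[OF that] z by (simp add: V_def norm_mult cmod_weight)
  have Ldiff: "cmod (L z g x - L z g x') \<le> (\<theta> / r * \<Lambda> * h x + \<beta> * m) * \<theta> ^ n"
    if xx: "n \<ge> 1" "x \<in> E" "x' \<in> E" "agree n x x'" for n x x'
  proof -
    have th: "\<theta> ^ n \<ge> 0" using \<theta>_pos by simp
    have "(\<Sum>\<^sub>\<infinity>y\<in>preimages x. cmod (V y)) = (\<Sum>\<^sub>\<infinity>y\<in>preimages x. exp (u y) * h y)"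
      by (intro infsum_cong cV preimagesD(1))
    then have "(\<Sum>\<^sub>\<infinity>y\<in>preimages x. cmod (V y)) \<le> h x / r" using super[OF xx(2)] by simp
    then have "((\<Sum>\<^sub>\<infinity>y\<in>preimages x. cmod (V y)) * \<Lambda> + \<beta> * m) * \<theta> \<le> (h x / r * \<Lambda> + \<beta> * m) * \<theta>"
      using \<Lambda>(2) \<theta>_pos by (intro mult_right_mono add_right_mono) auto
    also have "\<dots> \<le> \<theta> / r * \<Lambda> * h x + \<beta> * m"
      using mult_left_le[of \<theta> "\<beta> * m"] \<beta>0 m0 \<theta>_less by (simp add: algebra_simps)
    finally have "((\<Sum>\<^sub>\<infinity>y\<in>preimages x. cmod (V y)) * \<Lambda> + \<beta> * m) * \<theta> * \<theta> ^ n
        \<le> (\<theta> / r * \<Lambda> * h x + \<beta> * m) * \<theta> ^ n" using th by (rule mult_right_mono)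
    then show ?thesis
      using transfer_variation[OF V km \<Lambda>(1) xx] Lg[OF xx(2)] Lg[OF xx(3)] by (simp add: \<beta> mult.assoc)
  qed
  let ?c0 = "C * nrm e + (C * \<beta> + B * C) * m"
  have "lip_bound k (?c0 + \<rho> * \<Lambda>)"
    unfolding lip_bound_def
  proof (intro allI ballI impI)
    fix n x x' assume xx: "1 \<le> n" "x \<in> E" "x' \<in> E" "agree n x x'"
    have th: "\<theta> ^ n > 0" using \<theta>_pos by simp
    have "g x - g x' = (e x - e x') + of_real s * (L z g x - L z g x')" by (simp add: e_def algebra_simps)
    then have "cmod (g x - g x') \<le> cmod (e x - e x') + s * cmod (L z g x - L z g x')"
      using norm_triangle_ineq[of "e x - e x'" "of_real s * (L z g x - L z g x')"] s(1) by (simp add: norm_mult)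
    also have "s * cmod (L z g x - L z g x') \<le> 1 * cmod (L z g x - L z g x')"
      using s by (intro mult_right_mono) auto
    finally have "cmod (g x - g x') \<le> nrm e * \<theta> ^ n + (\<theta> / r * \<Lambda> * h x + \<beta> * m) * \<theta> ^ n"
      using lip_boundD[OF lip_bound_nrm[OF e\<B>] xx] Ldiff[OF xx] by simp
    then have "cmod (g x - g x') / h x \<le> (nrm e * \<theta> ^ n + (\<theta> / r * \<Lambda> * h x + \<beta> * m) * \<theta> ^ n) / h x"
      using hpos[OF xx(2)] by (intro divide_right_mono) auto
    also have "\<dots> = (1 / h x) * ((nrm e + \<beta> * m) * \<theta> ^ n) + \<theta> / r * \<Lambda> * \<theta> ^ n"
      using hpos[OF xx(2)] by (simp add: field_simps)
    also have "\<dots> \<le> C * ((nrm e + \<beta> * m) * \<theta> ^ n) + \<rho> * \<Lambda> * \<theta> ^ n"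
      using hinv[OF xx(2)] nrm_nonneg[of e] \<beta>0 m0 th \<rho>(1) \<Lambda>(2)
      by (intro add_mono mult_right_mono) auto
    finally show "cmod (k x - k x') \<le> (?c0 + \<rho> * \<Lambda>) * \<theta> ^ n"
      using kdiff[OF xx] by (simp add: algebra_simps)
  qed
  then have "\<Lambda> \<le> ?c0 + \<rho> * \<Lambda>" unfolding \<Lambda>_def by (rule lip_le)
  then have "\<Lambda> \<le> ?c0 / (1 - \<rho>)" using \<rho>(2) by (simp add: field_simps)
  then have "cmod (k x - k x') \<le> ?c0 / (1 - \<rho>) * \<theta> ^ n"
    if "n \<ge> 1" "x \<in> E" "x' \<in> E" "agree n x x'" for n x x'
    using lip_boundD[OF \<Lambda>(1) that] \<theta>_pos by (meson mult_right_mono order_trans zero_le_power less_imp_le)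
  then show ?thesis unfolding lip_bound_def e_def by (auto simp: k_def)
qed

text \<open>\<open>g = h k\<close> is an approximate fixed point of \<open>s L\<^sub>z\<close>, measured against the positive \<open>h\<close>, which is
  an approximate supersolution for the operator with the real potential \<open>u\<close>.\<close>

definition approx_eigenfunction ::
  "complex \<Rightarrow> real \<Rightarrow> real \<Rightarrow> ((nat \<Rightarrow> nat) \<Rightarrow> real) \<Rightarrow> real \<Rightarrow> ((nat \<Rightarrow> nat) \<Rightarrow> complex) \<Rightarrow> bool" where
  "approx_eigenfunction z C \<epsilon> h s k \<longleftrightarrow> 0 \<le> s \<and> s \<le> 1 \<and> (\<forall>x\<in>E. 1 / C \<le> h x \<and> h x \<le> C \<and>
     (\<Sum>\<^sub>\<infinity>y\<in>preimages x. exp (u y) * h y) \<le> (1 + \<epsilon>) * h x \<and> cmod (k x) \<le> 1 \<and>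
     cmod (of_real (h x) * k x - of_real s * (\<Sum>\<^sub>\<infinity>y\<in>preimages x. weight z y * of_real (h y) * k y)) \<le> \<epsilon>)"

text \<open>If \<open>k = g / h\<close> is bounded by 1 and \<open>s L\<^sub>z g\<close> is close to \<open>g\<close>, then the average of the
  nonnegative numbers \<open>1 - s Re (c exp (\<i> Im z \<xi>) k)\<close> over the inverse branches at \<open>x\<close> is at most
  about \<open>1 - Re (c k x)\<close>. So each of them is small where \<open>c k x\<close> is near 1.\<close>

lemma branch_alignment:
  assumes C1: "C \<ge> 1" and z: "Re z = a" and \<epsilon>: "\<epsilon> \<ge> 0" and ae: "approx_eigenfunction z C \<epsilon> h s k"
    and y: "y \<in> E" and c: "cmod c = 1"
  shows "1 - s * Re (c * (cis (Im z * \<xi> y) * k y)) \<le> C\<^sup>2 * exp (- u y) * (1 - Re (c * k (shift y)) + 2 * \<epsilon>)"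
proof -
  have s: "0 \<le> s" "s \<le> 1" using ae by (auto simp: approx_eigenfunction_def)
  have C: "C \<ge> 1" "\<And>x. x \<in> E \<Longrightarrow> 1 / C \<le> h x \<and> h x \<le> C"
    and super: "\<And>x. x \<in> E \<Longrightarrow> (\<Sum>\<^sub>\<infinity>y\<in>preimages x. exp (u y) * h y) \<le> (1 + \<epsilon>) * h x"
    and k: "\<And>x. x \<in> E \<Longrightarrow> cmod (k x) \<le> 1"
    and err: "\<And>x. x \<in> E \<Longrightarrow> cmod (of_real (h x) * k x
        - of_real s * (\<Sum>\<^sub>\<infinity>y\<in>preimages x. weight z y * of_real (h y) * k y)) \<le> \<epsilon>"
    using C1 ae unfolding approx_eigenfunction_def by auto
  define x where "x = shift y"
  have x: "x \<in> E" "y \<in> preimages x" using y shift_mem by (auto simp: x_def preimages_def)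
  have hpos: "h x > 0" if "x \<in> E" for x using C(2)[OF that] C(1) by (smt (verit) divide_pos_pos)
  define q where "q y = Re (c * (cis (Im z * \<xi> y) * k y))" for y
  have q: "\<bar>q y\<bar> \<le> 1" if "y \<in> E" for y
  proof -
    have "\<bar>q y\<bar> \<le> cmod (c * (cis (Im z * \<xi> y) * k y))" unfolding q_def by (rule abs_Re_le_cmod)
    also have "\<dots> \<le> 1" using c k[OF that] by (simp add: norm_mult)
    finally show ?thesis .
  qed
  have sq: "s * q y \<le> 1" if "y \<in> E" for y
    using q[OF that] s mult_mono[of s 1 "q y" 1] mult_nonneg_nonpos[of s "q y"] by (cases "q y \<ge> 0") auto
  have wq: "Re (c * (weight z y * of_real (h y) * k y)) = exp (u y) * h y * q y" for y
  proof -
    have "weight z y = of_real (exp (u y)) * cis (Im z * \<xi> y)"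
      unfolding weight_def cis_conv_exp using z
      by (simp add: complex_eq_iff Re_exp Im_exp exp_of_real[symmetric] del: exp_of_real flip: exp_add)
    then have "c * (weight z y * of_real (h y) * k y) = (exp (u y) * h y) *\<^sub>R (c * (cis (Im z * \<xi> y) * k y))"
      by (simp add: scaleR_conv_of_real)
    then show ?thesis unfolding q_def by (simp only: scaleR_complex.sel)
  qed
  have hs: "(\<lambda>y. exp (u y) * h y) summable_on preimages x"
    using C hpos by (intro sw.real_summable_preimages(1)[of x h C]) (auto simp: preimages_def less_imp_le)
  have W: "weight_bound (weight z) (\<lambda>e. (1 + S z) * b0 e)"
    using a_less z by (intro weight_weight_bound[of "t - a"]) auto
  have ks: "(\<lambda>y. weight z y * of_real (h y) * k y) summable_on preimages x"
  proof -
    have "(\<lambda>y. weight z y * (of_real (h y) * k y)) summable_on preimages x"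
    proof (rule weighted_summable(1)[OF W])
      show "cmod (of_real (h y) * k y) \<le> C * 1" if "y \<in> E" for y
        unfolding norm_mult using C(2)[OF that] hpos[OF that] k[OF that] by (intro mult_mono) auto
    qed
    then show ?thesis by (simp add: mult.assoc)
  qed
  define \<Sigma> where "\<Sigma> = (\<Sum>\<^sub>\<infinity>y\<in>preimages x. weight z y * of_real (h y) * k y)"
  have "((\<lambda>y. Re (c * (weight z y * of_real (h y) * k y))) has_sum Re (c * \<Sigma>)) (preimages x)"
    unfolding \<Sigma>_def by (intro has_sum_Re has_sum_cmult_right has_sum_infsum ks)
  then have qs: "((\<lambda>y. exp (u y) * h y * q y) has_sum Re (c * \<Sigma>)) (preimages x)" by (simp only: wq)
  have "((\<lambda>y. exp (u y) * h y + (- s) * (exp (u y) * h y * q y)) has_sum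
      ((\<Sum>\<^sub>\<infinity>y\<in>preimages x. exp (u y) * h y) + (- s) * Re (c * \<Sigma>))) (preimages x)"
    by (intro has_sum_add has_sum_cmult_right has_sum_infsum hs qs)
  then have fs: "((\<lambda>y. exp (u y) * h y * (1 - s * q y)) has_sum
      ((\<Sum>\<^sub>\<infinity>y\<in>preimages x. exp (u y) * h y) - s * Re (c * \<Sigma>))) (preimages x)"
    by (simp add: algebra_simps)
  have "sum (\<lambda>y. exp (u y) * h y * (1 - s * q y)) {y} \<le> (\<Sum>\<^sub>\<infinity>y\<in>preimages x. exp (u y) * h y) - s * Re (c * \<Sigma>)"
  proof (rule finite_sum_le_has_sum[OF fs])
    fix w assume "w \<in> preimages x - {y}"
    then have "w \<in> E" by (auto simp: preimages_def)
    then show "0 \<le> exp (u w) * h w * (1 - s * q w)" using sq[of w] hpos[of w] by simp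
  qed (use x in auto)
  then have le1: "exp (u y) * h y * (1 - s * q y) \<le> (1 + \<epsilon>) * h x - s * Re (c * \<Sigma>)"
    using super[OF x(1)] by simp
  have "\<bar>Re (c * (of_real (h x) * k x - of_real s * \<Sigma>))\<bar> \<le> cmod (c * (of_real (h x) * k x - of_real s * \<Sigma>))"
    by (rule abs_Re_le_cmod)
  also have "\<dots> \<le> \<epsilon>" using err[OF x(1)] c by (simp add: norm_mult \<Sigma>_def)
  finally have le2: "\<bar>h x * Re (c * k x) - s * Re (c * \<Sigma>)\<bar> \<le> \<epsilon>"
  proof -
    have "c * (of_real (h x) * k x - of_real s * \<Sigma>) = of_real (h x) * (c * k x) - of_real s * (c * \<Sigma>)"
      by (simp add: algebra_simps)
    then have "Re (c * (of_real (h x) * k x - of_real s * \<Sigma>)) = h x * Re (c * k x) - s * Re (c * \<Sigma>)"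
      by (simp only: minus_complex.sel Re_complex_of_real times_complex.sel Im_complex_of_real)
    then show "\<bar>Re (c * (of_real (h x) * k x - of_real s * \<Sigma>))\<bar> \<le> \<epsilon> \<Longrightarrow> ?thesis" by simp
  qed
  have Rec: "Re (c * k x) \<le> 1"
    using complex_Re_le_cmod[of "c * k x"] c k[OF x(1)] by (simp add: norm_mult)
  have "exp (u y) * h y * (1 - s * q y) \<le> h x * (1 - Re (c * k x) + \<epsilon>) + \<epsilon>"
    using le1 le2 by (simp add: algebra_simps)
  also have "\<dots> \<le> C * (1 - Re (c * k x) + \<epsilon>) + C * \<epsilon>"
    using C(2)[OF x(1)] \<epsilon> Rec mult_right_mono[OF C(1) \<epsilon>] by (intro add_mono mult_right_mono) auto
  finally have "exp (u y) * h y * (1 - s * q y) \<le> C * (1 - Re (c * k x) + 2 * \<epsilon>)" by (simp add: algebra_simps)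
  then have "(C * exp (- u y)) * (exp (u y) * h y * (1 - s * q y)) \<le> (C * exp (- u y)) * (C * (1 - Re (c * k x) + 2 * \<epsilon>))"
    using C(1) by (intro mult_left_mono) auto
  moreover have "(C * exp (- u y)) * (exp (u y) * h y * (1 - s * q y)) = C * h y * (1 - s * q y)"
    using exp_add[of "- u y" "u y"] by (simp add: algebra_simps)
  moreover have "1 * (1 - s * q y) \<le> C * h y * (1 - s * q y)"
    using C(2)[OF y] C(1) sq[OF y] by (intro mult_right_mono) (auto simp: field_simps)
  ultimately show ?thesis unfolding q_def x_def by (simp add: power2_eq_square algebra_simps)
qed

text \<open>By the Lasota-Yorke inequality the norm of a function that is nearly fixed by \<open>s L\<^sub>z\<close> is comparable
  to \<open>m = sup \<bar>g\<bar> / h\<close>. Normalization by \<open>m\<close> therefore keeps the Lipschitz constants bounded and the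
  supremum equal to 1.\<close>

lemma normalized_approximate_eigenfunctions:
  assumes z: "Re z = a"
    and not_below: "\<not> (\<exists>c>0. \<forall>s\<in>{0..1}. \<forall>g\<in>\<B>. nrm g \<le> c * nrm (\<lambda>x. g x - of_real s * L z g x))"
  obtains C M where "C \<ge> 1" "\<And>\<epsilon>. \<epsilon> > 0 \<Longrightarrow>
    \<exists>h s k. approx_eigenfunction z C \<epsilon> h s k \<and> lip_bound k M \<and> (\<exists>x\<in>E. cmod (k x) \<ge> 1 - \<epsilon>)"
proof -
  obtain C B where CB: "C \<ge> 1" "B \<ge> 0" "\<And>r. 1/2 \<le> r \<Longrightarrow> r < 1 \<Longrightarrow> \<exists>h. (\<forall>x\<in>E. 1 / C \<le> h x \<and> h x \<le> C) \<and>
      lip_bound h B \<and> (\<forall>x\<in>E. (\<Sum>\<^sub>\<infinity>y\<in>preimages x. exp (u y) * h y) \<le> h x / r)"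
    using sw.approximate_eigenfunctions[OF pressure_zero] by blast
  define \<rho> where "\<rho> = (1 + \<theta>) / 2"
  have \<rho>: "\<theta> < \<rho>" "0 < \<rho>" "\<rho> < 1" using \<theta>_pos \<theta>_less by (auto simp: \<rho>_def)
  define \<beta> where "\<beta> = (\<Sum>\<^sub>\<infinity>e\<in>I. (1 + S z) * b0 e * (B + C))"
  have \<beta>0: "\<beta> \<ge> 0" unfolding \<beta>_def using S_nonneg[of z] CB by (intro infsum_nonneg) (auto simp: b0_nonneg)
  define M where "M = (C + C * \<beta> + B * C) / (1 - \<rho>)"
  define c1 where "c1 = C + B + C * ((C * \<beta> + B * C) / (1 - \<rho>))"
  define c2 where "c2 = C * (C / (1 - \<rho>))"
  have c12: "c1 > 0" "c2 > 0" using CB \<beta>0 \<rho> unfolding c1_def c2_def by (auto intro!: add_pos_nonneg)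
  show thesis
  proof (rule that[of C M, OF CB(1)])
    fix \<epsilon> :: real assume \<epsilon>: "\<epsilon> > 0"
    \<comment> \<open>so close to 1 that the Lipschitz contraction survives and \<open>1 / r \<le> 1 + \<epsilon>\<close>\<close>
    define r where "r = Max {1/2, \<theta> / \<rho>, 1 / (1 + \<epsilon>)}"
    have r: "1/2 \<le> r" "r < 1" "\<theta> / \<rho> \<le> r" "1 / (1 + \<epsilon>) \<le> r"
      unfolding r_def using \<rho> \<epsilon> by (auto simp: Max_ge_iff)
    have r0: "r > 0" using r by simp
    have \<theta>r: "\<theta> / r \<le> \<rho>" using r(3) r0 \<rho>(2) by (simp add: field_simps)
    obtain h where h: "\<And>x. x \<in> E \<Longrightarrow> 1 / C \<le> h x \<and> h x \<le> C" "lip_bound h B"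
      "\<And>x. x \<in> E \<Longrightarrow> (\<Sum>\<^sub>\<infinity>y\<in>preimages x. exp (u y) * h y) \<le> h x / r"
      using CB(3)[OF r(1,2)] by blast
    have hpos: "h x > 0" if "x \<in> E" for x using h(1)[OF that] CB(1) by (smt (verit) divide_pos_pos)
    define \<epsilon>' where "\<epsilon>' = min \<epsilon> 1"
    have \<epsilon>': "0 < \<epsilon>'" "\<epsilon>' \<le> \<epsilon>" "\<epsilon>' \<le> 1" using \<epsilon> by (auto simp: \<epsilon>'_def)
    define c where "c = max (2 * c2) (2 * c1 / \<epsilon>')"
    have "c > 0" using c12 by (simp add: c_def less_max_iff_disj)
    then obtain s g where sg: "0 \<le> s" "s \<le> 1" "g \<in> \<B>"
      "c * nrm (\<lambda>x. g x - of_real s * L z g x) < nrm g"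
      using not_below by (meson atLeastAtMost_iff not_le)
    define e where "e = (\<lambda>x. g x - of_real s * L z g x)"
    have W: "weight_bound (weight z) (\<lambda>e. (1 + S z) * b0 e)"
      using a_less z by (intro weight_weight_bound[of "t - a"]) auto
    have e\<B>: "e \<in> \<B>"
      unfolding e_def by (intro \<B>_diff \<B>_scale sg fs.bounded_linD(1)[OF weighted_op_bounded[OF W]])
    have e_small: "c2 * nrm e \<le> nrm g / 2" "2 * c1 * nrm e \<le> \<epsilon>' * nrm g"
    proof -
      have "2 * c2 * nrm e \<le> c * nrm e" by (intro mult_right_mono nrm_nonneg) (simp add: c_def)
      then show "c2 * nrm e \<le> nrm g / 2" using sg(4) by (simp add: e_def)
      have "2 * c1 / \<epsilon>' * nrm e \<le> c * nrm e" by (intro mult_right_mono nrm_nonneg) (simp add: c_def)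
      then have "2 * c1 / \<epsilon>' * nrm e \<le> nrm g" using sg(4) by (simp add: e_def)
      then show "2 * c1 * nrm e \<le> \<epsilon>' * nrm g" using \<epsilon>'(1) by (simp add: field_simps)
    qed
    have g0: "nrm g > 0" using sg(4) \<open>c > 0\<close> nrm_nonneg[of e] unfolding e_def[symmetric]
      by (meson le_less_trans less_imp_le mult_nonneg_nonneg)
    define m where "m = (SUP x\<in>E. cmod (g x) / h x)"
    have bdd: "bdd_above ((\<lambda>x. cmod (g x) / h x) ` E)"
    proof (rule bdd_aboveI2)
      fix x assume x: "x \<in> E"
      have "1 / h x \<le> C" using h(1)[OF x] hpos[OF x] CB(1) by (simp add: field_simps)
      then have "cmod (g x) * (1 / h x) \<le> nrm g * C"
        using norm_le_nrm[OF sg(3) x] hpos[OF x] nrm_nonneg by (intro mult_mono) auto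
      then show "cmod (g x) / h x \<le> nrm g * C" by simp
    qed
    have gm: "cmod (g x) \<le> m * h x" if "x \<in> E" for x
    proof -
      have "cmod (g x) / h x \<le> m" unfolding m_def using that bdd by (rule cSUP_upper)
      then show ?thesis using hpos[OF that] by (simp add: field_simps)
    qed
    have m0: "m \<ge> 0"
    proof -
      obtain x where x: "x \<in> E" using E_nonempty by blast
      have "0 \<le> m * h x" using gm[OF x] norm_ge_zero order_trans by blast
      then show ?thesis using hpos[OF x] by (simp add: zero_le_mult_iff)
    qed
    define \<Lambda> where "\<Lambda> = (C * nrm e + (C * \<beta> + B * C) * m) / (1 - \<rho>)"
    have k0: "lip_bound (\<lambda>x. g x / of_real (h x)) \<Lambda>"
      unfolding \<Lambda>_def e_def
      by (rule lasota_yorke[OF CB(1) h r0 \<theta>r \<rho>(3) z sg(3,1,2) gm \<beta>_def])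
    have "nrm g \<le> C * m + (C * \<Lambda> + B * m)"
    proof (rule nrm_le_add(2))
      show "cmod (g x) \<le> C * m" if "x \<in> E" for x
        using gm[OF that] h(1)[OF that] m0 mult_left_mono[of "h x" C m] by (simp add: mult.commute)
      show "lip_bound g (C * \<Lambda> + B * m)"
        unfolding lip_bound_def
      proof (intro allI ballI impI)
        fix n x y assume xy: "1 \<le> n" "x \<in> E" "y \<in> E" "agree n x y"
        let ?k = "\<lambda>x. g x / of_real (h x)"
        have ky: "cmod (?k y) \<le> m" using gm[OF xy(3)] hpos[OF xy(3)] by (simp add: norm_divide field_simps)
        have "g x - g y = of_real (h x) * (?k x - ?k y) + of_real (h x - h y) * ?k y"
          using hpos[OF xy(2)] hpos[OF xy(3)] by (simp add: field_simps)
        then have "cmod (g x - g y) \<le> \<bar>h x\<bar> * cmod (?k x - ?k y) + \<bar>h x - h y\<bar> * cmod (?k y)"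
          by (metis norm_mult norm_of_real norm_triangle_ineq)
        also have "\<dots> \<le> C * (\<Lambda> * \<theta> ^ n) + (B * \<theta> ^ n) * m"
          using lip_boundD[OF k0 xy] lip_boundD[OF h(2) xy] ky h(1)[OF xy(2)] hpos[OF xy(2)] CB \<theta>_pos
          by (intro add_mono mult_mono) auto
        finally show "cmod (g x - g y) \<le> (C * \<Lambda> + B * m) * \<theta> ^ n" by (simp add: algebra_simps)
      qed
    qed (use \<B>D(5)[OF sg(3)] in auto)
    also have "\<dots> = c1 * m + c2 * nrm e"
      by (simp add: c1_def c2_def \<Lambda>_def add_divide_distrib algebra_simps)
    finally have gm2: "nrm g \<le> 2 * c1 * m" using e_small(1) by simp
    then have mpos: "m > 0" using g0 c12 m0 by (metis less_eq_real_def mult_zero_right not_le)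
    have em: "nrm e \<le> \<epsilon>' * m"
    proof -
      have "2 * c1 * nrm e \<le> \<epsilon>' * (2 * c1 * m)" using e_small(2) mult_left_mono[OF gm2, of \<epsilon>'] \<epsilon>'(1) by linarith
      then have "(2 * c1) * nrm e \<le> (2 * c1) * (\<epsilon>' * m)" by (simp add: algebra_simps)
      then show ?thesis using c12(1) by (simp add: mult_le_cancel_left)
    qed
    define k where "k x = g x / of_real (h x) / of_real m" for x
    have hk: "of_real (h x) * k x = g x / of_real m" if "x \<in> E" for x
      using hpos[OF that] by (simp add: k_def)
    have knorm: "cmod (k x) = (cmod (g x) / h x) / m" if "x \<in> E" for x
      unfolding k_def norm_divide norm_of_real using hpos[OF that] mpos by simp
    have "\<forall>x\<in>E. cmod (k x) \<le> 1"
    proof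
      fix x assume x: "x \<in> E"
      have "cmod (g x) / h x \<le> m" using gm[OF x] hpos[OF x] by (simp add: field_simps)
      then show "cmod (k x) \<le> 1" unfolding knorm[OF x] using mpos by (subst divide_le_eq_1_pos)
    qed
    moreover have "lip_bound k M"
      unfolding lip_bound_def
    proof (intro allI ballI impI)
      fix n x y assume xy: "1 \<le> n" "x \<in> E" "y \<in> E" "agree n x y"
      have "cmod (k x - k y) = cmod (g x / of_real (h x) - g y / of_real (h y)) / m"
        unfolding k_def diff_divide_distrib[symmetric] norm_divide using mpos by simp
      also have "\<dots> \<le> (\<Lambda> * \<theta> ^ n) / m" using lip_boundD[OF k0 xy] mpos by (intro divide_right_mono) auto
      also have "\<dots> = (\<Lambda> / m) * \<theta> ^ n" by simp
      also have "\<Lambda> \<le> M * m"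
      proof -
        have "nrm e \<le> 1 * m" using em \<epsilon>'(3) m0 by (meson mult_right_mono order_trans)
        then have "C * nrm e + (C * \<beta> + B * C) * m \<le> C * m + (C * \<beta> + B * C) * m"
          using CB(1) by simp
        then show ?thesis unfolding \<Lambda>_def M_def using \<rho>(3) by (simp add: divide_right_mono algebra_simps)
      qed
      then have "(\<Lambda> / m) * \<theta> ^ n \<le> M * \<theta> ^ n"
        using mpos \<theta>_pos by (intro mult_right_mono) (auto simp: field_simps)
      finally show "cmod (k x - k y) \<le> M * \<theta> ^ n" .
    qed
    moreover have "\<exists>x\<in>E. cmod (k x) \<ge> 1 - \<epsilon>"
    proof -
      have "m * (1 - \<epsilon>) < m" using mpos \<epsilon> by simp
      then obtain x where x: "x \<in> E" "m * (1 - \<epsilon>) < cmod (g x) / h x"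
        unfolding m_def using less_cSUP_iff[OF E_nonempty bdd] by auto
      have "(1 - \<epsilon>) * m \<le> cmod (g x) / h x" using x(2) by (simp add: mult.commute)
      then have "cmod (k x) \<ge> 1 - \<epsilon>" unfolding knorm[OF x(1)] using mpos by (subst pos_le_divide_eq)
      then show ?thesis using x(1) by blast
    qed
    moreover have "\<forall>x\<in>E. cmod (of_real (h x) * k x
        - of_real s * (\<Sum>\<^sub>\<infinity>y\<in>preimages x. weight z y * of_real (h y) * k y)) \<le> \<epsilon>"
    proof
      fix x assume x: "x \<in> E"
      have "(\<Sum>\<^sub>\<infinity>y\<in>preimages x. weight z y * of_real (h y) * k y) = (\<Sum>\<^sub>\<infinity>y\<in>preimages x. weight z y * g y * (1 / of_real m))"
        by (intro infsum_cong) (auto simp: preimages_def mult.assoc hk)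
      also have "\<dots> = L z g x / of_real m"
        using x by (simp add: weighted_op_def infsum_cmult_left' divide_inverse)
      finally have "of_real (h x) * k x - of_real s * (\<Sum>\<^sub>\<infinity>y\<in>preimages x. weight z y * of_real (h y) * k y) = e x / of_real m"
        by (simp add: hk[OF x] e_def diff_divide_distrib)
      moreover have "cmod (e x / of_real m) \<le> \<epsilon>'"
        using norm_le_nrm[OF e\<B> x] em mpos by (simp add: norm_divide field_simps)
      ultimately show "cmod (of_real (h x) * k x
        - of_real s * (\<Sum>\<^sub>\<infinity>y\<in>preimages x. weight z y * of_real (h y) * k y)) \<le> \<epsilon>" using \<epsilon>'(2) by simp
    qed
    moreover have "\<forall>x\<in>E. (\<Sum>\<^sub>\<infinity>y\<in>preimages x. exp (u y) * h y) \<le> (1 + \<epsilon>) * h x"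
    proof
      fix x assume x: "x \<in> E"
      have "1 / r \<le> 1 + \<epsilon>" using r(4) r0 \<epsilon> by (simp add: field_simps)
      then have "1 / r * h x \<le> (1 + \<epsilon>) * h x" using hpos[OF x] by (intro mult_right_mono) auto
      then show "(\<Sum>\<^sub>\<infinity>y\<in>preimages x. exp (u y) * h y) \<le> (1 + \<epsilon>) * h x" using h(3)[OF x] by simp
    qed
    ultimately show "\<exists>h s k. approx_eigenfunction z C \<epsilon> h s k \<and> lip_bound k M \<and> (\<exists>x\<in>E. cmod (k x) \<ge> 1 - \<epsilon>)"
      unfolding approx_eigenfunction_def using h(1) sg(1,2) by blast
  qed
qed

end

lemma cnj_sgn_mult: "cnj (sgn v) * v = of_real (cmod v)"
proof (cases "v = 0")
  case False
  have "cnj (sgn v) * v = (v * cnj v) / of_real (cmod v)" by (simp add: sgn_eq)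
  also have "\<dots> = of_real (cmod v)"
    using False complex_norm_square[of v, symmetric] by (simp add: power2_eq_square)
  finally show ?thesis .
qed simp

text \<open>An eigenfunction of modulus 1 of the twisted composition operator; written multiplicatively, a
  cohomology between \<open>b \<xi>\<close> and a function with values in \<open>2\<pi>\<int>\<close>.\<close>

definition (in markov_shift) phase_eigenfunction ::
  "((nat \<Rightarrow> nat) \<Rightarrow> real) \<Rightarrow> real \<Rightarrow> ((nat \<Rightarrow> nat) \<Rightarrow> complex) \<Rightarrow> bool" where
  "phase_eigenfunction \<xi> b \<phi> \<longleftrightarrow> (\<exists>M. lip_bound \<phi> M) \<and> (\<forall>x\<in>E. cmod (\<phi> x) = 1) \<and>
     (\<forall>y\<in>E. cis (b * \<xi> y) * \<phi> y = \<phi> (shift y))"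

context critical_family
begin

text \<open>If \<open>Id - s L\<^sub>z\<close> is not bounded below uniformly in \<open>0 \<le> s \<le> 1\<close>, the normalized approximate
  eigenfunctions accumulate at some \<open>\<phi>\<close>. Points where an approximate eigenfunction is nearly
  maximal have nearly maximal preimages; since the preimages along connecting paths meet every
  cylinder, \<open>\<phi>\<close> has modulus 1 everywhere. The triangle inequality for the sum over inverse
  branches is then an equality, which aligns the phases.\<close>

lemma unimodular_eigenfunction:
  assumes z: "Re z = a"
    and not_below: "\<not> (\<exists>c>0. \<forall>s\<in>{0..1}. \<forall>g\<in>\<B>. nrm g \<le> c * nrm (\<lambda>x. g x - of_real s * L z g x))"
  obtains \<phi> where "phase_eigenfunction \<xi> (Im z) \<phi>"
proof -
  obtain C M where C: "C \<ge> 1" and ex: "\<And>\<epsilon>. \<epsilon> > 0 \<Longrightarrow>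
      \<exists>h s k. approx_eigenfunction z C \<epsilon> h s k \<and> lip_bound k M \<and> (\<exists>x\<in>E. cmod (k x) \<ge> 1 - \<epsilon>)"
    by (rule normalized_approximate_eigenfunctions[OF z not_below]) blast
  define \<epsilon> where "\<epsilon> n = 1 / real (Suc n)" for n
  have \<epsilon>: "\<epsilon> n > 0" for n by (simp add: \<epsilon>_def)
  have "\<forall>n. \<exists>s k x. 0 \<le> s \<and> s \<le> 1 \<and> (\<forall>x\<in>E. cmod (k x) \<le> 1) \<and> lip_bound k M \<and> x \<in> E \<and> cmod (k x) \<ge> 1 - \<epsilon> n \<and>
      (\<forall>y\<in>E. \<forall>c. cmod c = 1 \<longrightarrow> 1 - s * Re (c * (cis (Im z * \<xi> y) * k y))
         \<le> C\<^sup>2 * exp (- u y) * (1 - Re (c * k (shift y)) + 2 * \<epsilon> n))"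
  proof
    fix n
    obtain h s k where hsk: "approx_eigenfunction z C (\<epsilon> n) h s k" "lip_bound k M" "\<exists>x\<in>E. cmod (k x) \<ge> 1 - \<epsilon> n"
      using ex[OF \<epsilon>[of n]] by blast
    note al = branch_alignment[OF C z less_imp_le[OF \<epsilon>] hsk(1)]
    have "0 \<le> s" "s \<le> 1" "\<forall>x\<in>E. cmod (k x) \<le> 1" using hsk(1) by (auto simp: approx_eigenfunction_def)
    then show "\<exists>s k x. 0 \<le> s \<and> s \<le> 1 \<and> (\<forall>x\<in>E. cmod (k x) \<le> 1) \<and> lip_bound k M \<and> x \<in> E \<and> cmod (k x) \<ge> 1 - \<epsilon> n \<and>
      (\<forall>y\<in>E. \<forall>c. cmod c = 1 \<longrightarrow> 1 - s * Re (c * (cis (Im z * \<xi> y) * k y))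
         \<le> C\<^sup>2 * exp (- u y) * (1 - Re (c * k (shift y)) + 2 * \<epsilon> n))"
      using hsk(2,3) al by blast
  qed
  then obtain s k x where s: "\<And>n. 0 \<le> s n" "\<And>n. s n \<le> 1" and k: "\<And>n x. x \<in> E \<Longrightarrow> cmod (k n x) \<le> 1"
    and klip: "\<And>n. lip_bound (k n) M" and x: "\<And>n. x n \<in> E" "\<And>n. cmod (k n (x n)) \<ge> 1 - \<epsilon> n"
    and align: "\<And>n y c. y \<in> E \<Longrightarrow> cmod c = 1 \<Longrightarrow> 1 - s n * Re (c * (cis (Im z * \<xi> y) * k n y))
         \<le> C\<^sup>2 * exp (- u y) * (1 - Re (c * k n (shift y)) + 2 * \<epsilon> n)"
    by metis
  obtain F \<phi> where F: "F \<noteq> bot" "F \<le> sequentially"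
    and lim0: "\<And>x. ((\<lambda>n. if x \<in> E then k n x else 0) \<longlongrightarrow> \<phi> x) F"
    by (rule bounded_functions_cluster[of "\<lambda>n x. if x \<in> E then k n x else 0"]) (auto simp: k)
  have lim: "((\<lambda>n. k n x) \<longlongrightarrow> \<phi> x) F" if "x \<in> E" for x using lim0[of x] that by simp
  have "\<epsilon> \<longlonglongrightarrow> 0" unfolding \<epsilon>_def[abs_def] by (rule LIMSEQ_Suc[OF lim_1_over_n])
  then have \<epsilon>0: "(\<epsilon> \<longlongrightarrow> 0) F" using F(2) by (rule tendsto_mono[rotated])
  have \<phi>lip: "lip_bound \<phi> M"
    unfolding lip_bound_def
  proof (intro allI ballI impI)
    fix n x y assume xy: "1 \<le> n" "x \<in> E" "y \<in> E" "agree n x y"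
    show "cmod (\<phi> x - \<phi> y) \<le> M * \<theta> ^ n"
      by (rule tendsto_upperbound[OF tendsto_norm[OF tendsto_diff[OF lim lim]] _ F(1)])
        (use xy lip_boundD[OF klip xy] in auto)
  qed
  have \<phi>le: "cmod (\<phi> x) \<le> 1" if "x \<in> E" for x
    by (rule tendsto_upperbound[OF tendsto_norm[OF lim[OF that]] _ F(1)]) (use k[OF that] in auto)
  obtain F0 J where FJ: "finite F0" "\<And>N z x. z \<in> E \<Longrightarrow> x \<in> E \<Longrightarrow>
    \<exists>y\<in>E. \<exists>j\<le>N + J. N < j \<and> agree (Suc N) y z \<and> (\<forall>i. N < i \<and> i < j \<longrightarrow> y i \<in> F0) \<and> (shift ^^ j) y = x"
    by (rule joining) blast
  have big: "1 - M * \<theta> ^ Suc N \<le> cmod (\<phi> v)" if v: "v \<in> E" for v N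
  proof -
    define Fv where "Fv = F0 \<union> v ` {..N}"
    have fin: "finite Fv" using FJ(1) by (simp add: Fv_def)
    obtain Q where "\<forall>w\<in>E. w 0 \<in> Fv \<longrightarrow> exp (- u w) \<le> Q"
      using sw.exp_minus_u_bounded[OF fin] by (rule exE)
    then have Q: "\<And>w. w \<in> E \<Longrightarrow> w 0 \<in> Fv \<Longrightarrow> exp (- u w) \<le> Q" by blast
    define \<kappa> where "\<kappa> = C\<^sup>2 * \<bar>Q\<bar> + 1"
    have \<kappa>: "\<kappa> \<ge> 1" by (simp add: \<kappa>_def)
    define \<mu> where "\<mu> n w = 1 - cmod (k n w) + 2 * \<epsilon> n" for n w
    have \<mu>0: "\<mu> n w \<ge> 0" if "w \<in> E" for n w using k[OF that, of n] \<epsilon>[of n] by (simp add: \<mu>_def)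
    have step: "\<mu> n w \<le> \<kappa> * \<mu> n (shift w)" if w: "w \<in> E" "w 0 \<in> Fv" for n w
    proof -
      \<comment> \<open>turns the value at \<open>shift w\<close> into its modulus\<close>
      define c where "c = (if k n (shift w) = 0 then 1 else cnj (sgn (k n (shift w))))"
      have c: "cmod c = 1" "c * k n (shift w) = of_real (cmod (k n (shift w)))"
        unfolding c_def using cnj_sgn_mult[of "k n (shift w)"] by (auto simp: norm_sgn)
      define q where "q = Re (c * (cis (Im z * \<xi> w) * k n w))"
      have "q \<le> cmod (c * (cis (Im z * \<xi> w) * k n w))" unfolding q_def by (rule complex_Re_le_cmod)
      then have "q \<le> cmod (k n w)" using c(1) by (simp add: norm_mult)
      then have "s n * q \<le> s n * cmod (k n w)" using s(1) by (rule mult_left_mono)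
      also have "\<dots> \<le> 1 * cmod (k n w)" using s(2) by (intro mult_right_mono) auto
      finally have "1 - cmod (k n w) \<le> 1 - s n * q" by simp
      also have "\<dots> \<le> C\<^sup>2 * exp (- u w) * (1 - Re (c * k n (shift w)) + 2 * \<epsilon> n)"
        unfolding q_def by (rule align[OF w(1) c(1)])
      also have "\<dots> = C\<^sup>2 * exp (- u w) * \<mu> n (shift w)" unfolding c(2) by (simp add: \<mu>_def)
      also have "\<dots> \<le> C\<^sup>2 * \<bar>Q\<bar> * \<mu> n (shift w)"
        using Q[OF w] \<mu>0[OF shift_mem[OF w(1)]] by (intro mult_right_mono mult_left_mono) auto
      finally have "1 - cmod (k n w) \<le> C\<^sup>2 * \<bar>Q\<bar> * \<mu> n (shift w)" .
      moreover have "2 * \<epsilon> n \<le> \<mu> n (shift w)" using k[OF shift_mem[OF w(1)], of n] by (simp add: \<mu>_def)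
      ultimately show ?thesis unfolding \<kappa>_def by (simp add: \<mu>_def[of n w] distrib_right)
    qed
    have chain: "\<mu> n w \<le> \<kappa> ^ j * \<mu> n ((shift ^^ j) w)" if "w \<in> E" "\<And>i. i < j \<Longrightarrow> w i \<in> Fv" for n w j
      using that
    proof (induction j arbitrary: w)
      case (Suc j)
      have "\<mu> n w \<le> \<kappa> * \<mu> n (shift w)" using Suc.prems by (intro step) auto
      also have "\<dots> \<le> \<kappa> * (\<kappa> ^ j * \<mu> n ((shift ^^ j) (shift w)))"
        using \<kappa> Suc.prems(2)[of "Suc _"]
        by (intro mult_left_mono Suc.IH shift_mem Suc.prems(1)) (auto simp: shift_def)
      finally show ?case by (simp add: funpow_swap1)
    qed simp
    have le: "1 - M * \<theta> ^ Suc N - \<kappa> ^ (N + J) * (3 * \<epsilon> n) \<le> cmod (k n v)" for n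
    proof -
      obtain y j where y: "y \<in> E" "j \<le> N + J" "N < j" "agree (Suc N) y v"
        "\<And>i. N < i \<Longrightarrow> i < j \<Longrightarrow> y i \<in> F0" "(shift ^^ j) y = x n"
        using FJ(2)[OF v x(1)[of n], of N] by blast
      have "y i \<in> Fv" if "i < j" for i
      proof (cases "i \<le> N")
        case True
        then have "y i = v i" using y(4) by (simp add: agree_def)
        then show ?thesis using True by (auto simp: Fv_def)
      qed (use y(5)[of i] that in \<open>auto simp: Fv_def\<close>)
      then have "\<mu> n y \<le> \<kappa> ^ j * \<mu> n (x n)" using chain[OF y(1), of j n] y(6) by simp
      also have "\<dots> \<le> \<kappa> ^ (N + J) * (3 * \<epsilon> n)"
        using \<kappa> y(2) x(2)[of n] \<mu>0[OF x(1)] by (intro mult_mono power_increasing) (auto simp: \<mu>_def)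
      finally have "1 - cmod (k n y) \<le> \<kappa> ^ (N + J) * (3 * \<epsilon> n)" using \<epsilon>[of n] by (simp add: \<mu>_def)
      moreover have "cmod (k n y) \<le> cmod (k n v) + M * \<theta> ^ Suc N"
        using lip_boundD[OF klip _ y(1) v y(4), of n] norm_triangle_ineq2[of "k n y" "k n v"] by simp
      ultimately show ?thesis by linarith
    qed
    have "((\<lambda>n. 1 - M * \<theta> ^ Suc N - \<kappa> ^ (N + J) * (3 * \<epsilon> n)) \<longlongrightarrow> 1 - M * \<theta> ^ Suc N - \<kappa> ^ (N + J) * (3 * 0)) F"
      by (intro tendsto_intros \<epsilon>0)
    then have l1: "((\<lambda>n. 1 - M * \<theta> ^ Suc N - \<kappa> ^ (N + J) * (3 * \<epsilon> n)) \<longlongrightarrow> 1 - M * \<theta> ^ Suc N) F" by simp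
    show ?thesis
      by (rule tendsto_le[OF F(1) tendsto_norm[OF lim[OF v]] l1]) (rule always_eventually, rule allI, rule le)
  qed
  have \<phi>1: "cmod (\<phi> v) = 1" if v: "v \<in> E" for v
  proof (rule antisym[OF \<phi>le[OF v]])
    have "(\<lambda>N. 1 - M * \<theta> ^ Suc N) \<longlonglongrightarrow> 1 - M * 0"
      using \<theta>_pos \<theta>_less by (intro tendsto_intros LIMSEQ_Suc[OF LIMSEQ_realpow_zero]) auto
    then show "1 \<le> cmod (\<phi> v)" using big[OF v] by (intro LIMSEQ_le_const2[where X = "\<lambda>N. 1 - M * \<theta> ^ Suc N"]) auto
  qed
  have coh: "cis (Im z * \<xi> y) * \<phi> y = \<phi> (shift y)" if y: "y \<in> E" for y
  proof -
    have sy: "shift y \<in> E" using y by (rule shift_mem)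
    \<comment> \<open>here the rotation is taken from the limit, so that \<open>Re (c k)\<close> tends to 1 at \<open>shift y\<close>\<close>
    define c where "c = cnj (\<phi> (shift y))"
    have c: "cmod c = 1" "c * \<phi> (shift y) = 1" "\<phi> (shift y) * c = 1"
      using \<phi>1[OF sy] complex_norm_square[of "\<phi> (shift y)"] by (auto simp: c_def mult.commute)
    let ?w = "c * (cis (Im z * \<xi> y) * \<phi> y)"
    have le: "1 - max 0 (Re (c * (cis (Im z * \<xi> y) * k n y))) \<le> C\<^sup>2 * exp (- u y) * (1 - Re (c * k n (shift y)) + 2 * \<epsilon> n)" for n
    proof -
      let ?q = "Re (c * (cis (Im z * \<xi> y) * k n y))"
      have "s n * ?q \<le> s n * max 0 ?q" using s(1) by (intro mult_left_mono) auto
      also have "\<dots> \<le> 1 * max 0 ?q" using s(2) by (intro mult_right_mono) auto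
      finally show ?thesis using align[OF y c(1), of n] by simp
    qed
    have l1: "((\<lambda>n. 1 - max 0 (Re (c * (cis (Im z * \<xi> y) * k n y)))) \<longlongrightarrow> 1 - max 0 (Re ?w)) F"
      by (intro tendsto_intros lim y)
    have l2: "((\<lambda>n. C\<^sup>2 * exp (- u y) * (1 - Re (c * k n (shift y)) + 2 * \<epsilon> n))
        \<longlongrightarrow> C\<^sup>2 * exp (- u y) * (1 - Re (c * \<phi> (shift y)) + 2 * 0)) F"
      by (intro tendsto_intros lim sy \<epsilon>0)
    have "1 - max 0 (Re ?w) \<le> C\<^sup>2 * exp (- u y) * (1 - Re (c * \<phi> (shift y)) + 2 * 0)"
      by (rule tendsto_le[OF F(1) l2 l1]) (rule always_eventually, rule allI, rule le)
    then have Re1: "Re ?w \<ge> 1" by (simp add: c(2))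
    have w1: "cmod ?w = 1" using c(1) \<phi>1[OF y] by (simp add: norm_mult)
    then have "Re ?w = 1" using Re1 complex_Re_le_cmod[of ?w] by linarith
    moreover have "(Re ?w)\<^sup>2 + (Im ?w)\<^sup>2 = 1" using w1 cmod_power2[of ?w] by simp
    ultimately have "?w = 1" by (simp add: complex_eq_iff)
    then have "\<phi> (shift y) * c * (cis (Im z * \<xi> y) * \<phi> y) = \<phi> (shift y)" by (simp add: mult.assoc)
    then show ?thesis by (simp add: c(3))
  qed
  show thesis by (rule that[of \<phi>]) (use \<phi>lip \<phi>1 coh in \<open>auto simp: phase_eigenfunction_def\<close>)
qed

section \<open>Invertibility and holomorphy of the resolvent\<close>

lemma S_le: "cmod v \<le> R \<Longrightarrow> S v \<le> (H + R * X) * exp (H + R * X)"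
proof -
  assume v: "cmod v \<le> R"
  have R: "0 \<le> R" using v norm_ge_zero[of v] by linarith
  have "H + cmod v * X \<le> H + R * X" using v X_nonneg by (simp add: mult_right_mono)
  then show ?thesis unfolding S_def using H_nonneg X_nonneg R by (intro mult_mono) auto
qed

text \<open>Without such an eigenfunction, \<open>Id - s L\<^sub>z\<close> is bounded below uniformly in \<open>s\<close>; continuity in \<open>s\<close> then
  gives bijectivity at \<open>s = 1\<close>, and the dependence on the parameter is holomorphic near \<open>z\<close>.\<close>

lemma resolvent_holomorphic_near_unless_eigenfunction:
  assumes z: "Re z = a"
    and none: "\<And>\<phi>. \<not> phase_eigenfunction \<xi> (Im z) \<phi>"
  shows "resolvent_holomorphic_near \<theta> E \<eta> \<xi> z"
proof -
  \<comment> \<open>In the ball of radius \<open>\<rho>\<close> real parts exceed \<open>a\<close> by at most \<open>\<rho>\<close>, and two points differ by at most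
    \<open>2 \<rho>\<close>; the remaining \<open>\<rho>\<close> is the margin that absorbs powers of \<open>\<xi>\<close>.\<close>
  define \<rho> where "\<rho> = (t - a) / 4"
  have \<rho>: "\<rho> > 0" using a_less by (simp add: \<rho>_def)
  define U where "U = ball z \<rho>"
  have U: "open U" "z \<in> U" using \<rho> by (auto simp: U_def)
  have ReU: "Re v + 2 * \<rho> + \<rho> \<le> t" if "v \<in> U" for v
  proof -
    have "\<bar>Re (v - z)\<bar> \<le> cmod (v - z)" by (rule abs_Re_le_cmod)
    then have "Re v \<le> a + \<rho>" using that z by (simp add: U_def dist_norm norm_minus_commute)
    then show ?thesis by (simp add: \<rho>_def field_simps)
  qed
  define R where "R = cmod z + \<rho>"
  have normU: "cmod v \<le> R" if "v \<in> U" for v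
    using that norm_triangle_sub[of v z] by (simp add: U_def R_def dist_norm norm_minus_commute)
  define S' where "S' = (H + R * X) * exp (H + R * X)"
  have S': "S v \<le> S'" if "v \<in> U" for v unfolding S'_def by (rule S_le[OF normU[OF that]])
  define \<beta> where "\<beta> = infsum b0 I"
  have \<beta>: "\<beta> \<ge> 0" unfolding \<beta>_def by (intro infsum_nonneg b0_nonneg)
  define C where "C = 2 * (((1 + S') / \<rho> + X) * \<beta>) + 2 * ((2 * (1 + S') / \<rho>\<^sup>2 + X\<^sup>2 * exp (2 * \<rho> * X) + X / \<rho>) * \<beta>)"
  have S'0: "S' \<ge> 0" using S'[OF U(2)] S_nonneg[of z] by linarith
  have C1: "2 * (((1 + S') / \<rho> + X) * \<beta>) \<le> C" "2 * ((2 * (1 + S') / \<rho>\<^sup>2 + X\<^sup>2 * exp (2 * \<rho> * X) + X / \<rho>) * \<beta>) \<le> C" "C \<ge> 0"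
    using S'0 X_nonneg \<rho> \<beta> unfolding C_def by (auto intro!: mult_nonneg_nonneg add_nonneg_nonneg)
  define T where "T v = (\<lambda>g x. g x - L v g x)" for v
  have Teq: "id_minus_transfer E \<eta> \<xi> v = T v" for v by (simp add: T_def id_minus_transfer_eq)
  have Wb: "weight_bound (weight v) (\<lambda>e. (1 + S v) * b0 e)" if "v \<in> U" for v
    using ReU[OF that] \<rho> by (intro weight_weight_bound[of \<rho>]) auto
  have Lb: "fs.bounded_lin (L v) (2 * (\<Sum>\<^sub>\<infinity>e\<in>I. (1 + S v) * b0 e))" if "v \<in> U" for v
    by (rule weighted_op_bounded[OF Wb[OF that]])
  have Tb: "fs.bounded_lin (T v) (1 + cmod 1 * (2 * (\<Sum>\<^sub>\<infinity>e\<in>I. (1 + S v) * b0 e)))" if "v \<in> U" for v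
    unfolding T_def using fs.bounded_lin_id_minus[OF Lb[OF that], of 1] by simp
  define D where "D v = weighted_op (\<lambda>y. - 1 * (of_real (\<xi> y) * weight v y))" for v
  have Db: "weight_bound (\<lambda>y. of_real (\<xi> y) * weight v y) (\<lambda>e. ((1 + S v) / \<rho> + X) * b0 e)" if "v \<in> U" for v
    using ReU[OF that] \<rho> by (intro weight_deriv_bound) auto
  have Dlin: "fs.bounded_lin (D v) C" if v: "v \<in> U" for v
  proof -
    have nb: "weight_bound (\<lambda>y. - 1 * (of_real (\<xi> y) * weight v y)) (\<lambda>e. ((1 + S v) / \<rho> + X) * b0 e)"
      using Db[OF v] unfolding weight_bound_def
      by (auto simp: norm_minus_commute simp flip: minus_diff_minus)
    have "2 * (\<Sum>\<^sub>\<infinity>e\<in>I. ((1 + S v) / \<rho> + X) * b0 e) = 2 * (((1 + S v) / \<rho> + X) * \<beta>)"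
      by (simp add: infsum_cmult_right' \<beta>_def)
    also have "\<dots> \<le> 2 * (((1 + S') / \<rho> + X) * \<beta>)"
      using S'[OF v] \<rho> \<beta> by (intro mult_left_mono mult_right_mono add_right_mono divide_right_mono) auto
    also have "\<dots> \<le> C" by (rule C1)
    finally have "2 * (\<Sum>\<^sub>\<infinity>e\<in>I. ((1 + S v) / \<rho> + X) * b0 e) * nrm g \<le> C * nrm g" for g
      by (intro mult_right_mono nrm_nonneg)
    then show ?thesis
      using weighted_op_bounded[OF nb] unfolding D_def fs.bounded_lin_def by (meson order_trans)
  qed
  have taylor: "nrm (\<lambda>x. T w g x - T v g x - (w - v) * D v g x) \<le> C * (cmod (w - v))\<^sup>2 * nrm g"
    if wv: "w \<in> U" "v \<in> U" and g: "g \<in> \<B>" for w v g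
  proof -
    have "cmod (w - v) \<le> 2 * \<rho>"
      using wv dist_triangle2[of w v z] by (simp add: U_def dist_norm[symmetric] dist_commute)
    then have tb: "weight_bound (\<lambda>y. weight w y - weight v y - (w - v) * (of_real (\<xi> y) * weight v y))
        (\<lambda>e. (cmod (w - v))\<^sup>2 * taylor_const \<rho> (2 * \<rho>) v * b0 e)"
      using ReU[OF wv(2)] by (intro weight_taylor_bound \<rho>) auto
    let ?Q = "\<lambda>y. weight w y - weight v y - (w - v) * (of_real (\<xi> y) * weight v y)"
    have sm: "(\<lambda>y. weight w y * g y) summable_on preimages x"
      "(\<lambda>y. weight v y * g y) summable_on preimages x"
      "(\<lambda>y. of_real (\<xi> y) * weight v y * g y) summable_on preimages x" for x
      using weighted_summable(1)[OF Wb[OF wv(1)] norm_le_nrm[OF g]]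
        weighted_summable(1)[OF Wb[OF wv(2)] norm_le_nrm[OF g]]
        weighted_summable(1)[OF Db[OF wv(2)] norm_le_nrm[OF g]] by auto
    have "weighted_op ?Q g x = L w g x - L v g x - (w - v) * weighted_op (\<lambda>y. of_real (\<xi> y) * weight v y) g x" for x
    proof (cases "x \<in> E")
      case True
      have "(\<Sum>\<^sub>\<infinity>y\<in>preimages x. ?Q y * g y) = (\<Sum>\<^sub>\<infinity>y\<in>preimages x. weight w y * g y - weight v y * g y
          - (w - v) * (of_real (\<xi> y) * weight v y * g y))"
        by (intro infsum_cong) (simp add: algebra_simps)
      also have "\<dots> = (\<Sum>\<^sub>\<infinity>y\<in>preimages x. weight w y * g y) - (\<Sum>\<^sub>\<infinity>y\<in>preimages x. weight v y * g y)
          - (w - v) * (\<Sum>\<^sub>\<infinity>y\<in>preimages x. of_real (\<xi> y) * weight v y * g y)"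
      proof -
        have d: "(\<lambda>y. weight w y * g y - weight v y * g y) summable_on preimages x"
          using summable_on_add[OF sm(1)[of x], of "\<lambda>y. - (weight v y * g y)"] sm(2)[of x]
          by (simp add: summable_on_uminus)
        show ?thesis
          by (subst infsum_diff[OF d summable_on_cmult_right[OF sm(3)]])
            (simp add: infsum_diff[OF sm(1,2)] infsum_cmult_right')
      qed
      finally show ?thesis using True by (simp add: weighted_op_def)
    qed (simp add: weighted_op_def)
    then have "(\<lambda>x. T w g x - T v g x - (w - v) * D v g x) = (\<lambda>x. - 1 * weighted_op ?Q g x)"
      unfolding T_def D_def weighted_op_scale by (auto simp: algebra_simps)
    then have "nrm (\<lambda>x. T w g x - T v g x - (w - v) * D v g x) = nrm (weighted_op ?Q g)"
      by (simp only: nrm_scale) simp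
    also have "\<dots> \<le> 2 * (\<Sum>\<^sub>\<infinity>e\<in>I. (cmod (w - v))\<^sup>2 * taylor_const \<rho> (2 * \<rho>) v * b0 e) * nrm g"
      by (rule fs.bounded_linD(2)[OF weighted_op_bounded[OF tb] g])
    also have "\<dots> = (2 * (taylor_const \<rho> (2 * \<rho>) v * \<beta>)) * (cmod (w - v))\<^sup>2 * nrm g"
      by (simp add: infsum_cmult_right' \<beta>_def mult.assoc)
    also have "\<dots> \<le> C * (cmod (w - v))\<^sup>2 * nrm g"
    proof (intro mult_right_mono nrm_nonneg zero_le_power2)
      have "taylor_const \<rho> (2 * \<rho>) v \<le> 2 * (1 + S') / \<rho>\<^sup>2 + X\<^sup>2 * exp (2 * \<rho> * X) + X / \<rho>"
        unfolding taylor_const_def using S'[OF wv(2)] \<rho> by (intro add_right_mono divide_right_mono) auto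
      then show "2 * (taylor_const \<rho> (2 * \<rho>) v * \<beta>) \<le> C"
        using C1(2) \<beta> by (smt (verit) mult_right_mono)
    qed
    finally show ?thesis .
  qed
  have "\<exists>c>0. \<forall>s\<in>{0..1}. \<forall>g\<in>\<B>. nrm g \<le> c * nrm (\<lambda>x. g x - of_real s * L z g x)"
  proof (rule ccontr)
    assume not_below: "\<not> (\<exists>c>0. \<forall>s\<in>{0..1}. \<forall>g\<in>\<B>. nrm g \<le> c * nrm (\<lambda>x. g x - of_real s * L z g x))"
    obtain \<phi> where "phase_eigenfunction \<xi> (Im z) \<phi>" by (rule unimodular_eigenfunction[OF z not_below])
    then show False using none by blast
  qed
  then obtain c where c: "c > 0" "\<And>s g. s \<in> {0..1} \<Longrightarrow> g \<in> \<B> \<Longrightarrow> nrm g \<le> c * nrm (\<lambda>x. g x - of_real s * L z g x)"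
    by blast
  have bij: "bij_betw (T z) \<B> \<B>"
    unfolding T_def by (rule fs.bij_id_minus_by_continuity[OF Lb[OF U(2)] c(1)]) (use c(2) in auto)
  have below: "nrm g \<le> c * nrm (T z g)" if "g \<in> \<B>" for g
    using c(2)[of 1 g] that by (simp add: T_def)
  obtain V where V: "open V" "z \<in> V" "V \<subseteq> U" "\<And>w. w \<in> V \<Longrightarrow> bij_betw (T w) \<B> \<B>"
    "\<And>w. w \<in> V \<Longrightarrow> fs.bounded_lin (inv_into \<B> (T w)) (2 * c)"
    "\<And>z. z \<in> V \<Longrightarrow> \<exists>D' K' C'. fs.bounded_lin D' K' \<and> (\<forall>w\<in>V. \<forall>g\<in>\<B>. w \<noteq> z \<longrightarrow>
       nrm (\<lambda>x. (inv_into \<B> (T w) g x - inv_into \<B> (T z) g x) / (w - z) - D' g x)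
         \<le> C' * cmod (w - z) * nrm g)"
    by (rule fs.inverse_holomorphic[OF U Tb Dlin C1(3) taylor bij below less_imp_le[OF c(1)]])
      (assumption | rule that | blast)+
  have res: "resolvent \<theta> E \<eta> \<xi> w = inv_into \<B> (T w)" for w by (simp add: resolvent_def Teq)
  show ?thesis
    unfolding resolvent_holomorphic_near_def
  proof (intro exI conjI ballI)
    show "open V" "z \<in> V" by (fact V)+
    fix w assume w: "w \<in> V"
    then have wU: "w \<in> U" using V(3) by blast
    show "invertible_op \<theta> E (id_minus_transfer E \<eta> \<xi> w)"
      unfolding invertible_op_def Teq
      using V(4)[OF w] bounded_lin_imp_bounded_operators[OF Tb[OF wU]]
        bounded_lin_imp_bounded_operators[OF V(5)[OF w]] by blast
  next
    show "op_holomorphic_on \<theta> E (resolvent \<theta> E \<eta> \<xi>) V"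
      unfolding op_holomorphic_on_def res
    proof (intro conjI ballI)
      fix w assume w: "w \<in> V"
      show "inv_into \<B> (T w) \<in> bounded_operators \<theta> E"
        by (rule bounded_lin_imp_bounded_operators[OF V(5)[OF w]])
      obtain D' K' C' where D': "fs.bounded_lin D' K'"
        "\<And>v g. v \<in> V \<Longrightarrow> g \<in> \<B> \<Longrightarrow> v \<noteq> w \<Longrightarrow>
         nrm (\<lambda>x. (inv_into \<B> (T v) g x - inv_into \<B> (T w) g x) / (v - w) - D' g x) \<le> C' * cmod (v - w) * nrm g"
        using V(6)[OF w] by blast
      let ?E = "\<lambda>v. op_norm \<theta> E (\<lambda>g x. (inv_into \<B> (T v) g x - inv_into \<B> (T w) g x) / (v - w) - D' g x)"
      have le: "?E v \<le> ennreal (C' * cmod (v - w))" if v: "v \<in> V" "v \<noteq> w" for v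
      proof (rule op_norm_le)
        fix g assume g: "g \<in> \<B>"
        have "(\<lambda>x. (1 / (v - w)) * (inv_into \<B> (T v) g x - inv_into \<B> (T w) g x) - D' g x) \<in> \<B>"
          by (intro \<B>_diff \<B>_scale fs.bounded_linD(1)[OF V(5)] fs.bounded_linD(1)[OF D'(1)] v w g)
        then show "(\<lambda>x. (inv_into \<B> (T v) g x - inv_into \<B> (T w) g x) / (v - w) - D' g x) \<in> \<B>" by simp
        show "nrm (\<lambda>x. (inv_into \<B> (T v) g x - inv_into \<B> (T w) g x) / (v - w) - D' g x) \<le> C' * cmod (v - w) * nrm g"
          by (rule D'(2)[OF v(1) g v(2)])
      qed
      have "((\<lambda>v. C' * cmod (v - w)) \<longlongrightarrow> C' * cmod (w - w)) (at w)" by (intro tendsto_intros)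
      then have "((\<lambda>v. ennreal (C' * cmod (v - w))) \<longlongrightarrow> 0) (at w)"
        using tendsto_ennrealI by fastforce
      moreover have "\<forall>\<^sub>F v in at w. ?E v \<le> ennreal (C' * cmod (v - w))"
        using le V(1) w unfolding eventually_at_topological by blast
      ultimately have "(?E \<longlongrightarrow> 0) (at w)"
        by (intro tendsto_sandwich[of "\<lambda>_. 0" ?E _ "\<lambda>v. ennreal (C' * cmod (v - w))"]) auto
      then show "\<exists>D\<in>bounded_operators \<theta> E. ((\<lambda>v. op_norm \<theta> E (\<lambda>g x. (inv_into \<B> (T v) g x - inv_into \<B> (T w) g x) / (v - w) - D g x)) \<longlongrightarrow> 0) (at w)"
        using bounded_lin_imp_bounded_operators[OF D'(1)] by blast
    qed
  qed
qed

end

section \<open>Lattice conditions\<close>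

lemma cis_eq_imp_diff_multiple:
  assumes "cis x = cis y"
  obtains k :: int where "x - y = 2 * pi * of_int k"
proof -
  have "exp (\<i> * of_real x) = exp (\<i> * of_real y)" using assms by (simp add: cis_conv_exp)
  then obtain n :: int where "\<i> * of_real x = \<i> * of_real y + (of_int (2 * n) * pi) * \<i>"
    unfolding exp_eq by blast
  then have "\<i> * of_real x = \<i> * of_real (y + 2 * pi * of_int n)" by (simp add: algebra_simps)
  then have "complex_of_real x = of_real (y + 2 * pi * of_int n)" by (simp only: mult_cancel_left) simp
  then have "x = y + 2 * pi * of_int n" by (simp only: of_real_eq_iff)
  then show thesis by (intro that[of n]) simp
qed

lemma cis_2pi_int: "cis (2 * pi * of_int k) = 1"
  by (simp add: cis_multiple_2pi)

lemma inv_real_group: "m_inv real_group x = - x"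
  unfolding m_inv_def real_group_def by (rule the_equality) auto

lemma subgroup_real_multiples: "subgroup {c * of_int k |k. True} real_group"
proof
  show "{c * of_int k |k. True} \<subseteq> carrier real_group" by (simp add: real_group_def)
  show "x \<otimes>\<^bsub>real_group\<^esub> y \<in> {c * of_int k |k. True}"
    if "x \<in> {c * of_int k |k. True}" "y \<in> {c * of_int k |k. True}" for x y
  proof -
    from that obtain j k where "x = c * of_int j" "y = c * of_int k" by auto
    then have "x + y = c * of_int (j + k)" by (simp add: distrib_left)
    then have "x + y \<in> {c * of_int k |k. True}" by blast
    then show ?thesis by (simp add: real_group_def)
  qed
  show "\<one>\<^bsub>real_group\<^esub> \<in> {c * of_int k |k. True}"
    unfolding real_group_def by (auto intro!: exI[of _ 0])
  show "inv\<^bsub>real_group\<^esub> x \<in> {c * of_int k |k. True}" if "x \<in> {c * of_int k |k. True}" for x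
  proof -
    from that obtain j where "x = c * of_int j" by auto
    then have "- x = c * of_int (- j)" by simp
    then show ?thesis unfolding inv_real_group by blast
  qed
qed

lemma discrete_real_multiples:
  fixes c :: real
  assumes "c \<noteq> 0"
  shows "discrete {c * of_int k |k. True}"
proof (rule discreteI)
  fix x assume x: "x \<in> {c * of_int k |k. True}"
  have "y = x" if y: "y \<in> {c * of_int k |k. True}" "dist x y < \<bar>c\<bar>" for y
  proof -
    obtain j k where jk: "x = c * of_int j" "y = c * of_int k" using x y by auto
    then have "\<bar>c\<bar> * \<bar>of_int (j - k)\<bar> < \<bar>c\<bar> * 1"
      using y(2) by (simp add: dist_real_def flip: abs_mult right_diff_distrib)
    moreover have "\<bar>c\<bar> > 0" using assms by simp
    ultimately have "\<bar>of_int (j - k)\<bar> < (1::real)" by (rule mult_left_less_imp_less[OF _ less_imp_le])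
    then have "j = k" by linarith
    then show ?thesis using jk by simp
  qed
  then show "x isolated_in {c * of_int k |k. True}"
    unfolding isolated_in_dist_Ex_iff using x assms by (intro conjI exI[of _ "\<bar>c\<bar>"]) auto
qed

lemma subgroup_int_multiples: "subgroup (range (\<lambda>k. q * k)) integer_group"
proof
  show "x \<otimes>\<^bsub>integer_group\<^esub> y \<in> range (\<lambda>k. q * k)"
    if "x \<in> range (\<lambda>k. q * k)" "y \<in> range (\<lambda>k. q * k)" for x y
  proof -
    from that obtain j k where "x = q * j" "y = q * k" by auto
    then have "x + y = q * (j + k)" by (simp add: distrib_left)
    then have "x + y \<in> range (\<lambda>k. q * k)" by blast
    then show ?thesis by (simp add: integer_group_def)
  qed
  show "\<one>\<^bsub>integer_group\<^esub> \<in> range (\<lambda>k. q * k)"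
    unfolding integer_group_def by (auto intro!: image_eqI[of _ _ 0])
  show "inv\<^bsub>integer_group\<^esub> x \<in> range (\<lambda>k. q * k)" if "x \<in> range (\<lambda>k. q * k)" for x
  proof -
    from that obtain j where "x = q * j" by auto
    then have "- x = q * (- j)" by simp
    then show ?thesis unfolding inv_integer_group by blast
  qed
qed (simp add: integer_group_def)

context markov_shift
begin

text \<open>A continuous logarithm exists because \<open>\<phi>\<close> varies by less than 1 on cylinders of some fixed
  length, and on each of these a branch of the argument can be chosen independently.\<close>

lemma continuous_argument:
  fixes \<phi> :: "(nat \<Rightarrow> nat) \<Rightarrow> complex"
  assumes lip: "lip_bound \<phi> M" and one: "\<And>x. x \<in> E \<Longrightarrow> cmod (\<phi> x) = 1"
  obtains \<psi> :: "(nat \<Rightarrow> nat) \<Rightarrow> real" where "continuous_on E \<psi>" "\<And>x. x \<in> E \<Longrightarrow> cis (\<psi> x) = \<phi> x"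
proof -
  have "(\<lambda>n. M * \<theta> ^ n) \<longlonglongrightarrow> M * 0"
    using \<theta>_pos \<theta>_less by (intro tendsto_intros LIMSEQ_realpow_zero) auto
  then have "\<forall>\<^sub>F n in sequentially. M * \<theta> ^ n < 1" by (auto simp: order_tendsto_iff)
  then have "\<forall>\<^sub>F n in sequentially. M * \<theta> ^ n < 1 \<and> n \<ge> 1"
    using eventually_ge_at_top by (rule eventually_conj)
  then obtain n where n: "M * \<theta> ^ n < 1" "n \<ge> 1" using eventually_happens by force
  define rep where "rep w = (SOME y. y \<in> E \<and> map y [0..<n] = w)" for w
  define \<rho> where "\<rho> x = rep (map x [0..<n])" for x :: "nat \<Rightarrow> nat"
  have \<rho>: "\<rho> x \<in> E" "agree n x (\<rho> x)" if "x \<in> E" for x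
  proof -
    have "\<rho> x \<in> E \<and> map (\<rho> x) [0..<n] = map x [0..<n]"
      unfolding \<rho>_def rep_def by (rule someI[of _ x]) (simp add: that)
    then show "\<rho> x \<in> E" "agree n x (\<rho> x)" by (auto simp: agree_def)
  qed
  have \<rho>_cong: "\<rho> y = \<rho> x" if "agree n x y" for x y
  proof -
    have "map y [0..<n] = map x [0..<n]" using that by (simp add: agree_def)
    then show ?thesis unfolding \<rho>_def by (rule arg_cong)
  qed
  define \<psi> where "\<psi> x = Arg (\<phi> x / \<phi> (\<rho> x)) + Arg (\<phi> (\<rho> x))" for x
  have q: "\<phi> x / \<phi> (\<rho> x) \<notin> \<real>\<^sub>\<le>\<^sub>0" if x: "x \<in> E" for x
  proof -
    have r0: "\<phi> (\<rho> x) \<noteq> 0" using one[OF \<rho>(1)[OF x]] by auto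
    have "\<phi> x / \<phi> (\<rho> x) - 1 = (\<phi> x - \<phi> (\<rho> x)) / \<phi> (\<rho> x)" using r0 by (simp add: field_simps)
    then have "cmod (\<phi> x / \<phi> (\<rho> x) - 1) = cmod (\<phi> x - \<phi> (\<rho> x))"
      using one[OF \<rho>(1)[OF x]] by (simp add: norm_divide)
    also have "\<dots> < 1" using lip_boundD[OF lip n(2) x \<rho>[OF x]] n(1) by linarith
    finally have lt: "cmod (\<phi> x / \<phi> (\<rho> x) - 1) < 1" .
    show ?thesis
    proof
      assume "\<phi> x / \<phi> (\<rho> x) \<in> \<real>\<^sub>\<le>\<^sub>0"
      then have "Re (\<phi> x / \<phi> (\<rho> x)) \<le> 0" by (simp add: complex_nonpos_Reals_iff)
      then show False using abs_Re_le_cmod[of "\<phi> x / \<phi> (\<rho> x) - 1"] lt by simp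
    qed
  qed
  show thesis
  proof (rule that[of \<psi>])
    show "cis (\<psi> x) = \<phi> x" if x: "x \<in> E" for x
    proof -
      have r: "cmod (\<phi> (\<rho> x)) = 1" "cmod (\<phi> x / \<phi> (\<rho> x)) = 1"
        using one[OF x] one[OF \<rho>(1)[OF x]] by (auto simp: norm_divide)
      have c: "cis (Arg w) = w" if "cmod w = 1" for w
        using that cis_Arg[of w] by (cases "w = 0") (auto simp: sgn_eq)
      have "cis (\<psi> x) = cis (Arg (\<phi> x / \<phi> (\<rho> x))) * cis (Arg (\<phi> (\<rho> x)))" by (simp add: \<psi>_def cis_mult)
      also have "\<dots> = \<phi> x / \<phi> (\<rho> x) * \<phi> (\<rho> x)" by (simp only: c[OF r(1)] c[OF r(2)])
      also have "\<dots> = \<phi> x" using r(1) by auto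
      finally show ?thesis .
    qed
    show "continuous_on E \<psi>"
      unfolding continuous_on_def
    proof
      fix x assume x: "x \<in> E"
      have "(\<phi> \<longlongrightarrow> \<phi> x) (at x within E)"
        using lip_bound_continuous[OF lip] x by (auto simp: continuous_on_def)
      then have "((\<lambda>y. \<phi> y / \<phi> (\<rho> x)) \<longlongrightarrow> \<phi> x / \<phi> (\<rho> x)) (at x within E)"
        using one[OF \<rho>(1)[OF x]] by (intro tendsto_divide tendsto_const) auto
      then have "((\<lambda>y. Arg (\<phi> y / \<phi> (\<rho> x)) + Arg (\<phi> (\<rho> x))) \<longlongrightarrow> \<psi> x) (at x within E)"
        unfolding \<psi>_def
        by (intro tendsto_add tendsto_const isCont_tendsto_compose[OF continuous_at_Arg[OF q[OF x]]])
      moreover have "\<forall>\<^sub>F y in at x within E. Arg (\<phi> y / \<phi> (\<rho> x)) + Arg (\<phi> (\<rho> x)) = \<psi> y"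
      proof -
        have "\<forall>\<^sub>F y in at x within E. agree n x y"
          unfolding eventually_at_topological using open_agree[of n x]
          by (intro exI[of _ "{y. agree n x y}"]) (auto simp: agree_def)
        then show ?thesis by eventually_elim (simp add: \<psi>_def \<rho>_cong)
      qed
      ultimately show "(\<psi> \<longlongrightarrow> \<psi> x) (at x within E)" by (rule Lim_transform_eventually)
    qed
  qed
qed

lemma phase_eigenfunctionD:
  assumes "phase_eigenfunction \<xi> b \<phi>"
  shows "x \<in> E \<Longrightarrow> cmod (\<phi> x) = 1" "y \<in> E \<Longrightarrow> cis (b * \<xi> y) * \<phi> y = \<phi> (shift y)"
  using assms by (auto simp: phase_eigenfunction_def)

lemma eigenfunction_imp_lattice:
  assumes \<phi>: "phase_eigenfunction \<xi> b \<phi>" and b: "b \<noteq> 0"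
  shows "lattice_potential E \<xi>"
proof -
  note one = phase_eigenfunctionD(1)[OF \<phi>] and coh = phase_eigenfunctionD(2)[OF \<phi>]
  obtain M where lip: "lip_bound \<phi> M" using \<phi> by (auto simp: phase_eigenfunction_def)
  obtain \<psi> :: "(nat \<Rightarrow> nat) \<Rightarrow> real" where \<psi>: "continuous_on E \<psi>" "\<And>x. x \<in> E \<Longrightarrow> cis (\<psi> x) = \<phi> x"
    by (rule continuous_argument[OF lip one]) blast+
  have "\<xi> x - (- \<psi> x / b) + (- \<psi> (shift x) / b) \<in> {2 * pi / b * of_int k |k. True}" if x: "x \<in> E" for x
  proof -
    have "cis (b * \<xi> x + \<psi> x) = cis (\<psi> (shift x))"
      using coh[OF x] \<psi>(2)[OF x] \<psi>(2)[OF shift_mem[OF x]] by (simp add: cis_mult[symmetric])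
    then obtain k :: int where "b * \<xi> x + \<psi> x - \<psi> (shift x) = 2 * pi * of_int k"
      by (rule cis_eq_imp_diff_multiple)
    then have "\<xi> x - (- \<psi> x / b) + (- \<psi> (shift x) / b) = 2 * pi / b * of_int k" using b by (simp add: field_simps)
    then show ?thesis by blast
  qed
  then have "\<forall>x\<in>E. \<xi> x - (- \<psi> x / b) + (- \<psi> (shift x) / b) \<in> {2 * pi / b * of_int k |k. True}" by blast
  moreover have "continuous_on E (\<lambda>x. - \<psi> x / b)" using b by (intro continuous_intros \<psi>) auto
  moreover have "discrete {2 * pi / b * of_int k |k. True}" using b by (intro discrete_real_multiples) auto
  ultimately show ?thesis
    unfolding lattice_potential_def
    by (intro exI[of _ "\<lambda>x. - \<psi> x / b"] exI[of _ "{2 * pi / b * of_int k |k. True}"] conjI subgroup_real_multiples)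
qed

lemma iterate_eigenfunction:
  assumes \<phi>: "phase_eigenfunction \<xi> b \<phi>" and y: "y \<in> E"
  shows "\<phi> ((shift ^^ n) y) = cis (b * birkhoff_sum n \<xi> y) * \<phi> y"
proof (induction n)
  case (Suc n)
  have "\<phi> ((shift ^^ Suc n) y) = cis (b * \<xi> ((shift ^^ n) y)) * \<phi> ((shift ^^ n) y)"
    using phase_eigenfunctionD(2)[OF \<phi> funpow_shift_mem[OF y, of n]] by simp
  then show ?case using Suc by (simp add: birkhoff_sum_def cis_mult distrib_left add.commute flip: mult.assoc)
qed (simp add: birkhoff_sum_def)

text \<open>For irrational \<open>b / 2\<pi>\<close>, integrality forces the sum of \<open>\<xi>\<close> over every periodic orbit to vanish.
  As \<open>\<xi> \<ge> 0\<close> and periodic points are dense, \<open>\<xi> = 0\<close>.\<close>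

lemma eigenfunction_irrational:
  assumes \<phi>: "phase_eigenfunction \<xi> b \<phi>"
    and irr: "b / (2 * pi) \<notin> \<rat>" and int: "\<And>x. x \<in> E \<Longrightarrow> \<xi> x \<in> \<int>"
    and nonneg: "\<And>x. x \<in> E \<Longrightarrow> \<xi> x \<ge> 0" and X: "lip_bound \<xi> X" and z: "z \<in> E"
  shows "\<xi> z = 0"
proof -
  note one = phase_eigenfunctionD(1)[OF \<phi>] and coh = phase_eigenfunctionD(2)[OF \<phi>]
  have "\<bar>\<xi> z\<bar> \<le> X * \<theta> ^ Suc N" for N
  proof -
    obtain y n where y: "y \<in> E" "n > 0" "agree (Suc N) y z" "(shift ^^ n) y = y"
      using periodic_point[OF z] by blast
    have "birkhoff_sum n \<xi> y \<in> \<int>" unfolding birkhoff_sum_def by (intro Ints_sum int funpow_shift_mem y)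
    then obtain s :: int where s: "birkhoff_sum n \<xi> y = of_int s" by (auto elim: Ints_cases)
    have "cis (b * of_int s) * \<phi> y = 1 * \<phi> y"
      using iterate_eigenfunction[OF \<phi> y(1), of n] y(4) s by simp
    then have "cis (b * of_int s) = cis 0" using one[OF y(1)] by (subst (asm) mult_cancel_right) auto
    then obtain k :: int where k: "b * of_int s - 0 = 2 * pi * of_int k" by (rule cis_eq_imp_diff_multiple)
    have "s = 0"
    proof (rule ccontr)
      assume s0: "s \<noteq> 0"
      then have "b / (2 * pi) = of_int k / of_int s" using k by (simp add: field_simps)
      then have "b / (2 * pi) \<in> \<rat>" by simp
      then show False using irr by blast
    qed
    then have "birkhoff_sum n \<xi> y = 0" using s by simp
    then have "\<forall>j\<in>{..<n}. \<xi> ((shift ^^ j) y) = 0" unfolding birkhoff_sum_def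
      using nonneg funpow_shift_mem[OF y(1)] by (subst (asm) sum_nonneg_eq_0_iff) auto
    then have "\<xi> y = 0" using y(2) by (auto dest: bspec[where x = 0])
    then show ?thesis using lip_boundD[OF X _ y(1) z y(3)] by simp
  qed
  moreover have "(\<lambda>N. X * \<theta> ^ Suc N) \<longlonglongrightarrow> X * 0"
    using \<theta>_pos \<theta>_less by (intro tendsto_intros LIMSEQ_Suc[OF LIMSEQ_realpow_zero]) auto
  ultimately have "\<bar>\<xi> z\<bar> \<le> X * 0" by (intro LIMSEQ_le_const[where X = "\<lambda>N. X * \<theta> ^ Suc N"]) auto
  then show ?thesis by simp
qed

text \<open>For \<open>b / 2\<pi> = p / q\<close> in lowest terms, \<open>\<phi>\<^sup>q\<close> is invariant under the shift and hence constant, so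
  \<open>\<phi>\<close> takes its values in a coset of the \<open>q\<close>-th roots of unity. Their exponents \<open>\<kappa>\<close> satisfy
  \<open>p \<xi> + \<kappa> - \<kappa> \<circ> shift \<in> q \<int>\<close>, and an inverse of \<open>p\<close> modulo \<open>q\<close> removes the factor \<open>p\<close>.\<close>

lemma eigenfunction_rational:
  fixes p :: int and q :: nat
  assumes \<phi>: "phase_eigenfunction \<xi> b \<phi>"
    and b: "b = 2 * pi * (of_int p / of_nat q)" and q: "q \<ge> 2" and pq: "coprime p (int q)"
    and int: "\<And>x. x \<in> E \<Longrightarrow> \<xi> x \<in> \<int>"
  shows "cohomologous_into_proper_subgroup E \<xi>"
proof -
  note one = phase_eigenfunctionD(1)[OF \<phi>] and coh = phase_eigenfunctionD(2)[OF \<phi>]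
  obtain M where lip: "lip_bound \<phi> M" using \<phi> by (auto simp: phase_eigenfunction_def)
  obtain x0 where x0: "x0 \<in> E" using E_nonempty by blast
  have q0: "q > 0" using q by simp
  have inv: "\<phi> (shift y) ^ q = \<phi> y ^ q" if y: "y \<in> E" for y
  proof -
    obtain k :: int where k: "\<xi> y = of_int k" using int[OF y] by (auto elim: Ints_cases)
    have e: "real q * (b * \<xi> y) = 2 * pi * of_int (p * k)" unfolding b k using q0 by (simp add: field_simps)
    have "\<phi> (shift y) ^ q = cis (b * \<xi> y) ^ q * \<phi> y ^ q" by (simp add: coh[OF y, symmetric] power_mult_distrib)
    also have "cis (b * \<xi> y) ^ q = cis (2 * pi * of_int (p * k))"
      by (simp only: Complex.DeMoivre e)
    also have "\<dots> = 1" by (rule cis_2pi_int)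
    finally show ?thesis by simp
  qed
  have inv_iter: "\<phi> ((shift ^^ j) y) ^ q = \<phi> y ^ q" if y: "y \<in> E" for y j
    by (induction j) (use inv[OF funpow_shift_mem[OF y]] in auto)
  have const: "\<phi> z ^ q = \<phi> x0 ^ q" if z: "z \<in> E" for z
  proof -
    have le: "cmod (\<phi> x0 ^ q - \<phi> z ^ q) \<le> real q * (M * \<theta> ^ Suc N)" for N
    proof -
      obtain y j where y: "y \<in> E" "agree (Suc N) y z" "(shift ^^ j) y = x0"
        using joining z x0 by metis
      have "\<phi> x0 ^ q = \<phi> y ^ q" using inv_iter[OF y(1), of j] y(3) by simp
      also have "cmod (\<phi> y ^ q - \<phi> z ^ q) \<le> real q * cmod (\<phi> y - \<phi> z)"
        using one[OF y(1)] one[OF z] by (intro norm_power_diff) auto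
      also have "\<dots> \<le> real q * (M * \<theta> ^ Suc N)"
        using lip_boundD[OF lip _ y(1) z y(2)] by (intro mult_left_mono) auto
      finally show ?thesis .
    qed
    have "(\<lambda>N. real q * (M * \<theta> ^ Suc N)) \<longlonglongrightarrow> real q * (M * 0)"
      using \<theta>_pos \<theta>_less by (intro tendsto_intros LIMSEQ_Suc[OF LIMSEQ_realpow_zero]) auto
    then have "cmod (\<phi> x0 ^ q - \<phi> z ^ q) \<le> real q * (M * 0)"
      by (rule LIMSEQ_le_const) (use le in blast)
    then show ?thesis by simp
  qed
  define w where "w x = \<phi> x / \<phi> x0" for x
  have x00: "\<phi> x0 \<noteq> 0" using one[OF x0] by auto
  have root: "w x ^ q = 1" if "x \<in> E" for x
    using const[OF that] x00 by (simp add: w_def power_divide)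
  define K where "K v = (SOME j::nat. v = cis (2 * pi * real j / real q))" for v
  have K: "v = cis (2 * pi * real (K v) / real q)" if "v ^ q = 1" for v
  proof -
    have "v \<in> {exp (2 * of_real pi * \<i> * of_nat j / of_nat q) |j. j < q}"
      using that complex_roots_unity[of q] q0 by auto
    then obtain j where "v = exp (2 * of_real pi * \<i> * of_nat j / of_nat q)" by blast
    also have "\<dots> = cis (2 * pi * real j / real q)" by (simp add: cis_conv_exp mult_ac)
    finally have "\<exists>j::nat. v = cis (2 * pi * real j / real q)" by blast
    then show ?thesis unfolding K_def by (rule someI_ex)
  qed
  define \<kappa> where "\<kappa> x = int (K (w x))" for x
  have key: "\<exists>k. p * m + \<kappa> x - \<kappa> (shift x) = int q * k" if x: "x \<in> E" and m: "\<xi> x = of_int m" for x m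
  proof -
    have "cis (b * \<xi> x) * w x = w (shift x)" unfolding w_def using coh[OF x] by simp
    then have "cis (b * \<xi> x) * cis (2 * pi * real (K (w x)) / real q) = cis (2 * pi * real (K (w (shift x))) / real q)"
      using K[OF root[OF x]] K[OF root[OF shift_mem[OF x]]] by simp
    then have "cis (b * \<xi> x + 2 * pi * real (K (w x)) / real q) = cis (2 * pi * real (K (w (shift x))) / real q)"
      by (simp add: cis_mult)
    then obtain k :: int where k: "b * \<xi> x + 2 * pi * real (K (w x)) / real q - 2 * pi * real (K (w (shift x))) / real q = 2 * pi * of_int k"
      by (rule cis_eq_imp_diff_multiple)
    have "2 * pi * (of_int p * of_int m + real (K (w x)) - real (K (w (shift x)))) =
        real q * (b * \<xi> x + 2 * pi * real (K (w x)) / real q - 2 * pi * real (K (w (shift x))) / real q)"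
      unfolding b m using q0 by (simp add: field_simps)
    also have "\<dots> = 2 * pi * (real q * of_int k)" unfolding k by simp
    finally have "2 * pi * (of_int p * of_int m + real (K (w x)) - real (K (w (shift x)))) = 2 * pi * (real q * of_int k)" .
    then have "of_int p * of_int m + real (K (w x)) - real (K (w (shift x))) = real q * of_int k" by simp
    then have "real_of_int (p * m + \<kappa> x - \<kappa> (shift x)) = of_int (int q * k)" by (simp add: \<kappa>_def)
    then show ?thesis by (simp only: of_int_eq_iff) blast
  qed
  obtain p' q' where bez: "p' * p + q' * int q = 1"
    using pq bezout_int[of p "int q"] by auto
  define \<psi> :: "(nat \<Rightarrow> nat) \<Rightarrow> complex" where "\<psi> x = - of_int (p' * \<kappa> x)" for x :: "nat \<Rightarrow> nat"
  have "complex_of_real (\<xi> x) - \<psi> x + \<psi> (shift x) \<in> of_int ` range (\<lambda>k. int q * k)" if x: "x \<in> E" for x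
  proof -
    obtain m :: int where m: "\<xi> x = of_int m" using int[OF x] by (auto elim: Ints_cases)
    obtain k where k: "p * m + \<kappa> x - \<kappa> (shift x) = int q * k" using key[OF x m] by blast
    have "m + p' * \<kappa> x - p' * \<kappa> (shift x) = (p' * p + q' * int q) * m + p' * \<kappa> x - p' * \<kappa> (shift x)"
      by (simp add: bez)
    also have "\<dots> = p' * (p * m + \<kappa> x - \<kappa> (shift x)) + q' * int q * m" by (simp add: algebra_simps)
    also have "\<dots> = int q * (p' * k + q' * m)" unfolding k by (simp add: algebra_simps)
    finally have "m + p' * \<kappa> x - p' * \<kappa> (shift x) \<in> range (\<lambda>k. int q * k)" by blast
    moreover have "complex_of_real (\<xi> x) - \<psi> x + \<psi> (shift x) = of_int (m + p' * \<kappa> x - p' * \<kappa> (shift x))"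
      by (simp add: m \<psi>_def)
    ultimately show ?thesis by blast
  qed
  moreover have "continuous_on E \<psi>"
  proof -
    have "w ` E \<subseteq> {v. v ^ q = 1}" using root by auto
    then have "finite (w ` E)" by (rule finite_subset) (use q in \<open>auto intro!: finite_roots_unity\<close>)
    then have "continuous_on (w ` E) (\<lambda>v. - of_int (p' * int (K v)) :: complex)" by (rule continuous_on_finite)
    moreover have "continuous_on E w"
      unfolding w_def using x00 by (intro continuous_on_divide continuous_on_const lip_bound_continuous[OF lip]) auto
    ultimately show ?thesis unfolding \<psi>_def \<kappa>_def by (rule continuous_on_compose2) auto
  qed
  moreover have "range (\<lambda>k. int q * k) \<noteq> UNIV"
  proof
    assume "range (\<lambda>k. int q * k) = UNIV"
    then obtain k where "1 = int q * k" by (metis UNIV_I imageE)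
    then have "int q dvd 1" by (metis dvd_triv_left)
    then show False using q by simp
  qed
  ultimately show ?thesis
    unfolding cohomologous_into_proper_subgroup_def using subgroup_int_multiples by blast
qed

lemma eigenfunction_imp_cohomologous_into_proper_subgroup:
  assumes \<phi>: "phase_eigenfunction \<xi> b \<phi>"
    and b: "b / (2 * pi) \<notin> \<int>" and int: "\<And>x. x \<in> E \<Longrightarrow> \<xi> x \<in> \<int>"
    and nonneg: "\<And>x. x \<in> E \<Longrightarrow> \<xi> x \<ge> 0" and X: "lip_bound \<xi> X"
  shows "cohomologous_into_proper_subgroup E \<xi>"
proof (cases "b / (2 * pi) \<in> \<rat>")
  case False
  have "\<xi> z = 0" if "z \<in> E" for z
    by (rule eigenfunction_irrational[OF \<phi> False int nonneg X that])
  then have "\<forall>x\<in>E. complex_of_real (\<xi> x) - (\<lambda>_. 0) x + (\<lambda>_. 0) (shift x) \<in> of_int ` range (\<lambda>k. 0 * k)"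
    by simp
  moreover have "range (\<lambda>k::int. 0 * k) \<noteq> UNIV" by (auto simp: set_eq_iff intro!: exI[of _ 1])
  ultimately show ?thesis
    unfolding cohomologous_into_proper_subgroup_def
    by (intro exI[of _ "\<lambda>_. 0"] exI[of _ "range (\<lambda>k::int. 0 * k)"] conjI subgroup_int_multiples continuous_on_const)
next
  case True
  then obtain p d :: int where pd: "d > 0" "b / (2 * pi) = of_int p / of_int d" "coprime p d"
    by (rule Rats_cases') 
  have "d \<noteq> 1" using b pd(2) by auto
  then have d: "nat d \<ge> 2" "int (nat d) = d" using pd(1) by auto
  have "b = 2 * pi * (of_int p / of_nat (nat d))" using pd(1,2) by (simp add: field_simps)
  moreover have "coprime p (int (nat d))" unfolding d(2) by (rule pd(3))
  ultimately show ?thesis by (intro eigenfunction_rational[OF \<phi> _ d(1) _ int])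
qed

lemma summable_potential_letter_bound:
  assumes "summable_potential I E v"
  obtains b0 where "b0 summable_on I" "\<And>e. 0 \<le> b0 e" "\<And>y. y \<in> E \<Longrightarrow> exp (v y) \<le> b0 (y 0)"
proof -
  define f where "f e = exp_ext (SUP \<tau>\<in>cylinder E [e]. ereal (v \<tau>))" for e
  have fin: "infsum f I < \<infinity>" using assms by (simp add: summable_potential_def f_def[abs_def])
  have f: "f e = ennreal (enn2real (f e))" if "e \<in> I" for e
  proof -
    have "sum f {e} \<le> infsum f I" using that by (intro finite_sum_le_infsum_ennreal) auto
    then have "f e < \<infinity>" using fin by (simp add: le_less_trans)
    then show ?thesis by simp
  qed
  show thesis
  proof (rule that[of "\<lambda>e. enn2real (f e)"])
    show "(\<lambda>e. enn2real (f e)) summable_on I"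
    proof (rule nonneg_bdd_above_summable_on)
      show "bdd_above (sum (\<lambda>e. enn2real (f e)) ` {F. F \<subseteq> I \<and> finite F})"
      proof (rule bdd_aboveI2, clarify)
        fix F assume F: "F \<subseteq> I" "finite F"
        have "ennreal (\<Sum>e\<in>F. enn2real (f e)) = (\<Sum>e\<in>F. ennreal (enn2real (f e)))" by simp
        also have "\<dots> = sum f F" using F(1) f by (intro sum.cong) auto
        also have "\<dots> \<le> infsum f I" using F by (intro finite_sum_le_infsum_ennreal)
        also have "\<dots> = ennreal (enn2real (infsum f I))" using fin by simp
        finally show "(\<Sum>e\<in>F. enn2real (f e)) \<le> enn2real (infsum f I)" by simp
      qed
    qed simp
    show "exp (v y) \<le> enn2real (f (y 0))" if y: "y \<in> E" for y
    proof -
      have "ereal (v y) \<le> (SUP \<tau>\<in>cylinder E [y 0]. ereal (v \<tau>))"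
        using y by (intro SUP_upper) (simp add: cylinder_def)
      from exp_ext_mono[OF this] have "ennreal (exp (v y)) \<le> f (y 0)" by (simp add: exp_ext_def f_def)
      also have "\<dots> = ennreal (enn2real (f (y 0)))" using y by (intro f) (simp add: mem_E)
      finally show ?thesis by simp
    qed
  qed simp
qed

end

lemma pressure_empty: "pressure {} u = -\<infinity>"
proof -
  have Z: "partition_sum {} u n = 0" for n by (simp add: partition_sum_def words_def)
  have "\<forall>\<^sub>F n in sequentially. ereal (1 / real n) * ln_ext (partition_sum {} u n) = -\<infinity>"
    using eventually_gt_at_top[of "0::nat"] by eventually_elim (simp add: Z ln_ext_def)
  then have "(\<lambda>n. ereal (1 / real n) * ln_ext (partition_sum {} u n)) \<longlonglongrightarrow> -\<infinity>"
    by (rule tendsto_eventually)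
  then show ?thesis unfolding pressure_def by (rule limI)
qed

lemma id_minus_transfer_periodic:
  assumes "\<And>x. x \<in> E \<Longrightarrow> \<xi> x \<in> \<int>"
  shows "id_minus_transfer E \<eta> \<xi> (z + 2 * complex_of_real pi * \<i>) = id_minus_transfer E \<eta> \<xi> z"
proof -
  have "exp (of_real (\<eta> y) + (z + 2 * complex_of_real pi * \<i>) * of_real (\<xi> y)) = exp (of_real (\<eta> y) + z * of_real (\<xi> y))"
    if y: "y \<in> E" for y
  proof -
    obtain m :: int where m: "\<xi> y = of_int m" using assms[OF y] by (auto elim: Ints_cases)
    have "exp (2 * complex_of_real pi * \<i> * of_real (\<xi> y)) = cis (2 * pi * of_int m)"
      by (simp add: m cis_conv_exp mult_ac)
    also have "\<dots> = 1" by (rule cis_2pi_int)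
    finally show ?thesis by (simp add: distrib_right exp_add)
  qed
  then have "(\<Sum>\<^sub>\<infinity>y\<in>{y \<in> E. shift y = x}. exp (of_real (\<eta> y) + (z + 2 * complex_of_real pi * \<i>) * of_real (\<xi> y)) * g y)
      = (\<Sum>\<^sub>\<infinity>y\<in>{y \<in> E. shift y = x}. exp (of_real (\<eta> y) + z * of_real (\<xi> y)) * g y)" for x g
    by (intro infsum_cong) auto
  then show ?thesis by (simp add: id_minus_transfer_def transfer_op_def fun_eq_iff)
qed

theorem proposition2p18:
  fixes I :: "nat set" and A :: "nat \<Rightarrow> nat \<Rightarrow> nat" and E :: "(nat \<Rightarrow> nat) set"
    and \<theta> \<delta> :: real and \<eta> \<xi> :: "(nat \<Rightarrow> nat) \<Rightarrow> real"
  assumes "\<forall>i\<in>I. \<forall>j\<in>I. A i j \<in> {0, 1}"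
    and "E = shift_space I A"
    and "finitely_irreducible I A"
    and "0 < \<theta>" and "\<theta> < 1"
    and "\<eta> \<in> theta_functions \<theta> E" and "\<xi> \<in> theta_functions \<theta> E"
    and "\<forall>x\<in>E. \<xi> x \<ge> 0"
    and "pressure E (\<lambda>x. \<eta> x - \<delta> * \<xi> x) = 0"
    and "\<forall>d. pressure E (\<lambda>x. \<eta> x - d * \<xi> x) = 0 \<longrightarrow> d = \<delta>"
    and "ereal (- \<delta>) < critical_exponent I E \<eta> \<xi>"
  shows
    "(\<not> lattice_potential E \<xi> \<longrightarrow>
        (\<forall>z. Re z = - \<delta> \<and> z \<noteq> complex_of_real (- \<delta>) \<longrightarrow>
           resolvent_holomorphic_near \<theta> E \<eta> \<xi> z)) \<and>
     ((\<forall>x\<in>E. \<xi> x \<in> \<int>) \<and> \<not> cohomologous_into_proper_subgroup E \<xi> \<longrightarrow>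
        resolvent_periodic \<theta> E \<eta> \<xi> (2 * complex_of_real pi * \<i>) \<and>
        (\<forall>z. Re z = - \<delta> \<and> Im z / (2 * pi) \<notin> \<int> \<longrightarrow>
           resolvent_holomorphic_near \<theta> E \<eta> \<xi> z))"
proof -
  \<comment> \<open>The pressure on the empty shift space is \<open>-\<infinity>\<close>.\<close>
  have "E \<noteq> {}" using assms(9) by (auto simp: pressure_empty)
  then interpret markov_shift I A E \<theta>
    using assms(2-5) by unfold_locales auto
  obtain t where t: "- \<delta> < t" "summable_potential I E (\<lambda>x. \<eta> x + t * \<xi> x)"
    using assms(11) unfolding critical_exponent_def less_Sup_iff by auto
  obtain b0 where b0: "b0 summable_on I" "\<And>e. 0 \<le> b0 e" "\<And>y. y \<in> E \<Longrightarrow> exp (\<eta> y + t * \<xi> y) \<le> b0 (y 0)"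
    by (rule summable_potential_letter_bound[OF t(2)]) blast
  obtain H where H: "lip_bound \<eta> H" using assms(6) by (rule theta_functions_lip)
  obtain X where X: "lip_bound \<xi> X" using assms(7) by (rule theta_functions_lip)
  have nonneg: "\<And>x. x \<in> E \<Longrightarrow> 0 \<le> \<xi> x" using assms(8) by blast
  interpret critical_family I A E \<theta> \<eta> \<xi> t H X b0 "- \<delta>"
    using H X nonneg b0 t(1) assms(9) by unfold_locales auto
  show ?thesis
  proof (intro conjI impI allI)
    fix z assume "\<not> lattice_potential E \<xi>" "Re z = - \<delta> \<and> z \<noteq> complex_of_real (- \<delta>)"
    moreover from this have "Im z \<noteq> 0" by (auto simp: complex_eq_iff)
    ultimately show "resolvent_holomorphic_near \<theta> E \<eta> \<xi> z"
      using eigenfunction_imp_lattice by (intro resolvent_holomorphic_near_unless_eigenfunction) blast+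
  next
    assume "(\<forall>x\<in>E. \<xi> x \<in> \<int>) \<and> \<not> cohomologous_into_proper_subgroup E \<xi>"
    then have int: "\<And>x. x \<in> E \<Longrightarrow> \<xi> x \<in> \<int>" and nc: "\<not> cohomologous_into_proper_subgroup E \<xi>" by auto
    show "resolvent_periodic \<theta> E \<eta> \<xi> (2 * complex_of_real pi * \<i>)"
      by (simp add: resolvent_periodic_def resolvent_def id_minus_transfer_periodic[OF int])
    fix z assume z: "Re z = - \<delta> \<and> Im z / (2 * pi) \<notin> \<int>"
    show "resolvent_holomorphic_near \<theta> E \<eta> \<xi> z"
    proof (rule resolvent_holomorphic_near_unless_eigenfunction)
      show "Re z = - \<delta>" using z by blast
      show "\<not> phase_eigenfunction \<xi> (Im z) \<phi>" for \<phi>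
        using eigenfunction_imp_cohomologous_into_proper_subgroup[OF _ _ int nonneg X] z nc by blast
    qed
  qed
qed

end
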